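(* Let $1\leq p<\infty$, let $\Omega\subset\mathbb{R}^n$ be an open set and let $f\in RW^1_p(\Omega)$. Then $f$ is $W^1_p$-differentiable $\mathrm{cap}_p$-almost everywhere in $\Omega$. In particular, $f$ is $L_p$-differentiable $\mathrm{cap}_p$-almost everywhere in $\Omega$.
   Context: $B(x,r)$ is the open ball with center $x$ and radius $r$. Capacity: for $K\subset\mathbb{R}^n$ compact, $\mathrm{cap}_p(K)=\inf\int_{\mathbb{R}^n}|\nabla u|^p\,dx$ over all $u\in C_c^\infty(\mathbb{R}^n)$ with $u\ge1$ on $K$; for $U$ open, $\mathrm{cap}_p(U)=\sup\{\mathrm{cap}_p(K):K\subset U \text{ compact}\}$; for arbitrary $E\subset\mathbb{R}^n$, $\mathrm{cap}_p(E)=\inf\{\mathrm{cap}_p(U): E\subset U,\ U\text{ open}\}$. A property holds $\mathrm{cap}_p$-almost everywhere in $\Omega$ if it holds at every point of $\Omega$ outside a set $E\subset\Omega$ with $\mathrm{cap}_p(E)=0$. Precise representative: for $f\in L_{1,\mathrm{loc}}(\Omega)$ (componentwise for vector-valued $f$), $f^*(x)=\lim_{r\to0^+}\frac{1}{|B(x,r)|}\int_{B(x,r)}f(y)\,dy$ if the limit exists and is finite, and $f^*(x)=0$ otherwise. $L_p$-point: for $f\in L_{p,\mathrm{loc}}(\Omega)$, $x\in\Omega$ is an $L_p$-point of $f$ if the limit defining $f^*(x)$ exists and is finite and $\lim_{r\to 0^+}\frac{1}{|B(x,r)|}\int_{B(x,r)}|f(z)-f^*(x)|^p\,dz=0$.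 The space $RW^1_p(\Omega)$: the set of $f\in W^1_p(\Omega)$ whose weak gradient satisfies $\lim_{r\to0^+}\frac{1}{|B(x,r)|}\int_{B(x,r)}|\nabla f(z)-(\nabla f)^*(x)|^p\,dz=0$ for $\mathrm{cap}_p$-almost every $x\in\Omega$. $L_p$-differentiability: $f\in L_{p,\mathrm{loc}}(\Omega)$ is $L_p$-differentiable at $x\in\Omega$ if there is a linear map $L:\mathbb{R}^n\to\mathbb{R}$ with $\lim_{r\to0^+}\frac{1}{|B(x,r)|}\int_{B(x,r)}\frac{|f(z)-f^*(x)-L(z-x)|^p}{r^p}\,dz=0$. Sobolev norm: $\|f\|_{W^1_p(U)}=\sum_{|\alpha|\le1}\|D^\alpha f\|_{L_p(U)}$, with weak derivatives. $W^1_p$-differentiability: for $f\in W^1_{p,\mathrm{loc}}(\Omega)$ and $x\in\Omega$ an $L_p$-point of $f$, $f$ is $W^1_p$-differentiable at $x$ if there is a linear map $L:\mathbb{R}^n\to\mathbb{R}$ such that for every open bounded $U\subset\mathbb{R}^n$, $\lim_{h\to0}\|f_{x,h}-L\|_{W^1_p(U)}=0$, where $f_{x,h}(z)=\frac{f^*(x+hz)-f^*(x)}{h}$ for $h\in\mathbb{R}\setminus\{0\}$, $z\in\frac{\Omega-x}{h}$ (this is defined on $U$ for $|h|$ small). *)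

theory Defs
  imports "HOL-Analysis.Analysis"
begin

text \<open>
  The ambient Euclidean space is an arbitrary type \<open>'a\<close> of class \<open>euclidean_space\<close>
  (e.g. \<^typ>\<open>real ^ 'n\<close>); coordinate directions are the elements of \<^term>\<open>Basis\<close>.
  Functions on an open set \<open>\<Omega>\<close> are total functions whose values outside \<open>\<Omega>\<close> are irrelevant,
  and elements of Lebesgue and Sobolev spaces are represented by functions, not by
  almost-everywhere classes.
\<close>


subsection \<open>Smooth functions and test functions\<close>

primrec Ck :: "nat \<Rightarrow> ('a::euclidean_space \<Rightarrow> real) \<Rightarrow> bool" where
  "Ck 0 u \<longleftrightarrow> continuous_on UNIV u"
| "Ck (Suc k) u \<longleftrightarrow>
     (\<exists>u'. (\<forall>x. (u has_derivative u' x) (at x)) \<and> (\<forall>b\<in>Basis. Ck k (\<lambda>x. u' x b)))"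

text \<open>\<open>test_functions \<Omega>\<close> is \<open>C\<^sub>c\<^sup>\<infinity>(\<Omega>)\<close>, each function being extended by zero to the whole space.\<close>

definition test_functions :: "'a::euclidean_space set \<Rightarrow> ('a \<Rightarrow> real) set" where
  "test_functions \<Omega> =
     {u. (\<forall>k. Ck k u) \<and> compact (closure {x. u x \<noteq> 0}) \<and> closure {x. u x \<noteq> 0} \<subseteq> \<Omega>}"

definition partial :: "'a::euclidean_space \<Rightarrow> ('a \<Rightarrow> real) \<Rightarrow> 'a \<Rightarrow> real" where
  "partial b u x = frechet_derivative u (at x) b"

definition grad :: "('a::euclidean_space \<Rightarrow> real) \<Rightarrow> 'a \<Rightarrow> 'a" where
  "grad u x = (\<Sum>b\<in>Basis. partial b u x *\<^sub>R b)"


subsection \<open>Capacity\<close>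

definition cap_compact :: "real \<Rightarrow> 'a::euclidean_space set \<Rightarrow> ennreal" where
  "cap_compact p K =
     (INF u\<in>{u \<in> test_functions UNIV. \<forall>x\<in>K. u x \<ge> 1}.
        \<integral>\<^sup>+ x. ennreal (norm (grad u x) powr p) \<partial>lebesgue)"

definition cap_open :: "real \<Rightarrow> 'a::euclidean_space set \<Rightarrow> ennreal" where
  "cap_open p U = (SUP K\<in>{K. compact K \<and> K \<subseteq> U}. cap_compact p K)"

definition cap :: "real \<Rightarrow> 'a::euclidean_space set \<Rightarrow> ennreal" where
  "cap p E = (INF U\<in>{U. open U \<and> E \<subseteq> U}. cap_open p U)"

definition cap_ae :: "real \<Rightarrow> 'a::euclidean_space set \<Rightarrow> ('a \<Rightarrow> bool) \<Rightarrow> bool" where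
  "cap_ae p \<Omega> P \<longleftrightarrow> (\<exists>E\<subseteq>\<Omega>. cap p E = 0 \<and> (\<forall>x\<in>\<Omega> - E. P x))"


subsection \<open>Lebesgue spaces\<close>

definition Lp :: "real \<Rightarrow> 'a::euclidean_space set \<Rightarrow> ('a \<Rightarrow> real) set" where
  "Lp p A = {f. set_borel_measurable lebesgue A f \<and>
                set_integrable lebesgue A (\<lambda>x. \<bar>f x\<bar> powr p)}"

definition Lp_norm :: "real \<Rightarrow> 'a::euclidean_space set \<Rightarrow> ('a \<Rightarrow> real) \<Rightarrow> real" where
  "Lp_norm p A f = (LINT x:A|lebesgue. \<bar>f x\<bar> powr p) powr (1 / p)"

definition Lp_loc :: "real \<Rightarrow> 'a::euclidean_space set \<Rightarrow> ('a \<Rightarrow> real) set" where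
  "Lp_loc p \<Omega> = {f. \<forall>K. compact K \<and> K \<subseteq> \<Omega> \<longrightarrow> f \<in> Lp p K}"


subsection \<open>Weak derivatives and Sobolev spaces\<close>

definition is_weak_partial ::
  "'a::euclidean_space set \<Rightarrow> 'a \<Rightarrow> ('a \<Rightarrow> real) \<Rightarrow> ('a \<Rightarrow> real) \<Rightarrow> bool" where
  "is_weak_partial \<Omega> b f g \<longleftrightarrow>
     f \<in> Lp_loc 1 \<Omega> \<and> g \<in> Lp_loc 1 \<Omega> \<and>
     (\<forall>\<phi>\<in>test_functions \<Omega>.
        (LINT x:\<Omega>|lebesgue. f x * partial b \<phi> x) = - (LINT x:\<Omega>|lebesgue. g x * \<phi> x))"

text \<open>
  A weak derivative is determined only up to a null set; \<open>weak_partial\<close> chooses a representative,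
  and everything below depends only on its almost-everywhere class. If there is no weak
  derivative, \<open>weak_partial\<close> is meaningless, so below it is used only for functions required
  to be in a Sobolev space.
\<close>

definition weak_partial ::
  "'a::euclidean_space set \<Rightarrow> 'a \<Rightarrow> ('a \<Rightarrow> real) \<Rightarrow> 'a \<Rightarrow> real" where
  "weak_partial \<Omega> b f = (SOME g. is_weak_partial \<Omega> b f g)"

definition weak_grad :: "'a::euclidean_space set \<Rightarrow> ('a \<Rightarrow> real) \<Rightarrow> 'a \<Rightarrow> 'a" where
  "weak_grad \<Omega> f x = (\<Sum>b\<in>Basis. weak_partial \<Omega> b f x *\<^sub>R b)"

definition W1p :: "real \<Rightarrow> 'a::euclidean_space set \<Rightarrow> ('a \<Rightarrow> real) set" where
  "W1p p \<Omega> = {f \<in> Lp p \<Omega>. \<forall>b\<in>Basis. \<exists>g\<in>Lp p \<Omega>. is_weak_partial \<Omega> b f g}"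

definition W1p_norm :: "real \<Rightarrow> 'a::euclidean_space set \<Rightarrow> ('a \<Rightarrow> real) \<Rightarrow> real" where
  "W1p_norm p \<Omega> f = Lp_norm p \<Omega> f + (\<Sum>b\<in>Basis. Lp_norm p \<Omega> (weak_partial \<Omega> b f))"

definition W1p_loc :: "real \<Rightarrow> 'a::euclidean_space set \<Rightarrow> ('a \<Rightarrow> real) set" where
  "W1p_loc p \<Omega> =
     {f. \<forall>V. open V \<and> compact (closure V) \<and> closure V \<subseteq> \<Omega> \<longrightarrow> f \<in> W1p p V}"


subsection \<open>Averages and precise representatives\<close>

definition ball_avg :: "('a::euclidean_space \<Rightarrow> real) \<Rightarrow> 'a \<Rightarrow> real \<Rightarrow> real" where
  "ball_avg f x r = (LINT y:ball x r|lebesgue. f y) / measure lebesgue (ball x r)"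

definition precise_rep :: "('a::euclidean_space \<Rightarrow> real) \<Rightarrow> 'a \<Rightarrow> real" where
  "precise_rep f x =
     (if \<exists>l. (ball_avg f x \<longlongrightarrow> l) (at_right 0) then Lim (at_right 0) (ball_avg f x) else 0)"

definition precise_rep_vec :: "('a::euclidean_space \<Rightarrow> 'a) \<Rightarrow> 'a \<Rightarrow> 'a" where
  "precise_rep_vec F x = (\<Sum>b\<in>Basis. precise_rep (\<lambda>y. F y \<bullet> b) x *\<^sub>R b)"

definition Lp_point :: "real \<Rightarrow> 'a::euclidean_space set \<Rightarrow> ('a \<Rightarrow> real) \<Rightarrow> 'a \<Rightarrow> bool" where
  "Lp_point p \<Omega> f x \<longleftrightarrow>
     f \<in> Lp_loc p \<Omega> \<and> x \<in> \<Omega> \<and>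
     (\<exists>l. (ball_avg f x \<longlongrightarrow> l) (at_right 0)) \<and>
     (ball_avg (\<lambda>z. \<bar>f z - precise_rep f x\<bar> powr p) x \<longlongrightarrow> 0) (at_right 0)"

definition RW1p :: "real \<Rightarrow> 'a::euclidean_space set \<Rightarrow> ('a \<Rightarrow> real) set" where
  "RW1p p \<Omega> =
     {f \<in> W1p p \<Omega>.
        cap_ae p \<Omega> (\<lambda>x.
          (ball_avg (\<lambda>z. norm (weak_grad \<Omega> f z - precise_rep_vec (weak_grad \<Omega> f) x) powr p) x
             \<longlongrightarrow> 0) (at_right 0))}"


subsection \<open>Differentiability\<close>

definition Lp_differentiable ::
  "real \<Rightarrow> 'a::euclidean_space set \<Rightarrow> ('a \<Rightarrow> real) \<Rightarrow> 'a \<Rightarrow> bool" where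
  "Lp_differentiable p \<Omega> f x \<longleftrightarrow>
     f \<in> Lp_loc p \<Omega> \<and> x \<in> \<Omega> \<and>
     (\<exists>L. linear L \<and>
        ((\<lambda>r. ball_avg (\<lambda>z. \<bar>f z - precise_rep f x - L (z - x)\<bar> powr p / r powr p) x r)
           \<longlongrightarrow> 0) (at_right 0))"

definition blowup :: "('a::euclidean_space \<Rightarrow> real) \<Rightarrow> 'a \<Rightarrow> real \<Rightarrow> 'a \<Rightarrow> real" where
  "blowup f x h z = (precise_rep f (x + h *\<^sub>R z) - precise_rep f x) / h"

text \<open>
  The requirement that the differences eventually belong to \<open>W1p p U\<close> makes sure that their
  Sobolev norms are meaningful: \<^const>\<open>W1p_norm\<close> is real-valued and total, so that the limit
  alone could hold for accidental values of the norm.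
\<close>

definition W1p_differentiable ::
  "real \<Rightarrow> 'a::euclidean_space set \<Rightarrow> ('a \<Rightarrow> real) \<Rightarrow> 'a \<Rightarrow> bool" where
  "W1p_differentiable p \<Omega> f x \<longleftrightarrow>
     f \<in> W1p_loc p \<Omega> \<and> Lp_point p \<Omega> f x \<and>
     (\<exists>L. linear L \<and>
        (\<forall>U. open U \<and> bounded U \<longrightarrow>
           (\<forall>\<^sub>F h in at 0. (\<lambda>z. blowup f x h z - L z) \<in> W1p p U) \<and>
           ((\<lambda>h. W1p_norm p U (\<lambda>z. blowup f x h z - L z)) \<longlongrightarrow> 0) (at 0)))"

end

theory Submission
  imports Defs
begin

text \<open>
  The exceptional set can be taken to be the one in the definition of \<open>RW\<^sup>1\<^sub>p\<close>, so that no capacity theory is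
  needed. Let \<open>x\<close> be a point with \<open>\<nabla>f \<rightarrow> a\<close> in the sense of \<open>L\<^sub>p\<close> averages, and let
  \<open>H z = f z - a \<bullet> (z - x)\<close>. The identity \<open>f (z + v) - f z = \<integral>\<^sub>0\<^sup>1 \<nabla>f (z + sv) \<bullet> v ds\<close>, valid for almost every \<open>z\<close>
  by duality with test functions, gives the Poincare inequality for \<open>H\<close> on the balls around \<open>x\<close>, with right-hand
  side \<open>o(r\<^sup>p)\<close>. Hence the averages of \<open>H\<close> over balls of comparable radii differ by \<open>o(r)\<close>, and summing over
  dyadic scales they converge to some \<open>l\<close>, at distance \<open>o(r)\<close> from the average over the ball of radius \<open>r\<close>.
  Thus \<open>f\<^sup>*(x) = l\<close> and the average of \<open>\<bar>f z - l - a \<bullet> (z - x)\<bar>\<^sup>p\<close> is \<open>o(r\<^sup>p)\<close>.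
  Rescaling this and the assumption on \<open>\<nabla>f\<close> yields the convergence of the blow-ups, because \<open>f\<^sup>* = f\<close> almost
  everywhere by the Lebesgue differentiation theorem.
\<close>

subsection \<open>Smooth functions and test functions\<close>

text \<open>The factor r in the Poincare inequality is what makes the dyadic sum converge: averages
  of \<open>H\<close> at the radii r and r/2 differ by at most eps * r, so the differences along r,
  r/2, r/4, ... add up to at most 2 * eps * r. With only o(1) per step, the sum over infinitely many
  scales would be uncontrolled. The definitions speak of arbitrary total functions, the completed
  measure, weak derivatives picked by \<open>SOME\<close>, and real-valued integrals that are 0 for
  non-integrable functions, whereas translation, scaling and Fubini are applied to Borel functions
  on \<open>lborel\<close>. Near a good point, f and its weak gradient are therefore replaced by
  Borel functions \<open>F\<close> and \<open>G\<close>; the central estimates are made with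
  \<open>ennreal\<close> integrals, where an infinite value cannot pass for a small one, and the
  results are then carried back to \<open>lebesgue\<close>. The differentiation theorem serves
  twice: for f* = f, and, through bumps that approximate indicators of balls, for the uniqueness of
  weak derivatives, which allows the \<open>SOME\<close> to be replaced by any concrete weak
  derivative.\<close>

lemma Ck_SucI:
  assumes "\<And>x. (u has_derivative u' x) (at x)" "\<And>b. b \<in> Basis \<Longrightarrow> Ck k (\<lambda>x. u' x b)"
  shows "Ck (Suc k) u"
  using assms by auto

lemma Ck_SucE:
  assumes "Ck (Suc k) u"
  obtains u' where "\<And>x. (u has_derivative u' x) (at x)" "\<And>b. b \<in> Basis \<Longrightarrow> Ck k (\<lambda>x. u' x b)"
  using assms unfolding Ck.simps by blast

lemma Ck_Suc_imp_Ck: "Ck (Suc k) u \<Longrightarrow> Ck k u"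
proof (induction k arbitrary: u)
  case 0
  then obtain u' where "\<And>x. (u has_derivative u' x) (at x)" by (rule Ck_SucE) (rule that)
  then show ?case by (auto intro!: continuous_at_imp_continuous_on has_derivative_continuous)
next
  case (Suc k)
  from Suc.prems obtain u' where "\<And>x. (u has_derivative u' x) (at x)"
    "\<And>b. b \<in> Basis \<Longrightarrow> Ck (Suc k) (\<lambda>x. u' x b)"
    by (rule Ck_SucE) (rule that)
  then show ?case by (intro Ck_SucI[of u u'] Suc.IH)
qed

lemma Ck_imp_continuous_on: "Ck k u \<Longrightarrow> continuous_on UNIV u"
proof (induction k)
  case (Suc k)
  then show ?case using Ck_Suc_imp_Ck by blast
qed simp

lemma Ck_const: "Ck k (\<lambda>x. c)"
proof (induction k arbitrary: c)
  case (Suc k)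
  show ?case by (rule Ck_SucI[where u'="\<lambda>_ _. 0"]) (auto intro: Suc.IH)
qed simp

lemma Ck_inner: "Ck k (\<lambda>x. x \<bullet> c)"
proof (cases k)
  case (Suc j)
  have "Ck (Suc j) (\<lambda>x. x \<bullet> c)"
    by (rule Ck_SucI[where u'="\<lambda>_ v. v \<bullet> c"]) (auto intro: Ck_const derivative_eq_intros)
  then show ?thesis using Suc by simp
qed (simp add: continuous_intros)

lemma Ck_add: "Ck k u \<Longrightarrow> Ck k v \<Longrightarrow> Ck k (\<lambda>x. u x + v x)"
proof (induction k arbitrary: u v)
  case (Suc k)
  obtain u' where u: "\<And>x. (u has_derivative u' x) (at x)" "\<And>b. b \<in> Basis \<Longrightarrow> Ck k (\<lambda>x. u' x b)"
    using Suc.prems(1) by (rule Ck_SucE) (rule that)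
  obtain v' where v: "\<And>x. (v has_derivative v' x) (at x)" "\<And>b. b \<in> Basis \<Longrightarrow> Ck k (\<lambda>x. v' x b)"
    using Suc.prems(2) by (rule Ck_SucE) (rule that)
  show ?case
    by (rule Ck_SucI[OF has_derivative_add[OF u(1) v(1)]]) (intro Suc.IH u(2) v(2))
qed (auto intro!: continuous_intros)

lemma Ck_mult: "Ck k u \<Longrightarrow> Ck k v \<Longrightarrow> Ck k (\<lambda>x. u x * v x)"
proof (induction k arbitrary: u v)
  case (Suc k)
  obtain u' where u: "\<And>x. (u has_derivative u' x) (at x)" "\<And>b. b \<in> Basis \<Longrightarrow> Ck k (\<lambda>x. u' x b)"
    using Suc.prems(1) by (rule Ck_SucE) (rule that)
  obtain v' where v: "\<And>x. (v has_derivative v' x) (at x)" "\<And>b. b \<in> Basis \<Longrightarrow> Ck k (\<lambda>x. v' x b)"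
    using Suc.prems(2) by (rule Ck_SucE) (rule that)
  show ?case
    by (rule Ck_SucI[OF has_derivative_mult[OF u(1) v(1)]])
      (intro Ck_add Suc.IH u(2) v(2) Suc.prems[THEN Ck_Suc_imp_Ck])
qed (auto intro!: continuous_intros)

lemma Ck_affine:
  assumes "Ck k u" shows "Ck k (\<lambda>x. u (c + h *\<^sub>R x))"
  using assms
proof (induction k arbitrary: u)
  case 0
  then have u: "continuous_on UNIV u" by simp
  show ?case unfolding Ck.simps
    by (rule continuous_on_compose2[OF u]) (auto intro!: continuous_intros)
next
  case (Suc k)
  obtain u' where u: "\<And>x. (u has_derivative u' x) (at x)" "\<And>b. b \<in> Basis \<Longrightarrow> Ck k (\<lambda>x. u' x b)"
    using Suc.prems by (rule Ck_SucE) (rule that)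
  have "((\<lambda>x. u (c + h *\<^sub>R x)) has_derivative (\<lambda>v. h * u' (c + h *\<^sub>R x) v)) (at x)" for x
  proof -
    have "((\<lambda>x. u (c + h *\<^sub>R x)) has_derivative (\<lambda>v. u' (c + h *\<^sub>R x) (h *\<^sub>R v))) (at x)"
      by (rule has_derivative_compose[where f="\<lambda>x. c + h *\<^sub>R x" and g=u, OF _ u(1)])
        (auto intro!: derivative_eq_intros)
    moreover have "u' y (h *\<^sub>R v) = h * u' y v" for y v
      using linear_cmul[OF has_derivative_linear[OF u(1)[of y]], of h v] by simp
    ultimately show ?thesis by simp
  qed
  then show ?case
    by (rule Ck_SucI[where u'="\<lambda>x v. h * u' (c + h *\<^sub>R x) v"]) (intro Ck_mult[OF Ck_const] Suc.IH[OF u(2)])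
qed

abbreviation smooth :: "('a::euclidean_space \<Rightarrow> real) \<Rightarrow> bool" where
  "smooth u \<equiv> \<forall>k. Ck k u"

text \<open>The witness hidden in \<open>Ck\<close> must be the Frechet derivative, so its
  components are the functions \<open>partial b u\<close>. This makes smoothness pass to
  \<open>partial b u\<close>.\<close>

lemma smooth_has_derivative:
  assumes "Ck (Suc k) u"
  shows "(u has_derivative (\<lambda>v. \<Sum>b\<in>Basis. (v \<bullet> b) * partial b u x)) (at x)"
    and "b \<in> Basis \<Longrightarrow> Ck k (partial b u)"
proof -
  obtain u' where *: "\<And>x. (u has_derivative u' x) (at x)" "\<And>b. b \<in> Basis \<Longrightarrow> Ck k (\<lambda>x. u' x b)"
    using assms by auto
  have u': "frechet_derivative u (at x) = u' x" for x
    using *(1) by (metis frechet_derivative_at)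
  have "u' x v = (\<Sum>b\<in>Basis. (v \<bullet> b) * partial b u x)" for v
  proof -
    have "linear (u' x)" using *(1) has_derivative_linear by blast
    then have "u' x (\<Sum>b\<in>Basis. (v \<bullet> b) *\<^sub>R b) = (\<Sum>b\<in>Basis. (v \<bullet> b) * u' x b)"
      by (simp add: linear_sum linear_cmul)
    then show ?thesis by (simp add: partial_def u' euclidean_representation)
  qed
  then show "(u has_derivative (\<lambda>v. \<Sum>b\<in>Basis. (v \<bullet> b) * partial b u x)) (at x)"
    using *(1)[of x] by presburger
  show "Ck k (partial b u)" if "b \<in> Basis"
    using *(2)[OF that] by (simp add: partial_def[abs_def] u')
qed

lemma partial_eqI:
  assumes "(u has_derivative D) (at x)" shows "partial b u x = D b"
  using frechet_derivative_at[OF assms] by (simp add: partial_def)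

lemma zero_outside_closure_support: "x \<notin> closure {x. \<phi> x \<noteq> 0} \<Longrightarrow> \<phi> x = 0"
  using subsetD[OF closure_subset, of x "{x. \<phi> x \<noteq> 0}"] by auto

lemma test_functionsD:
  assumes "\<phi> \<in> test_functions U"
  shows "smooth \<phi>" "compact (closure {x. \<phi> x \<noteq> 0})" "closure {x. \<phi> x \<noteq> 0} \<subseteq> U"
    "continuous_on UNIV \<phi>" "\<phi> \<in> borel_measurable borel"
    "x \<notin> U \<Longrightarrow> \<phi> x = 0"
    "(\<phi> has_derivative (\<lambda>v. \<Sum>b\<in>Basis. (v \<bullet> b) * partial b \<phi> x)) (at x)"
proof -
  show 1: "smooth \<phi>" "compact (closure {x. \<phi> x \<noteq> 0})" "closure {x. \<phi> x \<noteq> 0} \<subseteq> U"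
    using assms by (auto simp: test_functions_def)
  then show "continuous_on UNIV \<phi>" using Ck_imp_continuous_on by blast
  then show "\<phi> \<in> borel_measurable borel" by (simp add: borel_measurable_continuous_onI)
  show "x \<notin> U \<Longrightarrow> \<phi> x = 0" using 1(3) zero_outside_closure_support[of x \<phi>] by blast
  show "(\<phi> has_derivative (\<lambda>v. \<Sum>b\<in>Basis. (v \<bullet> b) * partial b \<phi> x)) (at x)"
    using 1(1) smooth_has_derivative(1) by blast
qed

text \<open>Any compact set off which u vanishes may stand in for the support: it is closed, hence
  contains the closure of the nonzero set.\<close>

lemma test_functionsI:
  assumes "smooth u" "compact K" "K \<subseteq> U" "\<And>x. x \<notin> K \<Longrightarrow> u x = 0"
  shows "u \<in> test_functions U"
proof -
  have "closure {x. u x \<noteq> 0} \<subseteq> K"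
    using assms by (intro closure_minimal) (auto intro: compact_imp_closed)
  then show ?thesis using assms
    using compact_Int_closed[of K "closure {x. u x \<noteq> 0}"] by (auto simp: test_functions_def inf.absorb2)
qed

lemma test_functions_mono: "U \<subseteq> V \<Longrightarrow> test_functions U \<subseteq> test_functions V"
  by (auto simp: test_functions_def)

lemma partial_in_test_functions:
  assumes "\<phi> \<in> test_functions U" "b \<in> Basis"
  shows "partial b \<phi> \<in> test_functions U"
proof (rule test_functionsI)
  note \<phi> = test_functionsD[OF assms(1)]
  show "smooth (partial b \<phi>)" using \<phi>(1) smooth_has_derivative(2) assms(2) by blast
  show "compact (closure {x. \<phi> x \<noteq> 0})" "closure {x. \<phi> x \<noteq> 0} \<subseteq> U" by fact+
  fix x assume x: "x \<notin> closure {x. \<phi> x \<noteq> 0}"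
  have "(\<phi> has_derivative (\<lambda>_. 0)) (at x)"
  proof (rule has_derivative_transform_within_open[of "\<lambda>_. 0"])
    show "open (- closure {x. \<phi> x \<noteq> 0})" by auto
    show "\<And>y. y \<in> - closure {x. \<phi> x \<noteq> 0} \<Longrightarrow> 0 = \<phi> y"
      using zero_outside_closure_support[of _ \<phi>] by (metis ComplD)
  qed (use x in auto)
  then show "partial b \<phi> x = 0" by (simp add: partial_eqI)
qed

lemma mult_in_test_functions:
  assumes "smooth u" "\<phi> \<in> test_functions U"
  shows "(\<lambda>x. u x * \<phi> x) \<in> test_functions U"
proof (rule test_functionsI)
  note \<phi> = test_functionsD[OF assms(2)]
  show "smooth (\<lambda>x. u x * \<phi> x)" using assms(1) \<phi>(1) Ck_mult by blast
  show "compact (closure {x. \<phi> x \<noteq> 0})" "closure {x. \<phi> x \<noteq> 0} \<subseteq> U" by fact+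
  show "u x * \<phi> x = 0" if "x \<notin> closure {x. \<phi> x \<noteq> 0}" for x
    using zero_outside_closure_support[OF that] by simp
qed

text \<open>The new support is the image of the old one under the inverse affine map. The case
  \<open>h = 1\<close> gives the translates used in the duality argument, the general case the
  rescaling used for blow-ups.\<close>

lemma affine_in_test_functions:
  assumes "\<phi> \<in> test_functions U" "h \<noteq> 0" "\<And>y. c + h *\<^sub>R y \<in> U \<Longrightarrow> y \<in> V"
  shows "(\<lambda>y. \<phi> (c + h *\<^sub>R y)) \<in> test_functions V"
proof (rule test_functionsI)
  note \<phi> = test_functionsD[OF assms(1)]
  let ?K = "(\<lambda>z. (1 / h) *\<^sub>R (z - c)) ` closure {x. \<phi> x \<noteq> 0}"
  show "smooth (\<lambda>y. \<phi> (c + h *\<^sub>R y))" using \<phi>(1) Ck_affine by blast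
  show "compact ?K"
    by (intro compact_continuous_image continuous_intros \<phi>)
  show "?K \<subseteq> V" using \<phi>(3) assms(2) by (auto intro!: assms(3))
  show "\<phi> (c + h *\<^sub>R y) = 0" if "y \<notin> ?K" for y
  proof (rule ccontr)
    assume "\<phi> (c + h *\<^sub>R y) \<noteq> 0"
    then have "c + h *\<^sub>R y \<in> closure {x. \<phi> x \<noteq> 0}"
      using zero_outside_closure_support[of "c + h *\<^sub>R y" \<phi>] by blast
    moreover have "y = (1 / h) *\<^sub>R ((c + h *\<^sub>R y) - c)" using assms(2) by simp
    ultimately show False using that by blast
  qed
qed

lemma partial_affine:
  assumes "\<phi> \<in> test_functions U"
  shows "partial b (\<lambda>y. \<phi> (c + h *\<^sub>R y)) y = h * partial b \<phi> (c + h *\<^sub>R y)"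
proof -
  note \<phi> = test_functionsD(7)[OF assms, of "c + h *\<^sub>R y"]
  have "((\<lambda>y. \<phi> (c + h *\<^sub>R y)) has_derivative
      (\<lambda>v. \<Sum>b\<in>Basis. ((h *\<^sub>R v) \<bullet> b) * partial b \<phi> (c + h *\<^sub>R y))) (at y)"
    by (rule has_derivative_compose[where f="\<lambda>y. c + h *\<^sub>R y" and g=\<phi>, OF _ \<phi>])
      (auto intro!: derivative_eq_intros)
  then have "partial b (\<lambda>y. \<phi> (c + h *\<^sub>R y)) y =
      (\<Sum>b'\<in>Basis. ((h *\<^sub>R b) \<bullet> b') * partial b' \<phi> (c + h *\<^sub>R y))"
    by (rule partial_eqI)
  also have "\<dots> = h * (\<Sum>b'\<in>Basis. (b \<bullet> b') * partial b' \<phi> (c + h *\<^sub>R y))"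
    by (simp add: sum_distrib_left mult.assoc)
  also have "\<dots> = h * partial b \<phi> (c + h *\<^sub>R y)"
    by (simp only: partial_eqI[OF \<phi>, of b])
  finally show ?thesis .
qed

lemma test_function_bounded:
  assumes "\<phi> \<in> test_functions U"
  obtains C where "\<And>x. \<bar>\<phi> x\<bar> \<le> C"
proof -
  note \<phi> = test_functionsD[OF assms]
  have "bounded (\<phi> ` closure {x. \<phi> x \<noteq> 0})"
    by (intro compact_imp_bounded compact_continuous_image continuous_on_subset[OF \<phi>(4)] \<phi>(2)) auto
  then obtain C where C: "\<And>x. x \<in> closure {x. \<phi> x \<noteq> 0} \<Longrightarrow> \<bar>\<phi> x\<bar> \<le> C"
    by (auto simp: bounded_iff)
  have "\<bar>\<phi> x\<bar> \<le> max C 0" for x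
  proof (cases "x \<in> closure {x. \<phi> x \<noteq> 0}")
    case True
    then show ?thesis by (intro max.coboundedI1 C)
  next
    case False
    then have "\<phi> x = 0" by (rule zero_outside_closure_support)
    then show ?thesis by simp
  qed
  then show ?thesis by (rule that)
qed

lemma integrable_test_function:
  assumes "\<phi> \<in> test_functions U"
  shows "integrable lborel \<phi>"
proof -
  note \<phi> = test_functionsD[OF assms]
  have "set_integrable lborel (closure {x. \<phi> x \<noteq> 0}) \<phi>"
    unfolding set_integrable_def
    by (rule borel_integrable_compact[OF \<phi>(2)]) (auto intro: continuous_on_subset[OF \<phi>(4)])
  moreover have "(\<lambda>x. indicator (closure {x. \<phi> x \<noteq> 0}) x *\<^sub>R \<phi> x) = \<phi>"
  proof
    show "indicator (closure {x. \<phi> x \<noteq> 0}) x *\<^sub>R \<phi> x = \<phi> x" for x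
    using zero_outside_closure_support[of x \<phi>] by (auto simp: indicator_def)
  qed
  ultimately show ?thesis by (simp only: set_integrable_def)
qed

lemma integrable_mult_test_function:
  assumes "integrable lborel F" "\<phi> \<in> test_functions U"
  shows "integrable lborel (\<lambda>x. F x * \<phi> x)"
proof -
  obtain C where C: "\<And>x. \<bar>\<phi> x\<bar> \<le> C" by (rule test_function_bounded[OF assms(2)]) (rule that)
  have [measurable]: "\<phi> \<in> borel_measurable borel" using test_functionsD(5)[OF assms(2)] .
  have [measurable]: "F \<in> borel_measurable borel" using assms(1) by auto
  show ?thesis
  proof (rule Bochner_Integration.integrable_bound)
    show "integrable lborel (\<lambda>x. C * F x)" using assms by auto
    show "AE x in lborel. norm (F x * \<phi> x) \<le> norm (C * F x)"
    proof (intro AE_I2)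
      fix x
      have "\<bar>\<phi> x\<bar> * \<bar>F x\<bar> \<le> \<bar>C\<bar> * \<bar>F x\<bar>"
        using C[of x] by (intro mult_right_mono) auto
      then show "norm (F x * \<phi> x) \<le> norm (C * F x)" by (simp add: abs_mult mult.commute)
    qed
  qed measurable
qed

text \<open>The functions \<open>s\<^sup>-\<^sup>j exp (-1/s)\<close> are closed under differentiation up to linear combinations,
  which makes an induction on the order of differentiability possible.\<close>

definition exp_cutoff :: "nat \<Rightarrow> real \<Rightarrow> real" where
  "exp_cutoff j s = (if s \<le> 0 then 0 else (1 / s) ^ j * exp (- (1 / s)))"

lemma exp_cutoff_tendsto_0: "(exp_cutoff j \<longlongrightarrow> 0) (at_right 0)"
proof -
  have "((\<lambda>t::real. t ^ j * exp (- t)) \<longlongrightarrow> 0) at_top"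
    using tendsto_power_div_exp_0[of j] by (simp add: exp_minus field_simps)
  then have "((\<lambda>s::real. (inverse s) ^ j * exp (- (inverse s))) \<longlongrightarrow> 0) (at_right 0)"
    by (rule filterlim_compose[OF _ filterlim_inverse_at_top_right])
  then show ?thesis
    by (rule Lim_transform_eventually) (auto simp: eventually_at_filter exp_cutoff_def inverse_eq_divide)
qed

text \<open>With t = 1/s one has dt/ds = -t^2, so the derivative of t^j exp(-t) is (t^(j+2) - j
  t^(j+1)) exp(-t). At s = 0 the right difference quotient is \<open>exp_cutoff (Suc j)\<close>,
  which tends to 0, and the left one vanishes.\<close>

lemma exp_cutoff_has_derivative:
  "(exp_cutoff j has_real_derivative (exp_cutoff (j + 2) s - real j * exp_cutoff (j + 1) s)) (at s)"
proof -
  consider "s < 0" | "s = 0" | "s > 0" by linarith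
  then show ?thesis
  proof cases
    case 1
    have "(exp_cutoff j has_real_derivative 0) (at s)"
      by (rule has_field_derivative_transform_within_open[of "\<lambda>_. 0" _ _ "{..<0}"])
        (use 1 in \<open>auto simp: exp_cutoff_def\<close>)
    with 1 show ?thesis by (simp add: exp_cutoff_def)
  next
    case 2
    have "((\<lambda>h. (exp_cutoff j (0 + h) - exp_cutoff j 0) / h) \<longlongrightarrow> 0) (at_right 0)"
      by (rule Lim_transform_eventually[OF exp_cutoff_tendsto_0[of "Suc j"]])
        (auto simp: eventually_at_filter exp_cutoff_def)
    moreover have "((\<lambda>h. (exp_cutoff j (0 + h) - exp_cutoff j 0) / h) \<longlongrightarrow> 0) (at_left 0)"
      by (rule Lim_transform_eventually[OF tendsto_const]) (auto simp: eventually_at_filter exp_cutoff_def)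
    ultimately have "((\<lambda>h. (exp_cutoff j (0 + h) - exp_cutoff j 0) / h) \<longlongrightarrow> 0) (at 0)"
      by (simp add: filterlim_split_at)
    with 2 show ?thesis by (simp add: DERIV_def exp_cutoff_def)
  next
    case 3
    have "((\<lambda>s. (1 / s) ^ j * exp (- (1 / s))) has_real_derivative
        (exp_cutoff (j + 2) s - real j * exp_cutoff (j + 1) s)) (at s)"
    proof -
      have t: "((\<lambda>s. 1 / s) has_real_derivative - ((1 / s)\<^sup>2)) (at s)"
        using 3 by (auto intro!: derivative_eq_intros simp: power2_eq_square)
      have "((\<lambda>s. (1 / s) ^ j * exp (- (1 / s))) has_real_derivative
        (real j * ((- ((1 / s)\<^sup>2)) * (1 / s) ^ (j - 1))) * exp (- (1 / s))
          + (exp (- (1 / s)) * (- (- ((1 / s)\<^sup>2)))) * (1 / s) ^ j) (at s)"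
        using DERIV_power[OF t, of j] t
        by (intro DERIV_mult DERIV_fun_exp DERIV_minus) (simp_all only: One_nat_def)
      \<comment> \<open>For \<open>j = 0\<close> the truncated exponent \<open>j - 1\<close> does no
        harm, because it comes with the factor j.\<close>
      moreover have "real j * ((- (t\<^sup>2)) * t ^ (j - 1)) * e + (e * (- (- (t\<^sup>2)))) * t ^ j
          = t ^ (j + 2) * e - real j * (t ^ (j + 1) * e)" for t e :: real
        by (cases j) (simp_all add: power2_eq_square)
      ultimately show ?thesis using 3 by (simp only: exp_cutoff_def) simp
    qed
    then show ?thesis
      by (rule has_field_derivative_transform_within_open[of _ _ _ "{0<..}"])
        (use 3 in \<open>auto simp: exp_cutoff_def\<close>)
  qed
qed

text \<open>The induction on k is for all j at once, since one derivative of
  \<open>exp_cutoff j\<close> produces the indices j + 1 and j + 2.\<close>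

lemma Ck_exp_cutoff_compose:
  assumes "smooth q" shows "Ck k (\<lambda>x. exp_cutoff j (q x))"
proof (induction k arbitrary: j)
  case 0
  have "continuous_on UNIV (exp_cutoff j)"
    by (rule DERIV_continuous_on[OF has_field_derivative_at_within[OF exp_cutoff_has_derivative]])
  moreover have "continuous_on UNIV q" using assms Ck_imp_continuous_on by blast
  ultimately show ?case unfolding Ck.simps by (rule continuous_on_compose2) simp
next
  case (Suc k)
  let ?e = "\<lambda>x. exp_cutoff (j + 2) (q x) + (- real j) * exp_cutoff (j + 1) (q x)"
  have *: "((\<lambda>x. exp_cutoff j (q x)) has_derivative (\<lambda>v. ?e x * (\<Sum>b\<in>Basis. (v \<bullet> b) * partial b q x))) (at x)" for x
    using has_derivative_compose[OF smooth_has_derivative(1)[OF spec[OF assms]]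
        exp_cutoff_has_derivative[of j "q x", unfolded has_field_derivative_def]]
    by simp
  have "Ck k ?e"
    by (intro Ck_add Ck_mult[OF Ck_const] Suc.IH)
  moreover have "Ck k (\<lambda>x. \<Sum>b'\<in>Basis. (b \<bullet> b') * partial b' q x)" if "b \<in> Basis" for b
  proof -
    have "(\<Sum>b'\<in>Basis. (b \<bullet> b') * partial b' q x) = partial b q x" for x
      using that by (subst sum.cong[OF refl, of _ _ "\<lambda>b'. if b' = b then partial b' q x else 0"])
        (auto simp: inner_Basis)
    then show ?thesis using smooth_has_derivative(2)[OF spec[OF assms] that] by simp
  qed
  ultimately show ?case
    by (intro Ck_SucI[OF *] Ck_mult)
qed

lemma smooth_ball_quadratic: "smooth (\<lambda>y. c * (r\<^sup>2 - (norm (y - x))\<^sup>2))"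
proof -
  \<comment> \<open>The squared norm is expanded into coordinates because \<open>Ck\<close> has been
    shown closed under sums and products.\<close>
  have eq: "(\<lambda>y. c * (r\<^sup>2 - (norm (y - x))\<^sup>2)) = (\<lambda>y. c * r\<^sup>2 + (- c) *
     (\<Sum>b\<in>Basis. ((y \<bullet> b) + - (x \<bullet> b)) * ((y \<bullet> b) + - (x \<bullet> b))))"
  proof
    fix y
    have "(norm (y - x))\<^sup>2 = (\<Sum>b\<in>Basis. ((y \<bullet> b) + - (x \<bullet> b)) * ((y \<bullet> b) + - (x \<bullet> b)))"
      unfolding power2_norm_eq_inner by (subst euclidean_inner) (simp add: inner_diff_left)
    moreover have "c * (r\<^sup>2 - S) = c * r\<^sup>2 + (- c) * S" for S
      by (simp add: right_diff_distrib)
    ultimately show "c * (r\<^sup>2 - (norm (y - x))\<^sup>2) = c * r\<^sup>2 + (- c) *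
        (\<Sum>b\<in>Basis. ((y \<bullet> b) + - (x \<bullet> b)) * ((y \<bullet> b) + - (x \<bullet> b)))"
      by (simp only:)
  qed
  have "Ck k (\<lambda>y. \<Sum>b\<in>B. ((y \<bullet> b) + - (x \<bullet> b)) * ((y \<bullet> b) + - (x \<bullet> b)))" if "finite B" for B k
    using that
  proof induction
    case (insert b B)
    show ?case
      unfolding sum.insert[OF insert.hyps] by (intro Ck_const Ck_add Ck_mult Ck_inner insert.IH)
  qed (simp add: Ck_const)
  then show ?thesis unfolding eq by (intro allI Ck_const Ck_add Ck_mult) auto
qed

text \<open>Inside the ball this is exp(-1 / ((k+1) (r^2 - |y-x|^2))), outside it is 0. The factor k
  + 1 drives the exponent to 0, so the bumps tend to the indicator of the open ball.\<close>

definition ball_bump :: "'a::euclidean_space \<Rightarrow> real \<Rightarrow> nat \<Rightarrow> 'a \<Rightarrow> real" where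
  "ball_bump x r k y = exp_cutoff 0 (real (Suc k) * (r\<^sup>2 - (norm (y - x))\<^sup>2))"

lemma ball_bump_in_test_functions:
  assumes "cball x r \<subseteq> U" "r > 0"
  shows "ball_bump x r k \<in> test_functions U"
proof (rule test_functionsI)
  show "smooth (ball_bump x r k)"
    unfolding ball_bump_def[abs_def] by (intro allI Ck_exp_cutoff_compose smooth_ball_quadratic)
  show "ball_bump x r k y = 0" if "y \<notin> cball x r" for y
  proof -
    have "r\<^sup>2 \<le> (norm (y - x))\<^sup>2" using that assms by (intro power_mono) (auto simp: dist_norm norm_minus_commute)
    then show ?thesis by (auto simp: ball_bump_def exp_cutoff_def mult_nonneg_nonpos)
  qed
qed (use assms in auto)

lemma ball_bump_bounded: "\<bar>ball_bump x r k y\<bar> \<le> 1"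
  by (auto simp: ball_bump_def exp_cutoff_def not_le)

lemma ball_bump_tendsto:
  assumes "r > 0" shows "(\<lambda>k. ball_bump x r k y) \<longlonglongrightarrow> indicator (ball x r) y"
proof (cases "y \<in> ball x r")
  case True
  then have "norm (y - x) < r" by (simp add: dist_norm norm_minus_commute)
  then have *: "0 < r\<^sup>2 - (norm (y - x))\<^sup>2" using assms by (simp add: power_strict_mono)
  then have "(\<lambda>k. exp (- (1 / (real (Suc k) * (r\<^sup>2 - (norm (y - x))\<^sup>2))))) \<longlonglongrightarrow> exp (- 0)"
  proof (intro tendsto_intros)
    have "(\<lambda>k. 1 / real (Suc k) * (1 / (r\<^sup>2 - (norm (y - x))\<^sup>2))) \<longlonglongrightarrow> 0 * (1 / (r\<^sup>2 - (norm (y - x))\<^sup>2))"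
      by (intro tendsto_mult tendsto_const) (use LIMSEQ_inverse_real_of_nat in \<open>simp add: inverse_eq_divide\<close>)
    then show "(\<lambda>k. 1 / (real (Suc k) * (r\<^sup>2 - (norm (y - x))\<^sup>2))) \<longlonglongrightarrow> 0" by simp
  qed
  moreover have "\<not> real (Suc k) * (r\<^sup>2 - (norm (y - x))\<^sup>2) \<le> 0" for k
    using * by (simp only: not_le zero_less_mult_iff) simp
  ultimately show ?thesis using True by (simp add: ball_bump_def exp_cutoff_def del: of_nat_Suc)
next
  case False
  then have "r \<le> norm (y - x)" by (simp add: dist_norm norm_minus_commute)
  then have "r\<^sup>2 \<le> (norm (y - x))\<^sup>2" using assms by (intro power_mono) auto
  then have "ball_bump x r k y = 0" for k
    by (auto simp: ball_bump_def exp_cutoff_def mult_nonneg_nonpos)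
  then show ?thesis using False by simp
qed

subsection \<open>The Lebesgue differentiation theorem\<close>

lemma set_integrable_lborel_subset:
  fixes h :: "'a::euclidean_space \<Rightarrow> 'b::{banach, second_countable_topology}"
  assumes "integrable lborel h" "A \<in> sets borel"
  shows "set_integrable lborel A h"
  unfolding set_integrable_def using assms by (intro integrable_mult_indicator) auto

lemma set_integrable_const_ball: "set_integrable lborel (ball (x::'a::euclidean_space) r) (\<lambda>_. c :: real)"
  using emeasure_lborel_ball_finite[of x r]
  by (simp add: set_integrable_def integrable_indicator_iff)

text \<open>The integral of \<open>h - b\<close> over the ball is positive, so the negative part has
  no more mass than the positive part. In this form, with nonnegative integrals, the inequality can
  be summed over countably many disjoint balls.\<close>

lemma ball_average_excess:
  fixes h :: "'a::euclidean_space \<Rightarrow> real"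
  assumes h: "integrable lborel h"
    and gt: "b * measure lborel (ball x r) < (LINT y:ball x r|lborel. h y)"
  shows "(\<integral>\<^sup>+y\<in>ball x r. ennreal (b - h y) \<partial>lborel) \<le> (\<integral>\<^sup>+y\<in>ball x r. ennreal (h y - b) \<partial>lborel)"
proof -
  let ?B = "ball x r" and ?f = "\<lambda>y. indicator (ball x r) y * (h y - b)"
  have [measurable]: "h \<in> borel_measurable borel" using h by auto
  have hB: "set_integrable lborel ?B h" by (rule set_integrable_lborel_subset[OF h]) auto
  have cB: "set_integrable lborel ?B (\<lambda>_. b)"
    by (rule set_integrable_const_ball)
  have f: "integrable lborel ?f"
    using set_integral_diff(1)[OF hB cB] by (simp add: set_integrable_def)
  have "integral\<^sup>L lborel ?f = (LINT y:?B|lborel. h y) - (LINT y:?B|lborel. b)"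
    using set_integral_diff(2)[OF hB cB] by (simp add: set_lebesgue_integral_def)
  also have "(LINT y:?B|lborel. b) = b * measure lborel ?B"
    by (simp add: set_lebesgue_integral_def)
  finally have "0 \<le> integral\<^sup>L lborel ?f" using gt by simp
  moreover have "(\<integral>\<^sup>+ y. ennreal (?f y) \<partial>lborel) < \<infinity>" "(\<integral>\<^sup>+ y. ennreal (- ?f y) \<partial>lborel) < \<infinity>"
    using integrableD(2)[OF f] integrableD(3)[OF f] by (auto simp: top.not_eq_extremum)
  ultimately have le: "enn2real (\<integral>\<^sup>+ y. ennreal (- ?f y) \<partial>lborel)
      \<le> enn2real (\<integral>\<^sup>+ y. ennreal (?f y) \<partial>lborel)"
    and fin: "(\<integral>\<^sup>+ y. ennreal (?f y) \<partial>lborel) < top" "(\<integral>\<^sup>+ y. ennreal (- ?f y) \<partial>lborel) < top"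
    using real_lebesgue_integral_def[OF f] unfolding infinity_ennreal_def by auto
  have "(\<integral>\<^sup>+ y. ennreal (- ?f y) \<partial>lborel) \<le> (\<integral>\<^sup>+ y. ennreal (?f y) \<partial>lborel)"
    using ennreal_leI[OF le] unfolding ennreal_enn2real[OF fin(1)] ennreal_enn2real[OF fin(2)] .
  moreover have "(\<integral>\<^sup>+ y. ennreal (- ?f y) \<partial>lborel) = (\<integral>\<^sup>+y\<in>?B. ennreal (b - h y) \<partial>lborel)"
    "(\<integral>\<^sup>+ y. ennreal (?f y) \<partial>lborel) = (\<integral>\<^sup>+y\<in>?B. ennreal (h y - b) \<partial>lborel)"
    by (auto intro!: nn_integral_cong simp: indicator_def)
  ultimately show ?thesis by simp
qed

text \<open>Cover T up to a null set by disjoint balls on which the average of h exceeds b, all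
  inside an open set that barely exceeds \<open>{h < a}\<close>. On their union the mass of (b - h)+
  is at most that of (h - b)+, and the latter lives in the small excess set. Since T is not known to
  be measurable, smallness is shown through measurable supersets.\<close>

lemma negligible_upper_average:
  fixes h :: "'a::euclidean_space \<Rightarrow> real" and a b R :: real
  assumes h: "integrable lborel h" and ab: "a < b"
  defines "T \<equiv> {x \<in> ball 0 R. h x < a \<and>
      (\<forall>d>0. \<exists>r>0. r < d \<and> b * measure lborel (ball x r) < (LINT y:ball x r|lborel. h y))}"
  shows "negligible T"
  unfolding negligible_outer_le
proof (intro allI impI)
  fix e :: real assume e: "e > 0"
  have hm[measurable]: "h \<in> borel_measurable borel" using h by auto
  define A where "A = {x \<in> ball 0 R. h x < a}"
  have A[measurable]: "A \<in> sets borel" unfolding A_def by measurable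
  \<comment> \<open>The density dominates (h - b)+ on the ball, and the restriction to the ball
    makes \<open>M\<close> finite, so that outer regularity applies.\<close>
  define M where "M = density lborel (\<lambda>x. ennreal (\<bar>h x\<bar> + \<bar>b\<bar>) * indicator (ball 0 R) x)"
  define P where "P = density lborel (\<lambda>x. ennreal (h x - b))"
  define N where "N = density lborel (\<lambda>x. ennreal (b - h x))"
  have sets[measurable_cong, simp]: "sets M = sets borel" "sets P = sets borel" "sets N = sets borel"
    by (simp_all add: M_def P_def N_def)
  have "integrable lborel (\<lambda>x. indicator (ball 0 R) x *\<^sub>R (\<bar>h x\<bar> + \<bar>b\<bar>))"
    using set_integral_add(1)[OF set_integrable_lborel_subset[OF integrable_abs[OF h]] set_integrable_const_ball,
        of 0 R "\<bar>b\<bar>"]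
    by (simp add: set_integrable_def)
  then have "(\<integral>\<^sup>+x. ennreal (indicator (ball 0 R) x *\<^sub>R (\<bar>h x\<bar> + \<bar>b\<bar>)) \<partial>lborel) < \<infinity>"
    by (simp add: nn_integral_eq_integral)
  also have "(\<integral>\<^sup>+x. ennreal (indicator (ball 0 R) x *\<^sub>R (\<bar>h x\<bar> + \<bar>b\<bar>)) \<partial>lborel) = emeasure M (space M)"
    unfolding M_def by (subst emeasure_density) (auto intro!: nn_integral_cong simp: indicator_def)
  finally have M_fin: "emeasure M (space M) \<noteq> \<infinity>" by simp
  interpret finite_measure M by (rule finite_measureI) (rule M_fin)
  have "emeasure M A = (INF U\<in>{U. A \<subseteq> U \<and> open U}. emeasure M U)"
    by (rule outer_regular[OF sets(1) M_fin A])
  \<comment> \<open>The tolerance \<open>e * (b - a)\<close> becomes e after the final division by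
    \<open>b - a\<close>.\<close>
  moreover have "emeasure M A < emeasure M A + ennreal (e * (b - a))"
    using e ab by (simp add: emeasure_eq_measure ennreal_less_iff flip: ennreal_plus)
  ultimately obtain U where U: "A \<subseteq> U" "open U" "emeasure M U < emeasure M A + ennreal (e * (b - a))"
    by (auto simp: INF_less_iff)
  define U' where "U' = U \<inter> ball 0 R"
  have U': "open U'" "A \<subseteq> U'" "U' \<subseteq> ball 0 R" using U by (auto simp: U'_def A_def)
  have [measurable]: "U' \<in> sets borel" using U'(1) by simp
  have "emeasure M U' \<le> emeasure M U" using U by (intro emeasure_mono) (auto simp: U'_def)
  with U(3) have "emeasure M U' < emeasure M A + ennreal (e * (b - a))" by order
  then have "measure M U' < measure M A + e * (b - a)"
    using e ab by (simp add: emeasure_eq_measure ennreal_less_iff flip: ennreal_plus)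
  then have MUA: "emeasure M (U' - A) \<le> ennreal (e * (b - a))"
    using U'(2) finite_measure_Diff[of U' A] by (simp add: emeasure_eq_measure ennreal_leI)
  define K where "K = {(x, r). x \<in> T \<and> 0 < r \<and> ball x r \<subseteq> U' \<and>
    b * measure lborel (ball x r) < (LINT y:ball x r|lborel. h y)}"
  have cover: "\<exists>i. i \<in> K \<and> x \<in> ball (fst i) (snd i) \<and> snd i < d" if x: "x \<in> T" and d: "d > 0" for x d
  proof -
    have "x \<in> U'" using x U'(2) by (auto simp: T_def A_def)
    then obtain k where k: "k > 0" "ball x k \<subseteq> U'" using U'(1) by (metis openE)
    have "min d k > 0" using d k by simp
    then obtain r where r: "r > 0" "r < min d k" "b * measure lborel (ball x r) < (LINT y:ball x r|lborel. h y)"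
      using x unfolding T_def by blast
    then have "ball x r \<subseteq> U'" using k subset_ball[of r k x] by auto
    with r x show ?thesis by (intro exI[of _ "(x, r)"]) (auto simp: K_def)
  qed
  obtain C where C: "countable C" "C \<subseteq> K"
     "pairwise (\<lambda>i j. disjnt (ball (fst i) (snd i)) (ball (fst j) (snd j))) C"
     "negligible (T - (\<Union>i \<in> C. ball (fst i) (snd i)))"
  proof (rule Vitali_covering_theorem_balls[of T K fst snd])
    show "\<exists>i. i \<in> K \<and> x \<in> ball (fst i) (snd i) \<and> snd i < d" if "x \<in> T" "0 < d" for x d
      using cover that .
  qed (rule that)
  define V where "V = (\<Union>i \<in> C. ball (fst i) (snd i))"
  have Vo: "open V" unfolding V_def by auto
  have [measurable]: "V \<in> sets borel" using Vo by simp
  have VU: "V \<subseteq> U'" unfolding V_def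
  proof (rule UN_least)
    show "ball (fst i) (snd i) \<subseteq> U'" if "i \<in> C" for i
      using subsetD[OF C(2) that] by (simp add: K_def case_prod_beta)
  qed
  have dis: "disjoint_family_on (\<lambda>i. ball (fst i) (snd i)) C"
    using C(3) by (auto simp: disjoint_family_on_def pairwise_def disjnt_def)
  have "emeasure N V = (\<integral>\<^sup>+i. emeasure N (ball (fst i) (snd i)) \<partial>count_space C)"
    unfolding V_def by (rule emeasure_UN_countable[OF _ C(1) dis]) simp
  also have "\<dots> \<le> (\<integral>\<^sup>+i. emeasure P (ball (fst i) (snd i)) \<partial>count_space C)"
    using C(2) ball_average_excess[OF h]
    by (intro nn_integral_mono) (auto simp: N_def P_def emeasure_density K_def subset_iff)
  also have "\<dots> = emeasure P V"
    unfolding V_def by (rule emeasure_UN_countable[OF _ C(1) dis, symmetric]) simp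
  finally have NP: "emeasure N V \<le> emeasure P V" .
  \<comment> \<open>On \<open>A\<close> the deficit b - h exceeds b - a, so (b - h)+ controls the
    measure of \<open>V \<inter> A\<close>. By \<open>NP\<close> the mass passes to (h - b)+, which
    vanishes on \<open>A\<close> and is dominated by \<open>M\<close> on
    \<open>U' - A\<close>.\<close>
  have "ennreal (b - a) * emeasure lborel (V \<inter> A) = (\<integral>\<^sup>+x. ennreal (b - a) * indicator (V \<inter> A) x \<partial>lborel)"
    by (simp add: nn_integral_cmult_indicator)
  also have "\<dots> \<le> (\<integral>\<^sup>+x. ennreal (b - h x) * indicator V x \<partial>lborel)"
    by (intro nn_integral_mono) (auto simp: A_def indicator_def intro!: ennreal_leI)
  also have "\<dots> = emeasure N V" by (simp add: N_def emeasure_density)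
  also note NP
  also have "emeasure P V = (\<integral>\<^sup>+x. ennreal (h x - b) * indicator V x \<partial>lborel)"
    by (simp add: P_def emeasure_density)
  also have "\<dots> \<le> (\<integral>\<^sup>+x. ennreal (\<bar>h x\<bar> + \<bar>b\<bar>) * indicator (ball 0 R) x * indicator (U' - A) x \<partial>lborel)"
  proof (intro nn_integral_mono)
    fix x
    have "h x - b \<le> 0" if "x \<in> A" using that ab by (simp add: A_def)
    then show "ennreal (h x - b) * indicator V x \<le> ennreal (\<bar>h x\<bar> + \<bar>b\<bar>) * indicator (ball 0 R) x * indicator (U' - A) x"
      using VU U'(3) by (auto simp: indicator_def ennreal_neg simp del: ennreal_plus intro!: ennreal_leI)
  qed
  also have "\<dots> = emeasure M (U' - A)"
    unfolding M_def
  proof (rule emeasure_density[symmetric])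
    show "(\<lambda>x. ennreal (\<bar>h x\<bar> + \<bar>b\<bar>) * indicator (ball 0 R) x) \<in> borel_measurable lborel"
      using hm by (intro borel_measurable_times_ennreal measurable_compose[OF _ measurable_ennreal]
        borel_measurable_indicator) auto
    show "U' - A \<in> sets lborel" using A U'(1) by simp
  qed
  also note MUA
  finally have "ennreal (b - a) * emeasure lborel (V \<inter> A) \<le> ennreal (e * (b - a))" .
  moreover have fin: "emeasure lborel (V \<inter> A) < \<infinity>"
  proof -
    have "emeasure lborel (V \<inter> A) \<le> emeasure lborel (ball (0::'a) R)"
      using VU U'(3) by (intro emeasure_mono) auto
    then show ?thesis using emeasure_lborel_ball_finite by (rule order_le_less_trans)
  qed
  ultimately have VA: "measure lborel (V \<inter> A) \<le> e"
    using ab e by (simp add: emeasure_eq_ennreal_measure ennreal_mult[symmetric] top.not_eq_extremum)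
  \<comment> \<open>Points of \<open>T\<close> in \<open>V\<close> lie in \<open>A\<close>, and the
    rest of \<open>T\<close> is null by the covering theorem.\<close>
  define W where "W = (V \<inter> A) \<union> (T - V)"
  have "W \<in> lmeasurable" "measure lebesgue W \<le> e"
  proof -
    have VAl: "V \<inter> A \<in> lmeasurable" using fin by (simp add: fmeasurable_def)
    have TV: "negligible (T - V)" using C(4) by (simp add: V_def)
    show "W \<in> lmeasurable" unfolding W_def using VAl TV by (simp add: fmeasurable.Un negligible_imp_measurable)
    have "measure lebesgue W = measure lebesgue (V \<inter> A)" unfolding W_def
      using VAl TV measure_Un_null_set[of "V \<inter> A" lebesgue "T - V"] by (simp add: negligible_iff_null_sets fmeasurableD)
    then show "measure lebesgue W \<le> e" using VA by simp
  qed
  moreover have "T \<subseteq> W" by (auto simp: W_def T_def A_def)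
  ultimately show "\<exists>W. T \<subseteq> W \<and> W \<in> lmeasurable \<and> measure lebesgue W \<le> e" by blast
qed

lemma AE_lborel_negligible: "negligible N \<Longrightarrow> (\<And>x. x \<notin> N \<Longrightarrow> P x) \<Longrightarrow> AE x in lborel. P x"
  by (rule AE_completion_iff[THEN iffD1]) (auto simp: eventually_ae_filter_negligible)

text \<open>The exceptional set in the differentiation theorem is a countable union of sets
  on which \<open>h\<close> and the limes superior of its averages are separated by rational numbers.\<close>

lemma AE_limsup_average_le:
  fixes h :: "'a::euclidean_space \<Rightarrow> real"
  assumes h: "integrable lborel h"
  shows "AE x in lborel. \<forall>c>h x. \<forall>\<^sub>F r in at_right 0.
    (LINT y:ball x r|lborel. h y) / measure lborel (ball x r) < c"
proof -
  define T where "T a b R = {x \<in> ball 0 (real R). h x < a \<and>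
      (\<forall>d>0. \<exists>r>0. r < d \<and> b * measure lborel (ball x r) < (LINT y:ball x r|lborel. h y))}" for a b R
  have "negligible (\<Union>i\<in>{(a, b, R::nat). a \<in> \<rat> \<and> b \<in> \<rat> \<and> a < b}. case i of (a, b, R) \<Rightarrow> T a b R)" (is "negligible (\<Union>i\<in>?I. _)")
  proof (rule negligible_countable_Union)
    have "countable (\<rat> \<times> \<rat> \<times> (UNIV :: nat set))"
      by (intro countable_SIGMA countable_rat) auto
    moreover have "?I \<subseteq> \<rat> \<times> \<rat> \<times> UNIV" by auto
    ultimately have "countable ?I" by (rule countable_subset[rotated])
    then show "countable ((\<lambda>i. case i of (a, b, R) \<Rightarrow> T a b R) ` ?I)" by blast
    show "negligible S" if "S \<in> (\<lambda>i. case i of (a, b, R) \<Rightarrow> T a b R) ` ?I" for S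
      using that negligible_upper_average[OF h] by (auto simp: T_def)
  qed
  then show ?thesis
  proof (rule AE_lborel_negligible, intro allI impI)
    fix x c assume x: "x \<notin> (\<Union>i\<in>?I. case i of (a, b, R) \<Rightarrow> T a b R)" and c: "h x < c"
    obtain a where a: "a \<in> \<rat>" "h x < a" "a < c" using Rats_dense_in_real[OF c] by blast
    obtain b where b: "b \<in> \<rat>" "a < b" "b < c" using Rats_dense_in_real[OF a(3)] by blast
    obtain R where R: "norm x < real R" using reals_Archimedean2 by blast
    have "x \<notin> T a b R" using x a b by auto
    then have "\<not> (\<forall>d>0. \<exists>r>0. r < d \<and> b * measure lborel (ball x r) < (LINT y:ball x r|lborel. h y))"
      using a R by (simp add: T_def)
    then obtain d where d: "d > 0" "\<And>r. r > 0 \<Longrightarrow> r < d \<Longrightarrow> (LINT y:ball x r|lborel. h y) \<le> b * measure lborel (ball x r)"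
      by (metis not_less)
    show "\<forall>\<^sub>F r in at_right 0. (LINT y:ball x r|lborel. h y) / measure lborel (ball x r) < c"
    proof (rule eventually_at_rightI[of 0 d])
      fix r assume r: "r \<in> {0<..<d}"
      have "0 < measure lborel (ball x r)" using r by (simp add: content_ball_pos)
      with d(2)[of r] r have "(LINT y:ball x r|lborel. h y) / measure lborel (ball x r) \<le> b"
        by (simp add: pos_divide_le_eq)
      with b show "(LINT y:ball x r|lborel. h y) / measure lborel (ball x r) < c" by simp
    qed fact
  qed
qed

text \<open>The lower bound for the averages of h is the upper bound for those of -h.\<close>

theorem lebesgue_differentiation:
  fixes h :: "'a::euclidean_space \<Rightarrow> real"
  assumes h: "integrable lborel h"
  shows "AE x in lborel.
    ((\<lambda>r. (LINT y:ball x r|lborel. h y) / measure lborel (ball x r)) \<longlongrightarrow> h x) (at_right 0)"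
proof -
  have "integrable lborel (\<lambda>x. - h x)" using h by simp
  from AE_limsup_average_le[OF h] AE_limsup_average_le[OF this] show ?thesis
  proof eventually_elim
    case (elim x)
    show ?case
    proof (rule order_tendstoI)
      fix c assume "c < h x"
      then have "- h x < - c" by simp
      from elim(2)[rule_format, OF this]
      show "\<forall>\<^sub>F r in at_right 0. c < (LINT y:ball x r|lborel. h y) / measure lborel (ball x r)"
        by (simp add: set_lebesgue_integral_def)
    qed (use elim(1) in auto)
  qed
qed

subsection \<open>Uniqueness of weak derivatives\<close>

text \<open>By the Lindelof property countably many of the good open sets suffice. Integrability is
  available only locally in \<open>\<Omega>\<close>, so almost-everywhere statements are proved on
  small balls and glued here.\<close>

lemma AE_open_locally:
  fixes D :: "'a::second_countable_topology set"
  assumes "\<And>x. x \<in> D \<Longrightarrow> \<exists>U. open U \<and> x \<in> U \<and> (AE y in M. y \<in> U \<longrightarrow> P y)"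
  shows "AE y in M. y \<in> D \<longrightarrow> P y"
proof -
  let ?F = "{U. open U \<and> (AE y in M. y \<in> U \<longrightarrow> P y)}"
  obtain F' where F': "F' \<subseteq> ?F" "countable F'" "\<Union>F' = \<Union>?F"
    by (rule Lindelof[of ?F]) (auto intro: that)
  have "AE y in M. \<forall>U\<in>F'. y \<in> U \<longrightarrow> P y"
    using F' by (subst AE_ball_countable) auto
  moreover have "D \<subseteq> \<Union>F'" unfolding F'(3) using assms by blast
  ultimately show ?thesis by (auto elim!: eventually_mono)
qed

text \<open>Testing with the bumps and passing to the limit, dominated by |h|, shows that h has
  integral 0 over every small ball in D. The differentiation theorem then gives h = 0 almost
  everywhere in D, without any mollification.\<close>

lemma fundamental_lemma:
  fixes h :: "'a::euclidean_space \<Rightarrow> real"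
  assumes h: "integrable lborel h" and D: "open D"
    and test: "\<And>\<phi>. \<phi> \<in> test_functions D \<Longrightarrow> (LINT y|lborel. h y * \<phi> y) = 0"
  shows "AE x in lborel. x \<in> D \<longrightarrow> h x = 0"
proof -
  have [measurable]: "h \<in> borel_measurable borel" using h by auto
  have ball: "(LINT y:ball x r|lborel. h y) = 0" if x: "cball x r \<subseteq> D" "r > 0" for x r
  proof -
    have t: "ball_bump x r k \<in> test_functions D" for k
      using x by (rule ball_bump_in_test_functions)
    have [measurable]: "ball_bump x r k \<in> borel_measurable borel" for k
      using test_functionsD(5)[OF t] .
    have "(\<lambda>k. LINT y|lborel. h y * ball_bump x r k y) \<longlonglongrightarrow> (LINT y|lborel. h y * indicator (ball x r) y)"
    proof (rule integral_dominated_convergence)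
      show "integrable lborel (\<lambda>y. \<bar>h y\<bar>)" using h by simp
      show "AE y in lborel. (\<lambda>k. h y * ball_bump x r k y) \<longlonglongrightarrow> h y * indicator (ball x r) y"
        by (intro AE_I2 tendsto_mult tendsto_const ball_bump_tendsto x)
      show "AE y in lborel. norm (h y * ball_bump x r k y) \<le> \<bar>h y\<bar>" for k
        using ball_bump_bounded[of x r k] by (intro AE_I2) (simp add: abs_mult mult_left_le)
    qed (auto intro!: borel_measurable_times borel_measurable_indicator)
    then have "(LINT y|lborel. h y * indicator (ball x r) y) = 0"
      by (simp add: test[OF t] LIMSEQ_const_iff)
    then show ?thesis by (simp add: set_lebesgue_integral_def mult.commute)
  qed
  from lebesgue_differentiation[OF h] show ?thesis
  proof eventually_elim
    case (elim x)
    show ?case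
    proof
      assume "x \<in> D"
      then obtain d where d: "d > 0" "cball x d \<subseteq> D" using D open_contains_cball by blast
      have "\<forall>\<^sub>F r in at_right 0. (LINT y:ball x r|lborel. h y) / measure lborel (ball x r) = 0"
      proof (rule eventually_at_rightI[of 0 d])
        fix r assume r: "r \<in> {0<..<d}"
        then have "cball x r \<subseteq> D" using d(2) subset_cball[of r d x] by auto
        with r show "(LINT y:ball x r|lborel. h y) / measure lborel (ball x r) = 0" by (simp add: ball)
      qed fact
      then have "((\<lambda>r. (LINT y:ball x r|lborel. h y) / measure lborel (ball x r)) \<longlongrightarrow> 0) (at_right 0)"
        by (rule tendsto_eventually)
      then show "h x = 0" using elim tendsto_unique[of "at_right (0::real)"] by (meson trivial_limit_at_right_real)
    qed
  qed
qed

section \<open>Borel representatives of functions measurable for the completed measure\<close>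

lemma integrable_lebesgue_borel_version:
  fixes h :: "'a::euclidean_space \<Rightarrow> real"
  assumes h: "integrable lebesgue h"
  obtains h' where "integrable lborel h'" "AE x in lebesgue. h x = h' x"
proof -
  obtain h' where h': "h' \<in> borel_measurable lborel" "AE x in lborel. h x = h' x"
    using completion_ex_borel_measurable_real[of h lborel] h by auto
  have ae: "AE x in lebesgue. h x = h' x" using h'(2) by (rule AE_completion)
  have "integrable lebesgue h'"
    using h ae h'(1) by (subst integrable_cong_AE[symmetric, of h]) (auto intro: measurable_completion)
  then have "integrable lborel h'" using h'(1) by (simp add: integrable_completion)
  then show ?thesis using ae by (rule that)
qed

lemma integral_lebesgue_borel_version:
  fixes h h' :: "'a::euclidean_space \<Rightarrow> real"
  assumes "integrable lebesgue h" "h' \<in> borel_measurable borel" "AE x in lebesgue. h x = h' x"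
  shows "integral\<^sup>L lebesgue h = integral\<^sup>L lborel h'"
proof -
  have "integral\<^sup>L lebesgue h = integral\<^sup>L lebesgue h'"
    using assms by (intro integral_cong_AE) (auto intro: measurable_completion)
  then show ?thesis using assms(2) by (simp add: integral_completion)
qed

text \<open>Integrability of |f| does not control the sign of f, which is why \<open>Lp\<close> also
  demands measurability of f; together they are Bochner integrability.\<close>

lemma Lp_1_iff: "f \<in> Lp 1 K \<longleftrightarrow> set_integrable lebesgue K f"
proof -
  have eq: "indicator K x *\<^sub>R (\<bar>f x\<bar> powr 1) = \<bar>indicator K x *\<^sub>R f x\<bar>" for x
    by (simp add: indicator_def)
  show ?thesis
    unfolding Lp_def set_borel_measurable_def set_integrable_def mem_Collect_eq eq
    by (intro iffI conjI; (elim conjE)?)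
      (rule integrable_abs_cancel borel_measurable_integrable integrable_abs; assumption)+
qed

lemma Lp_loc_1_iff:
  "f \<in> Lp_loc 1 \<Omega> \<longleftrightarrow> (\<forall>K. compact K \<and> K \<subseteq> \<Omega> \<longrightarrow> set_integrable lebesgue K f)"
  by (simp add: Lp_loc_def Lp_1_iff)

lemma set_integrable_lebesgue_borel_version:
  fixes h :: "'a::euclidean_space \<Rightarrow> real"
  assumes "set_integrable lebesgue A h"
  obtains h' where "integrable lborel h'" "AE x in lebesgue. x \<in> A \<longrightarrow> h x = h' x"
proof -
  obtain h' where h': "integrable lborel h'" "AE x in lebesgue. indicator A x *\<^sub>R h x = h' x"
    using assms unfolding set_integrable_def by (rule integrable_lebesgue_borel_version)
  from h'(2) have "AE x in lebesgue. x \<in> A \<longrightarrow> h x = h' x"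
    by eventually_elim auto
  with h'(1) show ?thesis by (rule that)
qed

text \<open>The test function vanishes off U, so only the values of f on K count, where f agrees
  with its Borel version. This links the integrals over \<open>\<Omega>\<close> in
  \<open>is_weak_partial\<close> with integrals over the whole space.\<close>

lemma integral_mult_test_function_transfer:
  assumes f: "set_integrable lebesgue K f" and K: "U \<subseteq> K" "K \<subseteq> \<Omega>"
    and f': "f' \<in> borel_measurable borel" "AE y in lebesgue. y \<in> K \<longrightarrow> f y = f' y"
    and \<phi>: "\<phi> \<in> test_functions U"
  shows "(LINT y:\<Omega>|lebesgue. f y * \<phi> y) = (LINT y|lborel. f' y * \<phi> y)"
proof -
  have \<phi>m: "\<phi> \<in> borel_measurable borel" and \<phi>0: "\<And>y. y \<notin> U \<Longrightarrow> \<phi> y = 0"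
    using test_functionsD[OF \<phi>] by auto
  have eq: "indicator \<Omega> y *\<^sub>R (f y * \<phi> y) = (indicator K y *\<^sub>R f y) * \<phi> y" for y
    using \<phi>0[of y] K by (auto simp: indicator_def)
  have "(LINT y:\<Omega>|lebesgue. f y * \<phi> y) = (LINT y|lebesgue. f' y * \<phi> y)"
    unfolding set_lebesgue_integral_def eq
  proof (rule integral_cong_AE)
    show "(\<lambda>y. indicator K y *\<^sub>R f y * \<phi> y) \<in> borel_measurable lebesgue"
      using f \<phi>m unfolding set_integrable_def
      by (intro borel_measurable_times) (auto intro: measurable_completion)
    show "(\<lambda>y. f' y * \<phi> y) \<in> borel_measurable lebesgue"
      using f'(1) \<phi>m by (intro borel_measurable_times) (auto intro: measurable_completion)
    from f'(2) show "AE y in lebesgue. indicator K y *\<^sub>R f y * \<phi> y = f' y * \<phi> y"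
    proof eventually_elim
      case (elim y)
      then show ?case using \<phi>0[of y] K by (cases "y \<in> K") auto
    qed
  qed
  also have "\<dots> = (LINT y|lborel. f' y * \<phi> y)"
    using f'(1) \<phi>m by (intro integral_completion) auto
  finally show ?thesis .
qed

text \<open>On a small ball the difference of the two derivatives annihilates every test function.
  Every passage from the choice in \<open>weak_partial\<close> to a concrete weak derivative goes
  through this lemma.\<close>

lemma weak_partial_unique:
  assumes \<Omega>: "open \<Omega>" and g1: "is_weak_partial \<Omega> b f g1" and g2: "is_weak_partial \<Omega> b f g2"
  shows "AE x in lebesgue. x \<in> \<Omega> \<longrightarrow> g1 x = g2 x"
proof (rule AE_open_locally)
  fix x assume "x \<in> \<Omega>"
  then obtain r where r: "r > 0" "cball x r \<subseteq> \<Omega>" using \<Omega> open_contains_cball by blast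
  have int: "set_integrable lebesgue (cball x r) g1" "set_integrable lebesgue (cball x r) g2"
    using g1 g2 r(2) by (auto simp: is_weak_partial_def Lp_loc_1_iff)
  obtain g1' where g1': "integrable lborel g1'" "AE y in lebesgue. y \<in> cball x r \<longrightarrow> g1 y = g1' y"
    using set_integrable_lebesgue_borel_version[OF int(1)] .
  obtain g2' where g2': "integrable lborel g2'" "AE y in lebesgue. y \<in> cball x r \<longrightarrow> g2 y = g2' y"
    using set_integrable_lebesgue_borel_version[OF int(2)] .
  have "AE y in lborel. y \<in> ball x r \<longrightarrow> g1' y - g2' y = 0"
  proof (rule fundamental_lemma)
    show "integrable lborel (\<lambda>y. g1' y - g2' y)" using g1' g2' by auto
    fix \<phi> assume \<phi>: "\<phi> \<in> test_functions (ball x r)"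
    then have \<phi>\<Omega>: "\<phi> \<in> test_functions \<Omega>"
      using test_functions_mono[of "ball x r" \<Omega>] r(2) ball_subset_cball[of x r] by blast
    have "(LINT y|lborel. g1' y * \<phi> y) = (LINT y:\<Omega>|lebesgue. g1 y * \<phi> y)"
      using g1' by (intro integral_mult_test_function_transfer[symmetric, OF int(1) _ r(2) _ _ \<phi>]) auto
    also have "\<dots> = (LINT y:\<Omega>|lebesgue. g2 y * \<phi> y)"
      using g1 g2 \<phi>\<Omega> unfolding is_weak_partial_def by auto
    also have "\<dots> = (LINT y|lborel. g2' y * \<phi> y)"
      using g2' by (intro integral_mult_test_function_transfer[OF int(2) _ r(2) _ _ \<phi>]) auto
    finally show "(LINT y|lborel. (g1' y - g2' y) * \<phi> y) = 0"
      using integrable_mult_test_function[OF g1'(1) \<phi>] integrable_mult_test_function[OF g2'(1) \<phi>]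
      by (simp add: left_diff_distrib)
  qed auto
  then have "AE y in lebesgue. y \<in> ball x r \<longrightarrow> g1' y - g2' y = 0" by (rule AE_completion)
  with g1'(2) g2'(2) have "AE y in lebesgue. y \<in> ball x r \<longrightarrow> g1 y = g2 y"
    by eventually_elim auto
  then show "\<exists>U. open U \<and> x \<in> U \<and> (AE y in lebesgue. y \<in> U \<longrightarrow> g1 y = g2 y)"
    using r by (intro exI[of _ "ball x r"]) auto
qed

lemma weak_partial_is_weak_partial:
  "is_weak_partial \<Omega> b f g \<Longrightarrow> is_weak_partial \<Omega> b f (weak_partial \<Omega> b f)"
  unfolding weak_partial_def by (rule someI[of "is_weak_partial \<Omega> b f"])

text \<open>The averages of f over small balls are those of a Borel version, to which the
  differentiation theorem applies. It is needed because \<open>blowup\<close> is built from the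
  precise representative and not from f.\<close>

lemma AE_precise_rep:
  fixes f :: "'a::euclidean_space \<Rightarrow> real"
  assumes \<Omega>: "open \<Omega>" and f: "f \<in> Lp_loc 1 \<Omega>"
  shows "AE x in lebesgue. x \<in> \<Omega> \<longrightarrow> precise_rep f x = f x"
proof (rule AE_open_locally)
  fix x assume "x \<in> \<Omega>"
  then obtain r where r: "r > 0" "cball x r \<subseteq> \<Omega>" using \<Omega> open_contains_cball by blast
  have int: "set_integrable lebesgue (cball x r) f"
    using f r(2) by (auto simp: Lp_loc_1_iff)
  obtain f' where f': "integrable lborel f'" "AE y in lebesgue. y \<in> cball x r \<longrightarrow> f y = f' y"
    using set_integrable_lebesgue_borel_version[OF int] .
  have avg: "ball_avg f y s = (LINT z:ball y s|lborel. f' z) / measure lborel (ball y s)"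
    if "ball y s \<subseteq> cball x r" for y s
  proof -
    have "integral\<^sup>L lebesgue (\<lambda>z. indicator (ball y s) z *\<^sub>R f z) = integral\<^sup>L lborel (\<lambda>z. indicator (ball y s) z *\<^sub>R f' z)"
    proof (rule integral_lebesgue_borel_version)
      show "integrable lebesgue (\<lambda>z. indicator (ball y s) z *\<^sub>R f z)"
        using set_integrable_subset[OF int, of "ball y s"] that by (auto simp: set_integrable_def)
      show "(\<lambda>z. indicator (ball y s) z *\<^sub>R f' z) \<in> borel_measurable borel"
        using f'(1) by (intro borel_measurable_scaleR borel_measurable_indicator) auto
      from f'(2) show "AE z in lebesgue. indicator (ball y s) z *\<^sub>R f z = indicator (ball y s) z *\<^sub>R f' z"
        by eventually_elim (use that in \<open>auto simp: indicator_def\<close>)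
    qed
    then show ?thesis by (simp add: ball_avg_def set_lebesgue_integral_def)
  qed
  have "AE y in lebesgue. y \<in> ball x r \<longrightarrow> precise_rep f y = f y"
    using f'(2) AE_completion[OF lebesgue_differentiation[OF f'(1)]]
  proof eventually_elim
    case (elim y)
    show ?case
    proof
      assume y: "y \<in> ball x r"
      then obtain d where d: "d > 0" "ball y d \<subseteq> ball x r" by (metis open_ball openE)
      have "\<forall>\<^sub>F s in at_right 0. (LINT z:ball y s|lborel. f' z) / measure lborel (ball y s) = ball_avg f y s"
      proof (rule eventually_at_rightI[of 0 d])
        fix s assume "s \<in> {0<..<d}"
        then have "ball y s \<subseteq> cball x r" using d subset_ball[of s d y] ball_subset_cball[of x r] by auto
        then show "(LINT z:ball y s|lborel. f' z) / measure lborel (ball y s) = ball_avg f y s" by (simp add: avg)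
      qed fact
      then have "(ball_avg f y \<longlongrightarrow> f' y) (at_right 0)"
        by (rule Lim_transform_eventually[OF elim(2)])
      moreover from this have "Lim (at_right 0) (ball_avg f y) = f' y"
        by (intro tendsto_Lim) auto
      ultimately have "precise_rep f y = f' y" unfolding precise_rep_def by auto
      then show "precise_rep f y = f y" using elim(1) y by auto
    qed
  qed
  then show "\<exists>U. open U \<and> x \<in> U \<and> (AE y in lebesgue. y \<in> U \<longrightarrow> precise_rep f y = f y)"
    using r by (intro exI[of _ "ball x r"]) auto
qed

subsection \<open>Differences and weak gradients\<close>

lemma powr_above_tangent:
  fixes t m p :: real
  assumes "0 \<le> t" "0 < m" "1 \<le> p"
  shows "m powr p + p * m powr (p - 1) * (t - m) \<le> t powr p"
proof (cases "t = 0")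
  case True
  have "m powr (p - 1) * m = m powr p" using assms by (simp add: powr_mult_base mult.commute)
  then have "m powr p + p * m powr (p - 1) * (t - m) = (1 - p) * m powr p"
    using True by (simp add: algebra_simps)
  also have "\<dots> \<le> 0" using assms by (intro mult_nonpos_nonneg) auto
  finally show ?thesis by (rule order_trans) simp
next
  case False
  have "p * m powr (p - 1) * (t - m) \<le> t powr p - m powr p"
    by (rule convex_on_imp_above_tangent[OF powr_convex[OF assms(3)]])
      (use assms False in \<open>auto intro!: derivative_eq_intros simp: powr_diff interior_open\<close>)
  then show ?thesis by simp
qed

text \<open>Integrate the tangent inequality for t^p at the mean of |h|: the linear terms cancel.
  The total mass is not normalised, hence the factor with exponent \<open>p - 1\<close>; with
  \<open>ennreal\<close> the right-hand side may be infinite.\<close>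

lemma (in finite_measure) jensen_powr:
  fixes h :: "'a \<Rightarrow> real"
  assumes h: "integrable M h" and p: "1 \<le> p"
  shows "ennreal (\<bar>integral\<^sup>L M h\<bar> powr p) \<le>
    ennreal (measure M (space M) powr (p - 1)) * (\<integral>\<^sup>+x. ennreal (\<bar>h x\<bar> powr p) \<partial>M)"
proof -
  define \<mu> where "\<mu> = measure M (space M)"
  define J where "J = (LINT x|M. \<bar>h x\<bar>)"
  have [measurable]: "h \<in> borel_measurable M" using h by auto
  have IJ: "\<bar>integral\<^sup>L M h\<bar> \<le> J" unfolding J_def by (rule integral_abs_bound)
  have emu: "emeasure M (space M) = ennreal \<mu>" by (simp add: \<mu>_def emeasure_eq_measure)
  have Jnn: "(\<integral>\<^sup>+x. ennreal \<bar>h x\<bar> \<partial>M) = ennreal J"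
    unfolding J_def using h by (intro nn_integral_eq_integral) auto
  have J0: "0 \<le> J" using IJ by simp
  show ?thesis
  proof (cases "J = 0")
    case True
    then show ?thesis using IJ by simp
  next
    case False
    then have J: "J > 0" using J0 by simp
    have \<mu>: "\<mu> > 0"
    proof (rule ccontr)
      assume "\<not> \<mu> > 0"
      then have "emeasure M (space M) = 0" using emu by (simp add: ennreal_neg)
      then have "space M \<in> null_sets M" by auto
      then have "AE x in M. \<bar>h x\<bar> = 0" by (rule AE_I') auto
      then have "J = 0" unfolding J_def by (subst integral_cong_AE[where g="\<lambda>_. 0"]) auto
      with J show False by simp
    qed
    define m where "m = J / \<mu>"
    have m: "m > 0" using J \<mu> by (simp add: m_def)
    define c where "c = p * m powr (p - 1)"
    have c: "c > 0" using m p by (simp add: c_def)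
    have "ennreal (m powr p * \<mu>) + ennreal (c * J)
      = (\<integral>\<^sup>+x. ennreal (m powr p) + ennreal c * ennreal \<bar>h x\<bar> \<partial>M)"
      using m \<mu> c J by (simp add: nn_integral_add nn_integral_cmult Jnn emu ennreal_mult)
    also have "\<dots> \<le> (\<integral>\<^sup>+x. ennreal (\<bar>h x\<bar> powr p) + ennreal (c * m) \<partial>M)"
    proof (rule nn_integral_mono)
      fix x
      have "m powr p + c * \<bar>h x\<bar> \<le> \<bar>h x\<bar> powr p + c * m"
        using powr_above_tangent[of "\<bar>h x\<bar>" m p] m p by (simp add: c_def algebra_simps)
      then have "ennreal (m powr p + c * \<bar>h x\<bar>) \<le> ennreal (\<bar>h x\<bar> powr p + c * m)" by (rule ennreal_leI)
      then show "ennreal (m powr p) + ennreal c * ennreal \<bar>h x\<bar> \<le> ennreal (\<bar>h x\<bar> powr p) + ennreal (c * m)"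
        using c m by (simp add: ennreal_mult)
    qed
    also have "\<dots> = (\<integral>\<^sup>+x. ennreal (\<bar>h x\<bar> powr p) \<partial>M) + ennreal (c * J)"
      using c m \<mu> by (simp add: nn_integral_add emu ennreal_mult[symmetric]) (simp add: m_def)
    \<comment> \<open>Both sides contain the finite term \<open>c * J\<close>, because
      \<open>m * \<mu> = J\<close> by the choice of m, and it can be cancelled.\<close>
    finally have key: "ennreal (m powr p * \<mu>) \<le> (\<integral>\<^sup>+x. ennreal (\<bar>h x\<bar> powr p) \<partial>M)"
      by (simp add: add.commute[of _ "ennreal (c * J)"] ennreal_add_left_cancel_le)
    have "\<bar>integral\<^sup>L M h\<bar> powr p \<le> J powr p"
      using IJ p by (intro powr_mono2) auto
    also have "J powr p = (m * \<mu>) powr p" using \<mu> by (simp add: m_def)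
    also have "\<dots> = \<mu> powr (p - 1) * (m powr p * \<mu>)"
      using \<mu> m by (simp add: powr_mult powr_mult_base[of \<mu> "p - 1"] mult_ac)
    finally have "ennreal (\<bar>integral\<^sup>L M h\<bar> powr p) \<le> ennreal (\<mu> powr (p - 1)) * ennreal (m powr p * \<mu>)"
      using \<mu> m by (simp add: ennreal_leI ennreal_mult[symmetric])
    also have "\<dots> \<le> ennreal (\<mu> powr (p - 1)) * (\<integral>\<^sup>+x. ennreal (\<bar>h x\<bar> powr p) \<partial>M)"
      by (intro mult_left_mono key) simp
    finally show ?thesis by (simp add: \<mu>_def)
  qed
qed

lemma jensen_powr_set:
  fixes h :: "'b::euclidean_space \<Rightarrow> real"
  assumes h: "set_integrable lborel A h" and A: "A \<in> sets borel" "emeasure lborel A < \<infinity>" and p: "1 \<le> p"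
  shows "ennreal (\<bar>LINT x:A|lborel. h x\<bar> powr p) \<le>
    ennreal (measure lborel A powr (p - 1)) * (\<integral>\<^sup>+x\<in>A. ennreal (\<bar>h x\<bar> powr p) \<partial>lborel)"
proof -
  interpret finite_measure "restrict_space lborel A"
    using A by (intro finite_measureI) (simp add: space_restrict_space emeasure_restrict_space)
  have "integrable (restrict_space lborel A) h"
    using h A by (simp add: integrable_restrict_space set_integrable_def)
  from jensen_powr[OF this p] show ?thesis using A
    by (simp add: integral_restrict_space nn_integral_restrict_space measure_restrict_space
        space_restrict_space set_lebesgue_integral_def)
qed

section \<open>Translations and integrals along segments\<close>

lemma
  fixes c :: "'a::euclidean_space" and f :: "'a \<Rightarrow> real"
  assumes [measurable]: "f \<in> borel_measurable borel"
  shows lborel_integral_translate: "(LINT z|lborel. f (z + c)) = (LINT z|lborel. f z)"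
    and lborel_integrable_translate: "integrable lborel (\<lambda>z. f (z + c)) \<longleftrightarrow> integrable lborel f"
proof -
  have "(LINT z|lborel. f z) = (LINT z|distr lborel borel ((+) c). f z)"
    by (simp add: lborel_distr_plus)
  also have "\<dots> = (LINT z|lborel. f (z + c))"
    by (subst integral_distr) (auto simp: add.commute)
  finally show "(LINT z|lborel. f (z + c)) = (LINT z|lborel. f z)" by simp
  have "integrable lborel f \<longleftrightarrow> integrable (distr lborel borel ((+) c)) f"
    by (simp add: lborel_distr_plus)
  also have "\<dots> \<longleftrightarrow> integrable lborel (\<lambda>z. f (z + c))"
    by (subst integrable_distr_eq) (auto simp: add.commute)
  finally show "integrable lborel (\<lambda>z. f (z + c)) \<longleftrightarrow> integrable lborel f" by simp
qed

lemma lborel_nn_integral_translate: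
  fixes c :: "'a::euclidean_space"
  assumes [measurable]: "f \<in> borel_measurable borel"
  shows "(\<integral>\<^sup>+z. f (z + c) \<partial>lborel) = (\<integral>\<^sup>+z. f z \<partial>lborel)"
proof -
  have "(\<integral>\<^sup>+z. f z \<partial>lborel) = (\<integral>\<^sup>+z. f z \<partial>distr lborel borel ((+) c))"
    by (simp add: lborel_distr_plus)
  also have "\<dots> = (\<integral>\<^sup>+z. f (z + c) \<partial>lborel)"
    by (subst nn_integral_distr) (auto simp: add.commute)
  finally show ?thesis by simp
qed

text \<open>For fixed s the integral over z is the L1 norm of H by translation invariance, and s
  runs over an interval of length 1. This is the integrability behind the uses of Fubini
  below.\<close>

lemma integrable_pair_segment:
  fixes H :: "'a::euclidean_space \<Rightarrow> real"
  assumes H: "integrable lborel H"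
  shows "integrable (lborel \<Otimes>\<^sub>M lborel) (\<lambda>(s::real, z). indicator {0..1} s * H (z + s *\<^sub>R w))"
proof (rule integrableI_bounded)
  have [measurable]: "H \<in> borel_measurable borel" using H by auto
  show "(\<lambda>(s::real, z). indicator {0..1} s * H (z + s *\<^sub>R w)) \<in> borel_measurable (lborel \<Otimes>\<^sub>M lborel)"
    by measurable
  have "(\<integral>\<^sup>+x. ennreal (norm (case x of (s::real, z) \<Rightarrow> indicator {0..1} s * H (z + s *\<^sub>R w))) \<partial>(lborel \<Otimes>\<^sub>M lborel))
    = (\<integral>\<^sup>+s. \<integral>\<^sup>+z. ennreal (norm (indicator {0..1} s * H (z + s *\<^sub>R w))) \<partial>lborel \<partial>lborel)"
    by (subst lborel.nn_integral_fst[symmetric]) auto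
  also have "\<dots> = (\<integral>\<^sup>+s. indicator {0..1::real} s * (\<integral>\<^sup>+z. ennreal (norm (H z)) \<partial>lborel) \<partial>lborel)"
  proof (rule nn_integral_cong)
    fix s :: real
    have "(\<integral>\<^sup>+z. ennreal (norm (H (z + s *\<^sub>R w))) \<partial>lborel) = (\<integral>\<^sup>+z. ennreal (norm (H z)) \<partial>lborel)"
      by (rule lborel_nn_integral_translate) simp
    then show "(\<integral>\<^sup>+z. ennreal (norm (indicator {0..1} s * H (z + s *\<^sub>R w))) \<partial>lborel)
        = indicator {0..1} s * (\<integral>\<^sup>+z. ennreal (norm (H z)) \<partial>lborel)"
      by (simp add: indicator_def)
  qed
  also have "\<dots> = (\<integral>\<^sup>+z. ennreal (norm (H z)) \<partial>lborel)"
    by (simp add: nn_integral_multc)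
  also have "\<dots> < \<infinity>" using H by (simp add: integrable_iff_bounded)
  finally show "(\<integral>\<^sup>+x. ennreal (norm (case x of (s::real, z) \<Rightarrow> indicator {0..1} s * H (z + s *\<^sub>R w))) \<partial>(lborel \<Otimes>\<^sub>M lborel)) < \<infinity>" .
qed

text \<open>By duality: tested against \<open>\<phi>\<close>, the difference becomes the difference of two translates of \<open>\<phi>\<close>,
  which is the integral of a directional derivative.\<close>

lemma weak_gradient_difference:
  fixes F :: "'a::euclidean_space \<Rightarrow> real" and G :: "'a \<Rightarrow> 'a"
  assumes F: "integrable lborel F" and G: "integrable lborel G" and D: "open D"
    and seg: "\<And>z s. z \<in> D \<Longrightarrow> 0 \<le> s \<Longrightarrow> s \<le> 1 \<Longrightarrow> z + s *\<^sub>R v \<in> B"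
    and weak: "\<And>\<phi> b. \<phi> \<in> test_functions B \<Longrightarrow> b \<in> Basis \<Longrightarrow>
      (LINT y|lborel. F y * partial b \<phi> y) = - (LINT y|lborel. (G y \<bullet> b) * \<phi> y)"
  shows "AE z in lborel. z \<in> D \<longrightarrow>
    F (z + v) - F z = (LINT s|lborel. indicator {0..1::real} s * (G (z + s *\<^sub>R v) \<bullet> v))"
proof -
  define g where "g z = (LINT s|lborel. indicator {0..1::real} s * (G (z + s *\<^sub>R v) \<bullet> v))" for z
  have [measurable]: "F \<in> borel_measurable borel" "G \<in> borel_measurable borel" using F G by auto
  have Gv: "integrable lborel (\<lambda>z. G z \<bullet> v)" using G by simp
  have pair: "integrable (lborel \<Otimes>\<^sub>M lborel) (\<lambda>(s::real, z). indicator {0..1} s * (G (z + s *\<^sub>R v) \<bullet> v))"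
    by (rule integrable_pair_segment[OF Gv])
  have g: "integrable lborel g"
    unfolding g_def[abs_def] by (rule lborel_pair.integrable_snd[OF pair])
  have Fv: "integrable lborel (\<lambda>z. F (z + v))" using F by (simp add: lborel_integrable_translate)
  have "AE z in lborel. z \<in> D \<longrightarrow> F (z + v) - F z - g z = 0"
  proof (rule fundamental_lemma)
    show "integrable lborel (\<lambda>z. F (z + v) - F z - g z)" using F Fv g by simp
    show "open D" by fact
    fix \<phi> assume \<phi>: "\<phi> \<in> test_functions D"
    have \<phi>m[measurable]: "\<phi> \<in> borel_measurable borel" using test_functionsD(5)[OF \<phi>] .
    have pm[measurable]: "partial b \<phi> \<in> borel_measurable borel" if "b \<in> Basis" for b
      using test_functionsD(5)[OF partial_in_test_functions[OF \<phi> that]] .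
    \<comment> \<open>The derivative of \<open>\<phi>\<close> in the direction v; thus
      \<open>s \<mapsto> \<phi> (y - s *\<^sub>R v)\<close> has derivative
      \<open>- \<psi> (y - s *\<^sub>R v)\<close>, which is where the minus signs come from.\<close>
    define \<psi> where "\<psi> y = (\<Sum>b\<in>Basis. (v \<bullet> b) * partial b \<phi> y)" for y
    have \<psi>m[measurable]: "\<psi> \<in> borel_measurable borel"
      unfolding \<psi>_def[abs_def] by measurable
    have \<psi>c: "continuous_on UNIV \<psi>"
      unfolding \<psi>_def[abs_def]
      by (intro continuous_intros test_functionsD(4)[OF partial_in_test_functions[OF \<phi>]])
    obtain C where C: "\<And>y. \<bar>\<psi> y\<bar> \<le> C"
    proof -
      have "\<exists>C. \<forall>y. \<bar>partial b \<phi> y\<bar> \<le> C" if "b \<in> Basis" for b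
        using test_function_bounded[OF partial_in_test_functions[OF \<phi> that]] by metis
      then obtain K where K: "\<And>b y. b \<in> Basis \<Longrightarrow> \<bar>partial b \<phi> y\<bar> \<le> K b" by metis
      have "\<bar>\<psi> y\<bar> \<le> (\<Sum>b\<in>Basis. \<bar>v \<bullet> b\<bar> * K b)" for y
        unfolding \<psi>_def by (intro order_trans[OF sum_abs] sum_mono) (auto simp: abs_mult intro!: mult_left_mono K)
      then show ?thesis by (rule that)
    qed
    \<comment> \<open>If \<open>y - s *\<^sub>R v\<close> lies in D, then adding
      \<open>s *\<^sub>R v\<close> gives y back, which lies in B by \<open>seg\<close>.\<close>
    have shift: "(\<lambda>y. \<phi> (y - s *\<^sub>R v)) \<in> test_functions B" if "0 \<le> s" "s \<le> 1" for s
      using affine_in_test_functions[OF \<phi>, of 1 "- (s *\<^sub>R v)" B] seg[OF _ that, of "_ - s *\<^sub>R v"] by force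
    have pshift: "partial b (\<lambda>y. \<phi> (y - s *\<^sub>R v)) y = partial b \<phi> (y - s *\<^sub>R v)" for b s y
      using partial_affine[OF \<phi>, of b "- (s *\<^sub>R v)" 1 y] by simp
    have FTC: "(LINT s|lborel. indicator {0..1::real} s * - \<psi> (y - s *\<^sub>R v)) = \<phi> (y - v) - \<phi> y" for y
    proof -
      have "(LINT s|lborel. indicator {0..1::real} s *\<^sub>R - \<psi> (y - s *\<^sub>R v)) = \<phi> (y - 1 *\<^sub>R v) - \<phi> (y - 0 *\<^sub>R v)"
      proof (rule integral_FTC_Icc)
        fix s :: real
        have "((\<lambda>s. \<phi> (y - s *\<^sub>R v)) has_derivative (\<lambda>t. \<Sum>b\<in>Basis. ((- (t *\<^sub>R v)) \<bullet> b) * partial b \<phi> (y - s *\<^sub>R v)))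
            (at s within {0..1})"
          by (rule has_derivative_compose[where f="\<lambda>s. y - s *\<^sub>R v" and g=\<phi>, OF _ test_functionsD(7)[OF \<phi>]])
            (auto intro!: derivative_eq_intros)
        also have "(\<lambda>t. \<Sum>b\<in>Basis. ((- (t *\<^sub>R v)) \<bullet> b) * partial b \<phi> (y - s *\<^sub>R v)) = (\<lambda>t. t *\<^sub>R - \<psi> (y - s *\<^sub>R v))"
          by (auto simp: \<psi>_def sum_distrib_left mult.assoc sum_negf)
        finally show "((\<lambda>s. \<phi> (y - s *\<^sub>R v)) has_vector_derivative - \<psi> (y - s *\<^sub>R v)) (at s within {0..1})"
          by (simp only: has_vector_derivative_def)
        show "continuous_on {0..1} (\<lambda>s. - \<psi> (y - s *\<^sub>R v))"
          by (intro continuous_intros continuous_on_compose2[OF \<psi>c]) auto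
      qed auto
      then show ?thesis by simp
    qed
    have pairF: "integrable (lborel \<Otimes>\<^sub>M lborel) (\<lambda>(s::real, y). F y * (indicator {0..1} s * - \<psi> (y - s *\<^sub>R v)))"
    proof (rule Bochner_Integration.integrable_bound)
      \<comment> \<open>With w = 0 the segment lemma gives the integrability of F y over [0,1] times
        the whole space, which serves as majorant.\<close>
      show "integrable (lborel \<Otimes>\<^sub>M lborel) (\<lambda>x. C * (case x of (s::real, y) \<Rightarrow> indicator {0..1} s * F (y + s *\<^sub>R 0)))"
        by (intro integrable_mult_right integrable_pair_segment F)
      show "(\<lambda>(s::real, y). F y * (indicator {0..1} s * - \<psi> (y - s *\<^sub>R v))) \<in> borel_measurable (lborel \<Otimes>\<^sub>M lborel)"
        by measurable
      have "0 \<le> C" using C[of 0] by simp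
      then show "AE x in lborel \<Otimes>\<^sub>M lborel. norm (case x of (s::real, y) \<Rightarrow> F y * (indicator {0..1} s * - \<psi> (y - s *\<^sub>R v)))
          \<le> norm (C * (case x of (s::real, y) \<Rightarrow> indicator {0..1} s * F (y + s *\<^sub>R 0)))"
        using C by (intro AE_I2) (auto simp: abs_mult indicator_def mult.commute[of C] intro!: mult_left_mono)
    qed
    obtain C' where C': "\<And>y. \<bar>\<phi> y\<bar> \<le> C'" by (rule test_function_bounded[OF \<phi>]) (rule that)
    have pairG: "integrable (lborel \<Otimes>\<^sub>M lborel) (\<lambda>(s::real, z). (indicator {0..1} s * (G (z + s *\<^sub>R v) \<bullet> v)) * \<phi> z)"
    proof (rule Bochner_Integration.integrable_bound)
      show "integrable (lborel \<Otimes>\<^sub>M lborel) (\<lambda>x. C' * (case x of (s::real, z) \<Rightarrow> indicator {0..1} s * (G (z + s *\<^sub>R v) \<bullet> v)))"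
        by (intro integrable_mult_right pair)
      show "(\<lambda>(s::real, z). (indicator {0..1} s * (G (z + s *\<^sub>R v) \<bullet> v)) * \<phi> z) \<in> borel_measurable (lborel \<Otimes>\<^sub>M lborel)"
        by measurable
      have "0 \<le> C'" using C'[of 0] by simp
      then show "AE x in lborel \<Otimes>\<^sub>M lborel. norm (case x of (s::real, z) \<Rightarrow> (indicator {0..1} s * (G (z + s *\<^sub>R v) \<bullet> v)) * \<phi> z)
          \<le> norm (C' * (case x of (s::real, z) \<Rightarrow> indicator {0..1} s * (G (z + s *\<^sub>R v) \<bullet> v)))"
        using C' by (intro AE_I2) (auto simp: abs_mult indicator_def mult.commute[of C'] intro!: mult_left_mono)
    qed
    \<comment> \<open>For s in [0,1] the translate of \<open>\<phi>\<close> by s v is an admissible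
      test function on B: apply the definition of the weak derivative to it and translate back. For
      other s both sides are 0.\<close>
    have inner_eq: "(LINT y|lborel. F y * (indicator {0..1} s * - \<psi> (y - s *\<^sub>R v)))
        = (LINT z|lborel. (indicator {0..1} s * (G (z + s *\<^sub>R v) \<bullet> v)) * \<phi> z)" for s :: real
    proof (cases "s \<in> {0..1}")
      case True
      then have t: "(\<lambda>y. \<phi> (y - s *\<^sub>R v)) \<in> test_functions B" using shift by simp
      have pt: "(\<lambda>y. partial b \<phi> (y - s *\<^sub>R v)) \<in> test_functions B" if "b \<in> Basis" for b
        using partial_in_test_functions[OF t that] by (simp add: pshift[abs_def])
      have wk: "(LINT y|lborel. F y * partial b \<phi> (y - s *\<^sub>R v)) = - (LINT y|lborel. (G y \<bullet> b) * \<phi> (y - s *\<^sub>R v))"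
        if "b \<in> Basis" for b
        using weak[OF t that] by (simp only: pshift)
      have "(LINT y|lborel. F y * (indicator {0..1} s * - \<psi> (y - s *\<^sub>R v)))
          = (LINT y|lborel. (\<Sum>b\<in>Basis. - (v \<bullet> b) * (F y * partial b \<phi> (y - s *\<^sub>R v))))"
        using True by (simp add: \<psi>_def sum_distrib_left mult_ac sum_negf)
      also have "\<dots> = (\<Sum>b\<in>Basis. - (v \<bullet> b) * (LINT y|lborel. F y * partial b \<phi> (y - s *\<^sub>R v)))"
        by (subst Bochner_Integration.integral_sum)
          (auto intro!: integrable_mult_right integrable_mult_test_function[OF F pt] simp del: mult_minus_left)
      also have "\<dots> = (\<Sum>b\<in>Basis. (v \<bullet> b) * (LINT y|lborel. (G y \<bullet> b) * \<phi> (y - s *\<^sub>R v)))"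
        by (simp add: wk)
      also have "\<dots> = (LINT y|lborel. (\<Sum>b\<in>Basis. (v \<bullet> b) * ((G y \<bullet> b) * \<phi> (y - s *\<^sub>R v))))"
        using G by (subst Bochner_Integration.integral_sum)
          (auto intro!: integrable_mult_right integrable_mult_test_function[OF _ t])
      also have "\<dots> = (LINT y|lborel. (G y \<bullet> v) * \<phi> (y - s *\<^sub>R v))"
      proof -
        have "(\<Sum>b\<in>Basis. (v \<bullet> b) * ((G y \<bullet> b) * q)) = (G y \<bullet> v) * q" for y q
          by (subst euclidean_inner[of "G y" v]) (simp add: sum_distrib_left sum_distrib_right mult_ac)
        then show ?thesis by simp
      qed
      also have "\<dots> = (LINT z|lborel. (G (z + s *\<^sub>R v) \<bullet> v) * \<phi> (z + s *\<^sub>R v - s *\<^sub>R v))"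
        by (rule lborel_integral_translate[symmetric]) measurable
      finally show ?thesis using True by simp
    qed simp
    have "(LINT y|lborel. F (y + v) * \<phi> y) = (LINT y|lborel. F (y + v) * \<phi> (y + v - v))" by simp
    also have "\<dots> = (LINT y|lborel. F y * \<phi> (y - v))"
      by (rule lborel_integral_translate) measurable
    finally have tr: "(LINT y|lborel. F (y + v) * \<phi> y) = (LINT y|lborel. F y * \<phi> (y - v))" .
    have i1: "integrable lborel (\<lambda>y. F y * \<phi> (y - v))"
      using integrable_mult_test_function[OF F shift[of 1]] by simp
    note i2 = integrable_mult_test_function[OF F \<phi>]
    have "(LINT y|lborel. F (y + v) * \<phi> y) - (LINT y|lborel. F y * \<phi> y) = (LINT y|lborel. F y * (\<phi> (y - v) - \<phi> y))"
      unfolding tr using i1 i2 by (simp add: right_diff_distrib)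
    also have "\<dots> = (LINT y|lborel. (LINT s|lborel. F y * (indicator {0..1::real} s * - \<psi> (y - s *\<^sub>R v))))"
      by (subst integral_mult_right_zero) (simp only: FTC)
    also have "\<dots> = (LINT s|lborel. (LINT y|lborel. F y * (indicator {0..1::real} s * - \<psi> (y - s *\<^sub>R v))))"
      by (rule lborel_pair.Fubini_integral[OF pairF])
    also have "\<dots> = (LINT s|lborel. (LINT z|lborel. (indicator {0..1::real} s * (G (z + s *\<^sub>R v) \<bullet> v)) * \<phi> z))"
      by (simp only: inner_eq)
    also have "\<dots> = (LINT z|lborel. (LINT s|lborel. (indicator {0..1::real} s * (G (z + s *\<^sub>R v) \<bullet> v)) * \<phi> z))"
      by (rule lborel_pair.Fubini_integral[OF pairG, symmetric])
    also have "\<dots> = (LINT z|lborel. g z * \<phi> z)"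
      by (simp only: integral_mult_left_zero g_def)
    finally show "(LINT y|lborel. (F (y + v) - F y - g y) * \<phi> y) = 0"
      using integrable_mult_test_function[OF Fv \<phi>] i2 integrable_mult_test_function[OF g \<phi>]
      by (simp add: left_diff_distrib)
  qed
  then show ?thesis by eventually_elim (simp add: g_def)
qed

text \<open>Subtracting \<open>a \<bullet> v\<close> under the integral over s leaves the mean of (G
  - a) along v over a segment. Jensen on [0,1], which has mass 1, and Cauchy-Schwarz bound its p-th
  power; after Fubini each s contributes a translate of the same integral. Both endpoints being in
  the ball, convexity keeps the segment inside.\<close>

lemma weak_gradient_difference_norm:
  fixes F :: "'a::euclidean_space \<Rightarrow> real" and G :: "'a \<Rightarrow> 'a"
  assumes F: "integrable lborel F" and G: "integrable lborel G" and p: "1 \<le> p"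
    and weak: "\<And>\<phi> b. \<phi> \<in> test_functions (ball x r) \<Longrightarrow> b \<in> Basis \<Longrightarrow>
      (LINT y|lborel. F y * partial b \<phi> y) = - (LINT y|lborel. (G y \<bullet> b) * \<phi> y)"
  shows "(\<integral>\<^sup>+z. indicator (ball x r) z * (indicator (ball x r) (z + v) *
        ennreal (\<bar>F (z + v) - F z - a \<bullet> v\<bar> powr p)) \<partial>lborel)
      \<le> ennreal (norm v powr p) * (\<integral>\<^sup>+y\<in>ball x r. ennreal (norm (G y - a) powr p) \<partial>lborel)"
proof -
  let ?B = "ball x r"
  let ?N = "\<integral>\<^sup>+y\<in>?B. ennreal (norm (G y - a) powr p) \<partial>lborel"
  have [measurable]: "F \<in> borel_measurable borel" "G \<in> borel_measurable borel" using F G by auto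
  have [measurable]: "?B \<in> sets borel" by simp
  define D where "D = {z \<in> ?B. z + v \<in> ?B}"
  have D: "open D"
  proof -
    have "D = ?B \<inter> ((\<lambda>z. z + v) -` ?B)" by (auto simp: D_def)
    then show ?thesis
      using open_vimage[of ?B "\<lambda>z. z + v"] by (simp add: open_Int continuous_intros)
  qed
  have seg: "z + s *\<^sub>R v \<in> ?B" if "z \<in> D" "0 \<le> s" "s \<le> 1" for z s
  proof -
    have "(1 - s) *\<^sub>R z + s *\<^sub>R (z + v) \<in> ?B"
      using that by (intro convexD_alt convex_ball) (auto simp: D_def)
    then show ?thesis by (simp add: algebra_simps)
  qed
  have Gv: "integrable lborel (\<lambda>z. G z \<bullet> v)" using G by simp
  have "AE z in lborel. integrable lborel (\<lambda>s. indicator {0..1::real} s * (G (z + s *\<^sub>R v) \<bullet> v))"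
    by (rule lborel_pair.AE_integrable_snd[OF integrable_pair_segment[OF Gv]])
  moreover have "AE z in lborel. z \<in> D \<longrightarrow>
      F (z + v) - F z = (LINT s|lborel. indicator {0..1::real} s * (G (z + s *\<^sub>R v) \<bullet> v))"
    by (rule weak_gradient_difference[OF F G D _ weak]) (use seg in auto)
  \<comment> \<open>The factor \<open>indicator ?B (z + s *\<^sub>R v)\<close> equals 1 on the
    segments in question; it is inserted so that, after translation by s v, the integral extends
    over the ball only.\<close>
  ultimately have "AE z in lborel. indicator ?B z * (indicator ?B (z + v) *
        ennreal (\<bar>F (z + v) - F z - a \<bullet> v\<bar> powr p))
      \<le> (\<integral>\<^sup>+s. indicator {0..1::real} s * (indicator ?B (z + s *\<^sub>R v) *
            ennreal (norm v powr p * norm (G (z + s *\<^sub>R v) - a) powr p)) \<partial>lborel)"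
  proof eventually_elim
    case (elim z)
    show ?case
    proof (cases "z \<in> D")
      case False
      then show ?thesis by (auto simp: D_def indicator_def)
    next
      case True
      let ?h = "\<lambda>s. (G (z + s *\<^sub>R v) - a) \<bullet> v"
      have 1: "set_integrable lborel {0..1::real} (\<lambda>s. G (z + s *\<^sub>R v) \<bullet> v)"
        using elim(1) by (simp add: set_integrable_def)
      have 2: "set_integrable lborel {0..1::real} (\<lambda>s. a \<bullet> v)"
        by (simp add: set_integrable_def)
      have h: "set_integrable lborel {0..1::real} ?h"
        using set_integral_diff(1)[OF 1 2] by (simp add: inner_diff_left)
      have "F (z + v) - F z - a \<bullet> v = (LINT s:{0..1::real}|lborel. ?h s)"
        using set_integral_diff(2)[OF 1 2] elim(2) True
        by (simp add: inner_diff_left set_lebesgue_integral_def)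
      then have "ennreal (\<bar>F (z + v) - F z - a \<bullet> v\<bar> powr p)
          \<le> (\<integral>\<^sup>+s\<in>{0..1}. ennreal (\<bar>?h s\<bar> powr p) \<partial>lborel)"
        using jensen_powr_set[OF h _ _ p] by simp
      also have "\<dots> \<le> (\<integral>\<^sup>+s. indicator {0..1::real} s * (indicator ?B (z + s *\<^sub>R v) *
            ennreal (norm v powr p * norm (G (z + s *\<^sub>R v) - a) powr p)) \<partial>lborel)"
      proof (rule nn_integral_mono)
        fix s :: real
        have "\<bar>?h s\<bar> powr p \<le> (norm v * norm (G (z + s *\<^sub>R v) - a)) powr p"
          using p Cauchy_Schwarz_ineq2[of "G (z + s *\<^sub>R v) - a" v] by (intro powr_mono2) (auto simp: mult.commute)
        also have "\<dots> = norm v powr p * norm (G (z + s *\<^sub>R v) - a) powr p" by (simp add: powr_mult)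
        finally show "ennreal (\<bar>?h s\<bar> powr p) * indicator {0..1} s
          \<le> indicator {0..1::real} s * (indicator ?B (z + s *\<^sub>R v) *
            ennreal (norm v powr p * norm (G (z + s *\<^sub>R v) - a) powr p))"
          using seg[OF True, of s] by (auto simp: indicator_def intro!: ennreal_leI)
      qed
      finally show ?thesis using True by (simp add: D_def)
    qed
  qed
  then have "(\<integral>\<^sup>+z. indicator ?B z * (indicator ?B (z + v) * ennreal (\<bar>F (z + v) - F z - a \<bullet> v\<bar> powr p)) \<partial>lborel)
     \<le> (\<integral>\<^sup>+z. (\<integral>\<^sup>+s. indicator {0..1::real} s * (indicator ?B (z + s *\<^sub>R v) *
            ennreal (norm v powr p * norm (G (z + s *\<^sub>R v) - a) powr p)) \<partial>lborel) \<partial>lborel)"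
    by (rule nn_integral_mono_AE)
  also have "\<dots> = (\<integral>\<^sup>+s. (\<integral>\<^sup>+z. indicator {0..1::real} s * (indicator ?B (z + s *\<^sub>R v) *
            ennreal (norm v powr p * norm (G (z + s *\<^sub>R v) - a) powr p)) \<partial>lborel) \<partial>lborel)"
    by (rule lborel_pair.Fubini'[of "\<lambda>s z. indicator {0..1::real} s * (indicator ?B (z + s *\<^sub>R v) *
            ennreal (norm v powr p * norm (G (z + s *\<^sub>R v) - a) powr p))"]) measurable
  also have "\<dots> = (\<integral>\<^sup>+s. indicator {0..1::real} s * (ennreal (norm v powr p) * ?N) \<partial>lborel)"
  proof (rule nn_integral_cong)
    fix s :: real
    have "(\<integral>\<^sup>+z. indicator {0..1::real} s * (indicator ?B (z + s *\<^sub>R v) *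
            ennreal (norm v powr p * norm (G (z + s *\<^sub>R v) - a) powr p)) \<partial>lborel)
       = (\<integral>\<^sup>+z. indicator {0..1::real} s * (indicator ?B z *
            ennreal (norm v powr p * norm (G z - a) powr p)) \<partial>lborel)"
      by (rule lborel_nn_integral_translate) measurable
    also have "\<dots> = (\<integral>\<^sup>+z. indicator {0..1::real} s * ennreal (norm v powr p) *
         (ennreal (norm (G z - a) powr p) * indicator ?B z) \<partial>lborel)"
      by (simp add: ennreal_mult mult_ac)
    also have "\<dots> = indicator {0..1::real} s * ennreal (norm v powr p) * ?N"
      by (rule nn_integral_cmult) measurable
    finally show "(\<integral>\<^sup>+z. indicator {0..1::real} s * (indicator ?B (z + s *\<^sub>R v) *
            ennreal (norm v powr p * norm (G (z + s *\<^sub>R v) - a) powr p)) \<partial>lborel)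
       = indicator {0..1::real} s * (ennreal (norm v powr p) * ?N)" by (simp add: mult.assoc)
  qed
  also have "\<dots> = ennreal (norm v powr p) * ?N"
    by (subst nn_integral_multc) auto
  finally show ?thesis .
qed

text \<open>Substitute w = z + v, exchange the integrals and use the bound for each fixed v. Two
  points of the ball differ by a vector of norm below 2r: this gives the factor (2r)^p, and the
  volume of the ball of radius 2r comes from integrating over v.\<close>

lemma poincare_double_integral:
  fixes F :: "'a::euclidean_space \<Rightarrow> real" and G :: "'a \<Rightarrow> 'a"
  assumes F: "integrable lborel F" and G: "integrable lborel G" and p: "1 \<le> p" and r: "0 < r"
    and weak: "\<And>\<phi> b. \<phi> \<in> test_functions (ball x r) \<Longrightarrow> b \<in> Basis \<Longrightarrow>
      (LINT y|lborel. F y * partial b \<phi> y) = - (LINT y|lborel. (G y \<bullet> b) * \<phi> y)"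
  shows "(\<integral>\<^sup>+z\<in>ball x r. (\<integral>\<^sup>+w\<in>ball x r. ennreal (\<bar>F w - F z - a \<bullet> (w - z)\<bar> powr p) \<partial>lborel) \<partial>lborel)
      \<le> ennreal ((2 * r) powr p * measure lborel (ball (0::'a) (2 * r))) *
        (\<integral>\<^sup>+y\<in>ball x r. ennreal (norm (G y - a) powr p) \<partial>lborel)"
proof -
  let ?B = "ball x r"
  let ?N = "\<integral>\<^sup>+y\<in>?B. ennreal (norm (G y - a) powr p) \<partial>lborel"
  let ?k = "\<lambda>v z. indicator ?B z * (indicator ?B (z + v) * ennreal (\<bar>F (z + v) - F z - a \<bullet> v\<bar> powr p))"
  have [measurable]: "F \<in> borel_measurable borel" "G \<in> borel_measurable borel" using F G by auto
  have [measurable]: "?B \<in> sets borel" by simp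
  have "(\<integral>\<^sup>+z\<in>?B. (\<integral>\<^sup>+w\<in>?B. ennreal (\<bar>F w - F z - a \<bullet> (w - z)\<bar> powr p) \<partial>lborel) \<partial>lborel)
     = (\<integral>\<^sup>+z. (\<integral>\<^sup>+v. ?k v z \<partial>lborel) \<partial>lborel)"
  proof (rule nn_integral_cong)
    fix z :: 'a
    have "(\<integral>\<^sup>+w\<in>?B. ennreal (\<bar>F w - F z - a \<bullet> (w - z)\<bar> powr p) \<partial>lborel)
        = (\<integral>\<^sup>+v. ennreal (\<bar>F (v + z) - F z - a \<bullet> (v + z - z)\<bar> powr p) * indicator ?B (v + z) \<partial>lborel)"
      by (rule lborel_nn_integral_translate[symmetric]) measurable
    also have "\<dots> = (\<integral>\<^sup>+v. indicator ?B (z + v) * ennreal (\<bar>F (z + v) - F z - a \<bullet> v\<bar> powr p) \<partial>lborel)"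
      by (simp add: add.commute mult.commute)
    finally show "(\<integral>\<^sup>+w\<in>?B. ennreal (\<bar>F w - F z - a \<bullet> (w - z)\<bar> powr p) \<partial>lborel) * indicator ?B z
        = (\<integral>\<^sup>+v. ?k v z \<partial>lborel)"
      by (simp add: nn_integral_cmult mult.commute[of _ "indicator ?B z"])
  qed
  also have "\<dots> = (\<integral>\<^sup>+v. (\<integral>\<^sup>+z. ?k v z \<partial>lborel) \<partial>lborel)"
    by (rule lborel_pair.Fubini'[of ?k]) measurable
  also have "\<dots> \<le> (\<integral>\<^sup>+v. (ennreal ((2 * r) powr p) * ?N) * indicator (ball (0::'a) (2 * r)) v \<partial>lborel)"
  proof (rule nn_integral_mono)
    fix v :: 'a
    show "(\<integral>\<^sup>+z. ?k v z \<partial>lborel) \<le> (ennreal ((2 * r) powr p) * ?N) * indicator (ball (0::'a) (2 * r)) v"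
    proof (cases "v \<in> ball (0::'a) (2 * r)")
      case True
      have "(\<integral>\<^sup>+z. ?k v z \<partial>lborel) \<le> ennreal (norm v powr p) * ?N"
        by (rule weak_gradient_difference_norm[OF F G p weak])
      also have "\<dots> \<le> ennreal ((2 * r) powr p) * ?N"
        using True p by (intro mult_right_mono ennreal_leI powr_mono2) auto
      finally show ?thesis using True by simp
    next
      case False
      have "?k v z = 0" for z
      proof (cases "z \<in> ?B \<and> z + v \<in> ?B")
        case True
        then have "norm (x - z) < r" "norm (x - (z + v)) < r" by (auto simp: dist_norm)
        then have "norm v < 2 * r" using norm_triangle_ineq4[of "x - z" "x - (z + v)"] by simp
        with False show ?thesis by simp
      qed (auto simp: indicator_def)
      then have "(\<integral>\<^sup>+z. ?k v z \<partial>lborel) = (\<integral>\<^sup>+(z::'a). 0 \<partial>lborel)" by (intro nn_integral_cong)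
      then show ?thesis by simp
    qed
  qed
  also have "\<dots> = (ennreal ((2 * r) powr p) * ?N) * emeasure lborel (ball (0::'a) (2 * r))"
    by (rule nn_integral_cmult_indicator) simp
  also have "\<dots> = ennreal ((2 * r) powr p * measure lborel (ball (0::'a) (2 * r))) * ?N"
    using emeasure_lborel_ball_finite[of "0::'a" "2 * r"]
    by (simp add: emeasure_eq_ennreal_measure ennreal_mult mult_ac less_top[symmetric])
  finally show ?thesis .
qed

subsection \<open>First-order expansion at a point\<close>

lemma powr_add_le:
  fixes a b p :: real
  assumes "0 \<le> p"
  shows "\<bar>a + b\<bar> powr p \<le> 2 powr p * (\<bar>a\<bar> powr p + \<bar>b\<bar> powr p)"
proof -
  have "\<bar>a + b\<bar> powr p \<le> (2 * max \<bar>a\<bar> \<bar>b\<bar>) powr p" using assms by (intro powr_mono2) auto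
  also have "\<dots> = 2 powr p * (max \<bar>a\<bar> \<bar>b\<bar>) powr p" by (simp add: powr_mult)
  also have "(max \<bar>a\<bar> \<bar>b\<bar>) powr p \<le> \<bar>a\<bar> powr p + \<bar>b\<bar> powr p" by (simp add: max_def)
  finally show ?thesis by simp
qed

text \<open>The average minus c is the average of H - c. Jensen contributes V^(p-1) and the
  normalisation V^(-p), which leaves 1/V.\<close>

lemma average_deviation:
  fixes H :: "'a::euclidean_space \<Rightarrow> real"
  assumes H: "set_integrable lborel (ball x r) H" and r: "0 < r" and p: "1 \<le> p"
  defines "V \<equiv> measure lborel (ball x r)"
  shows "ennreal (\<bar>(LINT w:ball x r|lborel. H w) / V - c\<bar> powr p) \<le>
    ennreal (1 / V) * (\<integral>\<^sup>+w\<in>ball x r. ennreal (\<bar>H w - c\<bar> powr p) \<partial>lborel)"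
proof -
  let ?B = "ball x r" and ?m = "(LINT w:ball x r|lborel. H w) / V"
  let ?N = "\<integral>\<^sup>+w\<in>ball x r. ennreal (\<bar>H w - c\<bar> powr p) \<partial>lborel"
  have V: "V > 0" using r by (simp add: V_def content_ball_pos)
  have h: "set_integrable lborel ?B (\<lambda>w. H w - c)"
    using H set_integrable_const_ball by (rule set_integral_diff)
  have "(LINT w:?B|lborel. H w - c) = (LINT w:?B|lborel. H w) - (LINT w:?B|lborel. c)"
    using H set_integrable_const_ball by (rule set_integral_diff)
  also have "(LINT w:?B|lborel. c) = c * V" by (simp add: set_lebesgue_integral_def V_def)
  finally have "(LINT w:?B|lborel. H w - c) = V * (?m - c)" using V by (simp add: right_diff_distrib)
  then have "ennreal (\<bar>V * (?m - c)\<bar> powr p) \<le> ennreal (V powr (p - 1)) * ?N"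
    using jensen_powr_set[OF h _ emeasure_lborel_ball_finite p] by (simp add: V_def)
  then have "ennreal (1 / V powr p) * ennreal (\<bar>V * (?m - c)\<bar> powr p)
      \<le> ennreal (1 / V powr p) * (ennreal (V powr (p - 1)) * ?N)"
    by (intro mult_left_mono) auto
  moreover have "ennreal (1 / V powr p) * ennreal (\<bar>V * (?m - c)\<bar> powr p) = ennreal (\<bar>?m - c\<bar> powr p)"
    using V by (simp add: ennreal_mult[symmetric] abs_mult powr_mult)
  moreover have "ennreal (1 / V powr p) * (ennreal (V powr (p - 1)) * ?N) = ennreal (1 / V) * ?N"
    using V by (simp add: ennreal_mult[symmetric] mult.assoc[symmetric] powr_diff)
  ultimately show ?thesis by simp
qed

lemma content_ball_scale:
  fixes x y :: "'a::euclidean_space"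
  assumes "0 \<le> r" "0 \<le> c"
  shows "measure lborel (ball x (c * r)) = c ^ DIM('a) * measure lborel (ball y r)"
  using assms by (simp add: content_ball power_mult_distrib)

lemma powr_inverse_le_imp:
  fixes a b p :: real
  assumes "0 \<le> a" "0 \<le> b" "0 < p" "a powr p \<le> b powr p" shows "a \<le> b"
  using assms powr_less_mono2[of p b a] by (meson not_le)

text \<open>The rates are stated as \<open>for every \<eta>, eventually\<close> with
  \<open>ennreal\<close> integrals, so finiteness is part of the bound. The value l is found as the
  limit of the averages of H along the radii 1/(k+1), and the telescoping estimate extends the rate
  to all small r.\<close>

lemma pointwise_expansion:
  fixes F :: "'a::euclidean_space \<Rightarrow> real" and G :: "'a \<Rightarrow> 'a"
  assumes F: "integrable lborel F" and G: "integrable lborel G" and p: "1 \<le> p" and \<rho>: "0 < \<rho>"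
    and weak: "\<And>\<phi> b. \<phi> \<in> test_functions (ball x \<rho>) \<Longrightarrow> b \<in> Basis \<Longrightarrow>
      (LINT y|lborel. F y * partial b \<phi> y) = - (LINT y|lborel. (G y \<bullet> b) * \<phi> y)"
    and small: "\<And>\<eta>. \<eta> > 0 \<Longrightarrow> \<forall>\<^sub>F r in at_right 0.
      (\<integral>\<^sup>+y\<in>ball x r. ennreal (norm (G y - a) powr p) \<partial>lborel) \<le> ennreal (\<eta> * measure lborel (ball x r))"
  obtains l where "\<And>\<eta>. \<eta> > 0 \<Longrightarrow> \<forall>\<^sub>F r in at_right 0.
      (\<integral>\<^sup>+z\<in>ball x r. ennreal (\<bar>F z - l - a \<bullet> (z - x)\<bar> powr p) \<partial>lborel)
        \<le> ennreal (\<eta> * r powr p * measure lborel (ball x r))"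
proof -
  define H where "H z = F z - a \<bullet> (z - x)" for z
  define V where "V r = measure lborel (ball x r)" for r
  define m where "m r = (LINT z:ball x r|lborel. H z) / V r" for r
  have [measurable]: "F \<in> borel_measurable borel" "G \<in> borel_measurable borel" using F G by auto
  have Hm[measurable]: "H \<in> borel_measurable borel" unfolding H_def[abs_def] by measurable
  have V: "V r > 0" if "r > 0" for r using that by (simp add: V_def content_ball_pos)
  have eV: "emeasure lborel (ball x r) = ennreal (V r)" for r
    using emeasure_lborel_ball_finite[of x r] by (simp add: V_def emeasure_eq_ennreal_measure less_top[symmetric])
  have H: "set_integrable lborel (ball x r) H" for r
  proof -
    have 1: "set_integrable lborel (ball x r) F" by (rule set_integrable_lborel_subset[OF F]) simp
    have "set_integrable lborel (cball x r) (\<lambda>z. a \<bullet> (z - x))"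
      unfolding set_integrable_def by (rule borel_integrable_compact) (auto intro!: continuous_intros)
    then have 2: "set_integrable lborel (ball x r) (\<lambda>z. a \<bullet> (z - x))"
      by (rule set_integrable_subset) auto
    show ?thesis unfolding H_def[abs_def] using 1 2 by (rule set_integral_diff)
  qed
  \<comment> \<open>Only differences of H occur below, and they are exactly the integrand of
    \<open>poincare_double_integral\<close>; so F and G can be kept there and no weak derivative of
    H is formed.\<close>
  have HH: "H w - H z = F w - F z - a \<bullet> (w - z)" for w z
    by (simp add: H_def inner_diff_right)
  \<comment> \<open>K is the doubling constant of ball volumes. In c, one factor K comes from the
    ball of radius 2r in the Poincare bound, the other from comparing balls of radii s and r with
    r/2 <= s <= r.\<close>
  define K where "K = (2::real) ^ DIM('a)"
  have K: "K > 0" by (simp add: K_def)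
  define c where "c = 2 powr p * K * K"
  have K1: "K \<ge> 1" by (simp add: K_def)
  have c: "c > 0" using K by (simp add: c_def)
  \<comment> \<open>By \<open>average_deviation\<close> with c = H z, the distance of H z from the
    average is bounded by the mean over w of |H w - H z|^p; integrating in z gives the double
    integral.\<close>
  have poincare: "(\<integral>\<^sup>+z\<in>ball x r. ennreal (\<bar>H z - m r\<bar> powr p) \<partial>lborel) \<le> ennreal (2 powr p * K * \<eta> * r powr p * V r)"
    if r: "0 < r" "r \<le> \<rho>" and \<eta>: "\<eta> > 0"
      "(\<integral>\<^sup>+y\<in>ball x r. ennreal (norm (G y - a) powr p) \<partial>lborel) \<le> ennreal (\<eta> * V r)" for r \<eta>
  proof -
    let ?B = "ball x r"
    have [measurable]: "?B \<in> sets borel" by simp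
    have weak': "(LINT y|lborel. F y * partial b \<phi> y) = - (LINT y|lborel. (G y \<bullet> b) * \<phi> y)"
      if "\<phi> \<in> test_functions ?B" "b \<in> Basis" for \<phi> b
    proof (rule weak[OF _ that(2)])
      show "\<phi> \<in> test_functions (ball x \<rho>)"
        using that(1) test_functions_mono[OF subset_ball[OF r(2)], of x] by blast
    qed
    have "(\<integral>\<^sup>+z\<in>?B. ennreal (\<bar>H z - m r\<bar> powr p) \<partial>lborel)
      \<le> (\<integral>\<^sup>+z. ennreal (1 / V r) * ((\<integral>\<^sup>+w\<in>?B. ennreal (\<bar>H w - H z\<bar> powr p) \<partial>lborel) * indicator ?B z) \<partial>lborel)"
    proof (rule nn_integral_mono)
      fix z
      have "ennreal (\<bar>H z - m r\<bar> powr p) \<le> ennreal (1 / V r) * (\<integral>\<^sup>+w\<in>?B. ennreal (\<bar>H w - H z\<bar> powr p) \<partial>lborel)"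
        using average_deviation[OF H r(1) p, of "H z"] by (simp add: m_def V_def abs_minus_commute)
      then show "ennreal (\<bar>H z - m r\<bar> powr p) * indicator ?B z \<le>
         ennreal (1 / V r) * ((\<integral>\<^sup>+w\<in>?B. ennreal (\<bar>H w - H z\<bar> powr p) \<partial>lborel) * indicator ?B z)"
        by (auto simp: indicator_def)
    qed
    also have "\<dots> = ennreal (1 / V r) * (\<integral>\<^sup>+z\<in>?B. (\<integral>\<^sup>+w\<in>?B. ennreal (\<bar>H w - H z\<bar> powr p) \<partial>lborel) \<partial>lborel)"
      by (rule nn_integral_cmult) measurable
    also have "(\<integral>\<^sup>+z\<in>?B. (\<integral>\<^sup>+w\<in>?B. ennreal (\<bar>H w - H z\<bar> powr p) \<partial>lborel) \<partial>lborel)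
       = (\<integral>\<^sup>+z\<in>?B. (\<integral>\<^sup>+w\<in>?B. ennreal (\<bar>F w - F z - a \<bullet> (w - z)\<bar> powr p) \<partial>lborel) \<partial>lborel)"
      by (simp only: HH)
    also have "ennreal (1 / V r) * \<dots> \<le> ennreal (1 / V r) * (ennreal ((2 * r) powr p * measure lborel (ball (0::'a) (2 * r))) *
        (\<integral>\<^sup>+y\<in>ball x r. ennreal (norm (G y - a) powr p) \<partial>lborel))"
      by (intro mult_left_mono poincare_double_integral[OF F G p r(1) weak']) auto
    also have "\<dots> \<le> ennreal (1 / V r) * (ennreal ((2 * r) powr p * measure lborel (ball (0::'a) (2 * r))) * ennreal (\<eta> * V r))"
      by (intro mult_left_mono \<eta>) auto
    also have "measure lborel (ball (0::'a) (2 * r)) = K * V r"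
      using r content_ball_scale[of r 2 0 x] by (simp add: K_def V_def)
    also have "ennreal (1 / V r) * (ennreal ((2 * r) powr p * (K * V r)) * ennreal (\<eta> * V r))
      = ennreal (2 powr p * K * \<eta> * r powr p * V r)"
      using V[OF r(1)] K r \<eta>(1) by (simp add: ennreal_mult[symmetric] powr_mult field_simps)
    finally show ?thesis .
  qed
  have osc: "\<bar>m s - m r\<bar> powr p \<le> c * \<eta> * r powr p"
    if r: "0 < r" "r \<le> \<rho>" and \<eta>: "\<eta> > 0"
      "(\<integral>\<^sup>+y\<in>ball x r. ennreal (norm (G y - a) powr p) \<partial>lborel) \<le> ennreal (\<eta> * V r)"
      and s: "r / 2 \<le> s" "s \<le> r" for r s \<eta>
  proof -
    have s0: "s > 0" using s r by simp
    have "V r \<le> measure lborel (ball x (2 * s))"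
      unfolding V_def using s s0 emeasure_lborel_ball_finite[of x "2 * s"]
      by (intro measure_mono_fmeasurable) (auto intro!: subset_ball simp: fmeasurable_def)
    also have "\<dots> = K * V s" using s0 content_ball_scale[of s 2 x x] by (simp add: K_def V_def)
    finally have Vs: "V r \<le> K * V s" .
    have "ennreal (\<bar>m s - m r\<bar> powr p) \<le> ennreal (1 / V s) * (\<integral>\<^sup>+w\<in>ball x s. ennreal (\<bar>H w - m r\<bar> powr p) \<partial>lborel)"
      unfolding m_def[of s] V_def[of s] by (rule average_deviation[OF H s0 p])
    also have "\<dots> \<le> ennreal (1 / V s) * (\<integral>\<^sup>+w\<in>ball x r. ennreal (\<bar>H w - m r\<bar> powr p) \<partial>lborel)"
      using subset_ball[OF s(2), of x] by (intro mult_left_mono nn_integral_mono) (auto simp: indicator_def)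
    also have "\<dots> \<le> ennreal (1 / V s) * ennreal (2 powr p * K * \<eta> * r powr p * V r)"
      by (intro mult_left_mono poincare r \<eta>) auto
    also have "\<dots> = ennreal (2 powr p * K * \<eta> * r powr p * (V r / V s))"
      using V[OF s0] V[OF r(1)] K \<eta>(1) by (simp add: ennreal_mult[symmetric])
    also have "\<dots> \<le> ennreal (2 powr p * K * \<eta> * r powr p * K)"
      using V[OF s0] Vs K \<eta>(1) by (intro ennreal_leI mult_left_mono) (auto simp: divide_le_eq)
    finally show ?thesis
      using K \<eta>(1) by (simp add: c_def mult_ac)
  qed
  have scale: "\<exists>R>0. R \<le> 1 \<and> (\<forall>r. 0 < r \<and> r \<le> R \<longrightarrow>
      (\<integral>\<^sup>+z\<in>ball x r. ennreal (\<bar>H z - m r\<bar> powr p) \<partial>lborel) \<le> ennreal (\<epsilon> powr p * r powr p * V r) \<and>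
      (\<forall>s. r / 2 \<le> s \<and> s \<le> r \<longrightarrow> \<bar>m s - m r\<bar> \<le> \<epsilon> * r))" if \<epsilon>: "\<epsilon> > 0" for \<epsilon>
  proof -
    \<comment> \<open>Chosen so that \<open>c * \<eta> = \<epsilon> powr p\<close>, which turns the
      oscillation bound into \<open>\<epsilon> * r\<close> after taking p-th roots.\<close>
    define \<eta> where "\<eta> = \<epsilon> powr p / c"
    have \<eta>: "\<eta> > 0" using \<epsilon> c by (simp add: \<eta>_def)
    obtain R0 where R0: "R0 > 0" "\<And>r. 0 < r \<Longrightarrow> r < R0 \<Longrightarrow>
      (\<integral>\<^sup>+y\<in>ball x r. ennreal (norm (G y - a) powr p) \<partial>lborel) \<le> ennreal (\<eta> * V r)"
      using small[OF \<eta>] unfolding eventually_at_right_field V_def by auto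
    \<comment> \<open>Halving \<open>R0\<close> replaces the strict bound r < R0 by r <= R; the
      bound 1 enters the Cauchy estimate, and \<open>\<rho>\<close> is the radius on which the weak
      derivative is known.\<close>
    define R where "R = min (R0 / 2) (min 1 \<rho>)"
    have R: "R > 0" "R \<le> 1" "R < R0" "R \<le> \<rho>" using R0(1) \<rho> by (auto simp: R_def)
    have c\<eta>: "c * \<eta> = \<epsilon> powr p" using c by (simp add: \<eta>_def)
    show ?thesis
    proof (intro exI[of _ R] conjI allI impI)
      fix r assume r: "0 < r \<and> r \<le> R"
      have g: "(\<integral>\<^sup>+y\<in>ball x r. ennreal (norm (G y - a) powr p) \<partial>lborel) \<le> ennreal (\<eta> * V r)"
        using r R by (intro R0(2)) auto
      have "(\<integral>\<^sup>+z\<in>ball x r. ennreal (\<bar>H z - m r\<bar> powr p) \<partial>lborel) \<le> ennreal (2 powr p * K * \<eta> * r powr p * V r)"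
        using r R by (intro poincare \<eta> g) auto
      also have "\<dots> \<le> ennreal (c * \<eta> * r powr p * V r)"
        using K K1 \<eta> V[of r] r unfolding c_def by (intro ennreal_leI mult_right_mono) auto
      finally show "(\<integral>\<^sup>+z\<in>ball x r. ennreal (\<bar>H z - m r\<bar> powr p) \<partial>lborel) \<le> ennreal (\<epsilon> powr p * r powr p * V r)"
        by (simp only: c\<eta>)
      fix s assume s: "r / 2 \<le> s \<and> s \<le> r"
      have "\<bar>m s - m r\<bar> powr p \<le> c * \<eta> * r powr p"
        using r R s by (intro osc \<eta> g) auto
      also have "\<dots> = (\<epsilon> * r) powr p" by (simp only: c\<eta> powr_mult)
      finally have le: "\<bar>m s - m r\<bar> powr p \<le> (\<epsilon> * r) powr p" .
      show "\<bar>m s - m r\<bar> \<le> \<epsilon> * r"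
        using \<epsilon> r p by (intro powr_inverse_le_imp[OF _ _ _ le]) simp_all
    qed (use R in auto)
  qed
  \<comment> \<open>The geometric sum r + r/2 + r/4 + ... <= 2r. The induction is on the number of
    halvings that bring r down to s, with r varying.\<close>
  have telescope: "\<bar>m s - m r\<bar> \<le> 2 * \<epsilon> * r"
    if step: "\<And>r s. 0 < r \<Longrightarrow> r \<le> R \<Longrightarrow> r / 2 \<le> s \<Longrightarrow> s \<le> r \<Longrightarrow> \<bar>m s - m r\<bar> \<le> \<epsilon> * r"
      and \<epsilon>: "\<epsilon> > 0" and rs: "0 < s" "s \<le> r" "r \<le> R" for \<epsilon> R r s
  proof -
    obtain k :: nat where "r / s \<le> 2 ^ k" using real_arch_pow[of 2 "r / s"] by (auto intro: less_imp_le)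
    then have k: "r / 2 ^ k \<le> s" using rs by (simp add: field_simps)
    from k rs show ?thesis
    proof (induction k arbitrary: r)
      case 0
      then have "s = r" by simp
      then show ?case using 0 \<epsilon> by simp
    next
      case (Suc k)
      show ?case
      proof (cases "r / 2 \<le> s")
        case True
        then have "\<bar>m s - m r\<bar> \<le> \<epsilon> * r" using Suc.prems by (intro step) auto
        also have "\<dots> \<le> 2 * \<epsilon> * r" using Suc.prems \<epsilon> by simp
        finally show ?thesis .
      next
        case False
        have "\<bar>m s - m (r / 2)\<bar> \<le> 2 * \<epsilon> * (r / 2)"
          using False Suc.prems by (intro Suc.IH) auto
        moreover have "\<bar>m (r / 2) - m r\<bar> \<le> \<epsilon> * r" using Suc.prems by (intro step) auto
        ultimately show ?thesis by (simp add: algebra_simps)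
      qed
    qed
  qed
  define X where "X k = m (1 / real (Suc k))" for k
  have Xlim: "\<exists>k0. \<forall>k\<ge>k0. 1 / real (Suc k) \<le> R" if "R > 0" for R
  proof -
    obtain k0 where "1 / real (Suc k0) < R" using \<open>R > 0\<close> by (metis nat_approx_posE)
    moreover have "1 / real (Suc k) \<le> 1 / real (Suc k0)" if "k \<ge> k0" for k
      using that by (intro divide_left_mono) auto
    ultimately show ?thesis by (intro exI[of _ k0]) (auto intro: order_trans less_imp_le)
  qed
  have "Cauchy X"
  proof (rule CauchyI)
    fix e :: real assume e: "e > 0"
    obtain R where R: "R > 0" "R \<le> 1"
      \<comment> \<open>With e/8 the telescoping bound gives |X k - m R| <= e/4, and two such terms
        stay strictly below e.\<close>
      "\<And>r s. 0 < r \<Longrightarrow> r \<le> R \<Longrightarrow> r / 2 \<le> s \<Longrightarrow> s \<le> r \<Longrightarrow> \<bar>m s - m r\<bar> \<le> (e / 8) * r"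
      using scale[of "e / 8"] e by auto
    obtain k0 where k0: "\<And>k. k \<ge> k0 \<Longrightarrow> 1 / real (Suc k) \<le> R" using Xlim[OF R(1)] by blast
    have *: "\<bar>X k - m R\<bar> \<le> e / 4" if "k \<ge> k0" for k
    proof -
      have "\<bar>X k - m R\<bar> \<le> 2 * (e / 8) * R"
        unfolding X_def using e k0[OF that] by (intro telescope[OF R(3)]) auto
      also have "\<dots> \<le> 2 * (e / 8) * 1" using e R by (intro mult_left_mono) auto
      finally show ?thesis by simp
    qed
    show "\<exists>M. \<forall>i\<ge>M. \<forall>j\<ge>M. norm (X i - X j) < e"
    proof (intro exI[of _ k0] allI impI)
      fix i j assume "i \<ge> k0" "j \<ge> k0"
      from *[OF this(1)] *[OF this(2)] e show "norm (X i - X j) < e" unfolding real_norm_def by linarith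
    qed
  qed
  then obtain l where l: "X \<longlonglongrightarrow> l" by (auto simp: Cauchy_convergent_iff convergent_def)
  show ?thesis
  proof (rule that[of l])
    fix \<eta> :: real assume \<eta>: "\<eta> > 0"
    \<comment> \<open>The first summand is the weight of H - m r in \<open>powr_add_le\<close>; the
      second combines the same weight with the 2^p from |m r - l| <= 2 eps r.\<close>
    define d where "d = 2 powr p + 2 powr p * 2 powr p"
    have d: "d > 0" by (simp add: d_def add_pos_pos)
    define \<epsilon> where "\<epsilon> = (\<eta> / d) powr (1 / p)"
    have \<epsilon>: "\<epsilon> > 0" "\<epsilon> powr p = \<eta> / d" using \<eta> d p by (auto simp: \<epsilon>_def powr_powr)
    obtain R where R: "R > 0" "R \<le> 1"
      "\<And>r s. 0 < r \<Longrightarrow> r \<le> R \<Longrightarrow> r / 2 \<le> s \<Longrightarrow> s \<le> r \<Longrightarrow> \<bar>m s - m r\<bar> \<le> \<epsilon> * r"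
      "\<And>r. 0 < r \<Longrightarrow> r \<le> R \<Longrightarrow> (\<integral>\<^sup>+z\<in>ball x r. ennreal (\<bar>H z - m r\<bar> powr p) \<partial>lborel) \<le> ennreal (\<epsilon> powr p * r powr p * V r)"
      using scale[OF \<epsilon>(1)] by auto
    show "\<forall>\<^sub>F r in at_right 0. (\<integral>\<^sup>+z\<in>ball x r. ennreal (\<bar>F z - l - a \<bullet> (z - x)\<bar> powr p) \<partial>lborel)
        \<le> ennreal (\<eta> * r powr p * measure lborel (ball x r))"
    proof (rule eventually_at_rightI[of 0 R])
      fix r assume "r \<in> {0<..<R}"
      then have r: "0 < r" "r \<le> R" by auto
      obtain k0 where k0: "\<And>k. k \<ge> k0 \<Longrightarrow> 1 / real (Suc k) \<le> r" using Xlim[OF r(1)] by blast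
      have lm: "\<bar>l - m r\<bar> \<le> 2 * \<epsilon> * r"
      proof (rule LIMSEQ_le_const2)
        show "(\<lambda>k. \<bar>X k - m r\<bar>) \<longlonglongrightarrow> \<bar>l - m r\<bar>" by (intro tendsto_intros l)
        have "\<bar>X k - m r\<bar> \<le> 2 * \<epsilon> * r" if "k \<ge> k0" for k
          unfolding X_def using k0[OF that] r \<epsilon> by (intro telescope[OF R(3)]) auto
        then show "\<exists>N. \<forall>k\<ge>N. \<bar>X k - m r\<bar> \<le> 2 * \<epsilon> * r" by blast
      qed
      have lmp: "\<bar>m r - l\<bar> powr p \<le> 2 powr p * (\<epsilon> powr p * r powr p)"
      proof -
        have "\<bar>m r - l\<bar> powr p \<le> (2 * \<epsilon> * r) powr p" using lm p by (intro powr_mono2) auto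
        then show ?thesis by (simp add: powr_mult mult.assoc)
      qed
      have [measurable]: "ball x r \<in> sets borel" by simp
      have "(\<integral>\<^sup>+z\<in>ball x r. ennreal (\<bar>F z - l - a \<bullet> (z - x)\<bar> powr p) \<partial>lborel)
         \<le> (\<integral>\<^sup>+z. ennreal (2 powr p) * (ennreal (\<bar>H z - m r\<bar> powr p) * indicator (ball x r) z)
             + ennreal (2 powr p * (2 powr p * (\<epsilon> powr p * r powr p))) * indicator (ball x r) z \<partial>lborel)"
      proof (rule nn_integral_mono)
        fix z
        have "F z - l - A = (F z - A - m r) + (m r - l)" for A by simp
        then have "F z - l - a \<bullet> (z - x) = (H z - m r) + (m r - l)" unfolding H_def .
        then have "\<bar>F z - l - a \<bullet> (z - x)\<bar> powr p = \<bar>(H z - m r) + (m r - l)\<bar> powr p" by (simp only:)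
        also have "\<dots> \<le> 2 powr p * (\<bar>H z - m r\<bar> powr p + \<bar>m r - l\<bar> powr p)"
          using p by (intro powr_add_le) auto
        also have "\<dots> \<le> 2 powr p * (\<bar>H z - m r\<bar> powr p + 2 powr p * (\<epsilon> powr p * r powr p))"
          using lmp by (intro mult_left_mono add_left_mono) auto
        finally have "ennreal (\<bar>F z - l - a \<bullet> (z - x)\<bar> powr p) \<le>
           ennreal (2 powr p * \<bar>H z - m r\<bar> powr p + 2 powr p * (2 powr p * (\<epsilon> powr p * r powr p)))"
          by (intro ennreal_leI) (simp add: distrib_left)
        also have "\<dots> = ennreal (2 powr p) * ennreal (\<bar>H z - m r\<bar> powr p) + ennreal (2 powr p * (2 powr p * (\<epsilon> powr p * r powr p)))"
          by (simp add: ennreal_mult)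
        finally show "ennreal (\<bar>F z - l - a \<bullet> (z - x)\<bar> powr p) * indicator (ball x r) z \<le>
           ennreal (2 powr p) * (ennreal (\<bar>H z - m r\<bar> powr p) * indicator (ball x r) z)
             + ennreal (2 powr p * (2 powr p * (\<epsilon> powr p * r powr p))) * indicator (ball x r) z"
          by (auto simp: indicator_def)
      qed
      also have "\<dots> = (\<integral>\<^sup>+z. ennreal (2 powr p) * (ennreal (\<bar>H z - m r\<bar> powr p) * indicator (ball x r) z) \<partial>lborel)
          + (\<integral>\<^sup>+z. ennreal (2 powr p * (2 powr p * (\<epsilon> powr p * r powr p))) * indicator (ball x r) z \<partial>lborel)"
        by (rule nn_integral_add) measurable
      also have "(\<integral>\<^sup>+z. ennreal (2 powr p) * (ennreal (\<bar>H z - m r\<bar> powr p) * indicator (ball x r) z) \<partial>lborel)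
          = ennreal (2 powr p) * (\<integral>\<^sup>+z\<in>ball x r. ennreal (\<bar>H z - m r\<bar> powr p) \<partial>lborel)"
        by (rule nn_integral_cmult) measurable
      also have "(\<integral>\<^sup>+z. ennreal (2 powr p * (2 powr p * (\<epsilon> powr p * r powr p))) * indicator (ball x r) z \<partial>lborel)
          = ennreal (2 powr p * (2 powr p * (\<epsilon> powr p * r powr p))) * ennreal (V r)"
        unfolding eV[symmetric] by (rule nn_integral_cmult_indicator) measurable
      finally have "(\<integral>\<^sup>+z\<in>ball x r. ennreal (\<bar>F z - l - a \<bullet> (z - x)\<bar> powr p) \<partial>lborel)
         \<le> ennreal (2 powr p) * (\<integral>\<^sup>+z\<in>ball x r. ennreal (\<bar>H z - m r\<bar> powr p) \<partial>lborel)
          + ennreal (2 powr p * (2 powr p * (\<epsilon> powr p * r powr p))) * ennreal (V r)" .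
      also have "\<dots> \<le> ennreal (2 powr p) * ennreal (\<epsilon> powr p * r powr p * V r)
          + ennreal (2 powr p * (2 powr p * (\<epsilon> powr p * r powr p))) * ennreal (V r)"
        by (intro add_mono mult_left_mono R(4) r) auto
      also have "\<dots> = ennreal (d * \<epsilon> powr p * r powr p * V r)"
        using V[OF r(1)] by (simp add: ennreal_mult[symmetric] ennreal_plus[symmetric] d_def algebra_simps del: ennreal_plus)
      also have "\<dots> = ennreal (\<eta> * r powr p * V r)" using \<epsilon>(2) d by simp
      finally show "(\<integral>\<^sup>+z\<in>ball x r. ennreal (\<bar>F z - l - a \<bullet> (z - x)\<bar> powr p) \<partial>lborel)
        \<le> ennreal (\<eta> * r powr p * measure lborel (ball x r))"
        by (simp add: V_def)
    qed (fact R(1))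
  qed
qed

text \<open>The integral of \<open>\<phi> (y + b) - \<phi> y\<close> over y is 0 by translation
  invariance. Writing this difference as an integral of the derivative along the segment and
  exchanging the integrals gives the integral of \<open>partial b \<phi>\<close>.\<close>

lemma integral_partial_test_function:
  assumes \<phi>: "\<phi> \<in> test_functions U" and b: "b \<in> Basis"
  shows "(LINT y|lborel. partial b \<phi> y) = 0"
proof -
  note p = partial_in_test_functions[OF \<phi> b]
  note \<phi>i = integrable_test_function[OF \<phi>]
  have [measurable]: "\<phi> \<in> borel_measurable borel" using test_functionsD(5)[OF \<phi>] .
  have [measurable]: "partial b \<phi> \<in> borel_measurable borel" using test_functionsD(5)[OF p] .
  have FTC: "(LINT s|lborel. indicator {0..1::real} s * partial b \<phi> (y + s *\<^sub>R b)) = \<phi> (y + b) - \<phi> y" for y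
  proof -
    have "(LINT s|lborel. indicator {0..1::real} s *\<^sub>R partial b \<phi> (y + s *\<^sub>R b)) = \<phi> (y + 1 *\<^sub>R b) - \<phi> (y + 0 *\<^sub>R b)"
    proof (rule integral_FTC_Icc)
      fix s :: real
      have "((\<lambda>s. \<phi> (y + s *\<^sub>R b)) has_derivative (\<lambda>t. \<Sum>b'\<in>Basis. ((t *\<^sub>R b) \<bullet> b') * partial b' \<phi> (y + s *\<^sub>R b)))
          (at s within {0..1})"
        by (rule has_derivative_compose[where f="\<lambda>s. y + s *\<^sub>R b" and g=\<phi>, OF _ test_functionsD(7)[OF \<phi>]])
          (auto intro!: derivative_eq_intros)
      also have "(\<lambda>t. \<Sum>b'\<in>Basis. ((t *\<^sub>R b) \<bullet> b') * partial b' \<phi> (y + s *\<^sub>R b)) = (\<lambda>t. t *\<^sub>R partial b \<phi> (y + s *\<^sub>R b))"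
        using b by (auto simp: inner_Basis if_distrib if_distribR sum.delta cong: if_cong)
      finally show "((\<lambda>s. \<phi> (y + s *\<^sub>R b)) has_vector_derivative partial b \<phi> (y + s *\<^sub>R b)) (at s within {0..1})"
        by (simp only: has_vector_derivative_def)
      show "continuous_on {0..1} (\<lambda>s. partial b \<phi> (y + s *\<^sub>R b))"
        by (intro continuous_intros continuous_on_compose2[OF test_functionsD(4)[OF p]]) auto
    qed auto
    then show ?thesis by simp
  qed
  have "(LINT y|lborel. \<phi> (y + b)) - (LINT y|lborel. \<phi> y) = (LINT y|lborel. \<phi> (y + b) - \<phi> y)"
    using \<phi>i by (intro Bochner_Integration.integral_diff[symmetric]) (simp_all add: lborel_integrable_translate)
  also have "\<dots> = (LINT y|lborel. (LINT s|lborel. indicator {0..1::real} s * partial b \<phi> (y + s *\<^sub>R b)))"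
    by (simp only: FTC)
  also have "\<dots> = (LINT s|lborel. (LINT y|lborel. indicator {0..1::real} s * partial b \<phi> (y + s *\<^sub>R b)))"
    by (rule lborel_pair.Fubini_integral[OF integrable_pair_segment[OF integrable_test_function[OF p]]])
  also have "\<dots> = (LINT s|lborel. indicator {0..1::real} s * (LINT y|lborel. partial b \<phi> y))"
    by (simp add: lborel_integral_translate)
  also have "\<dots> = (LINT y|lborel. partial b \<phi> y)" by simp
  finally show ?thesis by (simp add: lborel_integral_translate)
qed

text \<open>Apply the preceding lemma to the test function
  \<open>(y \<bullet> a) * \<phi> y\<close>. It says that a linear function has its constant
  gradient as weak gradient, which is used for the linear term subtracted from the blow-up.\<close>

lemma integral_linear_partial_test_function:
  assumes \<phi>: "\<phi> \<in> test_functions U" and b: "b \<in> Basis"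
  shows "(LINT y|lborel. (y \<bullet> a) * partial b \<phi> y) = - (LINT y|lborel. (a \<bullet> b) * \<phi> y)"
proof -
  have l: "smooth (\<lambda>y. y \<bullet> a)" using Ck_inner by blast
  note m = mult_in_test_functions[OF l \<phi>]
  have eq: "partial b (\<lambda>y. (y \<bullet> a) * \<phi> y) y = (y \<bullet> a) * partial b \<phi> y + (a \<bullet> b) * \<phi> y" for y
  proof -
    have 1: "((\<lambda>y. y \<bullet> a) has_derivative (\<lambda>v. v \<bullet> a)) (at y)" by (auto intro!: derivative_eq_intros)
    have "partial b \<phi> y = (\<Sum>b'\<in>Basis. (b \<bullet> b') * partial b' \<phi> y)"
      by (rule partial_eqI[OF test_functionsD(7)[OF \<phi>]])
    with partial_eqI[OF has_derivative_mult[OF 1 test_functionsD(7)[OF \<phi>, of y]], of b]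
    show ?thesis by (simp add: inner_commute)
  qed
  have i1: "integrable lborel (\<lambda>y. (y \<bullet> a) * partial b \<phi> y)"
    by (rule integrable_test_function[OF mult_in_test_functions[OF l partial_in_test_functions[OF \<phi> b]]])
  have i2: "integrable lborel (\<lambda>y. (a \<bullet> b) * \<phi> y)"
    using integrable_test_function[OF \<phi>] by simp
  have "0 = (LINT y|lborel. partial b (\<lambda>y. (y \<bullet> a) * \<phi> y) y)"
    using integral_partial_test_function[OF m b] by simp
  also have "\<dots> = (LINT y|lborel. (y \<bullet> a) * partial b \<phi> y) + (LINT y|lborel. (a \<bullet> b) * \<phi> y)"
    unfolding eq using i1 i2 by (rule Bochner_Integration.integral_add)
  finally show ?thesis by simp
qed

section \<open>Affine changes of variables\<close>

lemma AE_lborel_affine: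
  fixes c :: "'a::euclidean_space"
  assumes h: "h \<noteq> 0" and P: "AE y in lborel. P y"
  shows "AE z in lborel. P (c + h *\<^sub>R z)"
proof -
  obtain N where N: "{y. \<not> P y} \<subseteq> N" "emeasure lborel N = 0" "N \<in> sets borel"
    using P by (auto elim!: AE_E)
  have "AE y in lborel. y \<notin> N" using N by (intro AE_not_in) auto
  then have "AE y in density (distr lborel borel (\<lambda>x. c + h *\<^sub>R x)) (\<lambda>_. ennreal (\<bar>h\<bar> ^ DIM('a))). y \<notin> N"
    by (simp only: lborel_affine[OF h, of c, symmetric])
  then have "AE y in distr lborel borel (\<lambda>x. c + h *\<^sub>R x). y \<notin> N"
    using h by (subst (asm) AE_density) auto
  then have "AE z in lborel. c + h *\<^sub>R z \<notin> N"
    using N(3) by (subst (asm) AE_distr_iff) (auto simp: sets.sets_Collect)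
  then show ?thesis using N(1) by (auto elim!: eventually_mono)
qed

lemma lborel_nn_integral_affine:
  fixes c :: "'a::euclidean_space"
  assumes [measurable]: "f \<in> borel_measurable borel" and h: "h \<noteq> 0"
  shows "(\<integral>\<^sup>+y. f y \<partial>lborel) = ennreal (\<bar>h\<bar> ^ DIM('a)) * (\<integral>\<^sup>+z. f (c + h *\<^sub>R z) \<partial>lborel)"
  by (subst lborel_affine[OF h, of c]) (simp add: nn_integral_density nn_integral_distr nn_integral_cmult)

lemma
  fixes c :: "'a::euclidean_space" and f :: "'a \<Rightarrow> real"
  assumes f[measurable]: "f \<in> borel_measurable borel" and h: "h \<noteq> 0"
  shows lborel_integrable_affine: "integrable lborel (\<lambda>z. f (c + h *\<^sub>R z)) \<longleftrightarrow> integrable lborel f"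
    and lborel_integral_affine: "(LINT y|lborel. f y) = \<bar>h\<bar> ^ DIM('a) * (LINT z|lborel. f (c + h *\<^sub>R z))"
proof -
  have "(\<integral>\<^sup>+y. ennreal (norm (f y)) \<partial>lborel) = ennreal (\<bar>h\<bar> ^ DIM('a)) * (\<integral>\<^sup>+z. ennreal (norm (f (c + h *\<^sub>R z))) \<partial>lborel)"
    by (rule lborel_nn_integral_affine[OF _ h]) measurable
  then show "integrable lborel (\<lambda>z. f (c + h *\<^sub>R z)) \<longleftrightarrow> integrable lborel f"
    using h by (auto simp: integrable_iff_bounded ennreal_mult_less_top less_top[symmetric] ennreal_mult_eq_top_iff)
  show "(LINT y|lborel. f y) = \<bar>h\<bar> ^ DIM('a) * (LINT z|lborel. f (c + h *\<^sub>R z))"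
    by (subst lborel_affine[OF h, of c]) (simp add: integral_density integral_distr)
qed

subsection \<open>Lebesgue and Sobolev spaces\<close>

text \<open>If h is not integrable, its integral is 0 by convention, and the bound holds because c
  is nonnegative.\<close>

lemma integral_le_nn_integral:
  fixes h :: "'b \<Rightarrow> real"
  assumes "\<And>x. 0 \<le> h x" "(\<integral>\<^sup>+x. ennreal (h x) \<partial>M) \<le> ennreal c" "0 \<le> c"
  shows "0 \<le> integral\<^sup>L M h" "integral\<^sup>L M h \<le> c"
proof -
  show "0 \<le> integral\<^sup>L M h" using assms(1) by simp
  show "integral\<^sup>L M h \<le> c"
  proof (cases "integrable M h")
    case True
    then have "(\<integral>\<^sup>+x. ennreal (h x) \<partial>M) = ennreal (integral\<^sup>L M h)"
      using assms(1) by (intro nn_integral_eq_integral) auto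
    with assms(2,3) show ?thesis by (simp add: ennreal_le_iff)
  qed (simp add: assms(3) not_integrable_integral_eq)
qed

lemma set_nn_integral_indicator:
  "(\<integral>\<^sup>+x\<in>A. ennreal (h x) \<partial>M) = (\<integral>\<^sup>+x. ennreal (indicator A x *\<^sub>R h x) \<partial>M)"
  by (intro nn_integral_cong) (auto simp: indicator_def)

text \<open>The integrand may depend on r because \<open>Lp_differentiable\<close> puts the division
  by r^p inside the average.\<close>

lemma ball_avg_tendsto_0:
  fixes h :: "real \<Rightarrow> 'a::euclidean_space \<Rightarrow> real"
  assumes "\<And>r z. 0 \<le> h r z"
    and small: "\<And>\<eta>. \<eta> > 0 \<Longrightarrow> \<forall>\<^sub>F r in at_right 0.
      (\<integral>\<^sup>+z\<in>ball x r. ennreal (h r z) \<partial>lebesgue) \<le> ennreal (\<eta> * measure lborel (ball x r))"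
  shows "((\<lambda>r. ball_avg (h r) x r) \<longlongrightarrow> 0) (at_right 0)"
proof (rule tendstoI)
  fix e :: real assume e: "e > 0"
  then have e2: "e / 2 > 0" by simp
  have "\<forall>\<^sub>F r in at_right (0::real). 0 < r" by (simp add: eventually_at_right_less)
  with small[OF e2] show "\<forall>\<^sub>F r in at_right 0. dist (ball_avg (h r) x r) 0 < e"
  proof eventually_elim
    case (elim r)
    have V: "measure lborel (ball x r) > 0" using elim by (simp add: content_ball_pos)
    have nn: "(\<integral>\<^sup>+y. ennreal (indicator (ball x r) y *\<^sub>R h r y) \<partial>lebesgue) \<le> ennreal (e / 2 * measure lborel (ball x r))"
      using elim(1) by (simp only: set_nn_integral_indicator)
    have "0 \<le> indicator (ball x r) y *\<^sub>R h r y" for y using assms(1) by simp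
    note le = integral_le_nn_integral[OF this nn]
    have "0 \<le> (LINT y:ball x r|lebesgue. h r y)" "(LINT y:ball x r|lebesgue. h r y) \<le> e / 2 * measure lborel (ball x r)"
      unfolding set_lebesgue_integral_def using le e by simp_all
    moreover have "e * measure lborel (ball x r) > 0" using e V by simp
    ultimately have "0 \<le> (LINT y:ball x r|lebesgue. h r y)" "(LINT y:ball x r|lebesgue. h r y) < e * measure lborel (ball x r)"
      by linarith+
    with V show ?case by (simp add: ball_avg_def pos_divide_less_eq abs_of_nonneg)
  qed
qed

lemma Lp_cong_AE:
  assumes f: "f \<in> Lp p A" and A: "A \<in> sets lebesgue" and eq: "AE y in lebesgue. y \<in> A \<longrightarrow> f y = g y"
  shows "g \<in> Lp p A"
proof -
  have 1: "(\<lambda>x. indicator A x *\<^sub>R g x) \<in> borel_measurable lebesgue"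
  proof (rule borel_measurable_AE)
    show "(\<lambda>x. indicator A x *\<^sub>R f x) \<in> borel_measurable lebesgue"
      using f by (simp add: Lp_def set_borel_measurable_def)
    show "AE x in lebesgue. indicator A x *\<^sub>R f x = indicator A x *\<^sub>R g x"
      using eq by eventually_elim (auto simp: indicator_def)
  qed
  have fi: "integrable lebesgue (\<lambda>x. indicator A x *\<^sub>R \<bar>f x\<bar> powr p)"
    using f by (simp add: Lp_def set_integrable_def)
  have ae: "AE x in lebesgue. indicator A x *\<^sub>R \<bar>f x\<bar> powr p = indicator A x *\<^sub>R \<bar>g x\<bar> powr p"
    using eq by eventually_elim (auto simp: indicator_def)
  have "(\<lambda>x. indicator A x *\<^sub>R \<bar>g x\<bar> powr p) \<in> borel_measurable lebesgue"
    using borel_measurable_AE[OF borel_measurable_integrable[OF fi] ae] .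
  then have "integrable lebesgue (\<lambda>x. indicator A x *\<^sub>R \<bar>g x\<bar> powr p)"
    by (rule integrable_cong_AE_imp[OF fi _ ae])
  with 1 show ?thesis by (simp add: Lp_def set_borel_measurable_def set_integrable_def)
qed

text \<open>Finiteness of the nonnegative integral makes the p-th power of the Borel version
  integrable; membership and bound survive the change on a null set.\<close>

lemma Lp_borel_versionI:
  fixes u u' :: "'a::euclidean_space \<Rightarrow> real"
  assumes A: "A \<in> sets borel" and u': "u' \<in> borel_measurable borel"
    and eq: "AE y in lebesgue. y \<in> A \<longrightarrow> u y = u' y"
    and le: "(\<integral>\<^sup>+y\<in>A. ennreal (\<bar>u' y\<bar> powr p) \<partial>lborel) \<le> ennreal c" and c: "0 \<le> c"
  shows "u \<in> Lp p A" "(LINT y:A|lebesgue. \<bar>u y\<bar> powr p) \<le> c"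
proof -
  have le': "(\<integral>\<^sup>+y. ennreal (indicator A y *\<^sub>R \<bar>u' y\<bar> powr p) \<partial>lebesgue) \<le> ennreal c"
    using le by (simp add: set_nn_integral_indicator nn_integral_completion)
  have m: "(\<lambda>y. indicator A y *\<^sub>R u' y) \<in> borel_measurable lebesgue"
      "(\<lambda>y. indicator A y *\<^sub>R \<bar>u' y\<bar> powr p) \<in> borel_measurable lebesgue"
    using A u' by (auto intro!: measurable_completion borel_measurable_scaleR borel_measurable_indicator
        powr_real_measurable borel_measurable_abs)
  have "u' \<in> Lp p A"
    unfolding Lp_def set_borel_measurable_def set_integrable_def
    using m le' by (auto intro!: integrableI_bounded simp: order_le_less_trans)
  then show "u \<in> Lp p A"
    using A eq by (elim Lp_cong_AE) (auto elim!: eventually_mono)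
  have "(\<integral>\<^sup>+y. ennreal (indicator A y *\<^sub>R \<bar>u y\<bar> powr p) \<partial>lebesgue) = (\<integral>\<^sup>+y. ennreal (indicator A y *\<^sub>R \<bar>u' y\<bar> powr p) \<partial>lebesgue)"
    using eq by (intro nn_integral_cong_AE) (auto elim!: eventually_mono simp: indicator_def)
  with le' show "(LINT y:A|lebesgue. \<bar>u y\<bar> powr p) \<le> c"
    unfolding set_lebesgue_integral_def using c by (intro integral_le_nn_integral(2)) auto
qed

lemma Lp_subset:
  assumes "f \<in> Lp p A" "B \<in> sets lebesgue" "B \<subseteq> A"
  shows "f \<in> Lp p B"
  using assms set_integrable_subset[of lebesgue A "\<lambda>x. \<bar>f x\<bar> powr p" B]
    set_borel_measurable_subset[of lebesgue A f B] by (auto simp: Lp_def)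

lemma set_integrable_finite_measure_const:
  "A \<in> sets M \<Longrightarrow> emeasure M A < \<infinity> \<Longrightarrow> set_integrable M A (\<lambda>_. c :: real)"
  unfolding set_integrable_def by (simp add: integrable_indicator_iff less_top[symmetric])

lemma Lp_imp_set_integrable_diff:
  assumes f: "f \<in> Lp p A" and A: "A \<in> sets lebesgue" "emeasure lebesgue A < \<infinity>" and p: "1 \<le> p"
  shows "set_integrable lebesgue A (\<lambda>x. \<bar>f x - c\<bar> powr p)"
proof -
  have fm: "(\<lambda>x. indicator A x *\<^sub>R f x) \<in> borel_measurable lebesgue"
    using f by (simp add: Lp_def set_borel_measurable_def)
  have "set_integrable lebesgue A (\<lambda>x. \<bar>f x\<bar> powr p + \<bar>c\<bar> powr p)"
    using f A by (intro set_integral_add set_integrable_finite_measure_const) (auto simp: Lp_def)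
  then have i: "integrable lebesgue (\<lambda>x. 2 powr p * (indicator A x *\<^sub>R (\<bar>f x\<bar> powr p + \<bar>c\<bar> powr p)))"
    unfolding set_integrable_def by (rule integrable_mult_right)
  show ?thesis unfolding set_integrable_def
  proof (rule Bochner_Integration.integrable_bound[OF i])
    \<comment> \<open>f is measurable only after multiplication by the indicator of A; g is
      measurable everywhere and agrees with f on A.\<close>
    define g where "g = (\<lambda>x. indicator A x *\<^sub>R f x)"
    have [measurable]: "g \<in> borel_measurable lebesgue" "A \<in> sets lebesgue" using fm A by (auto simp: g_def)
    have "(\<lambda>x. indicator A x *\<^sub>R (\<bar>g x - c\<bar> powr p)) \<in> borel_measurable lebesgue"
      by measurable
    also have "(\<lambda>x. indicator A x *\<^sub>R (\<bar>g x - c\<bar> powr p)) = (\<lambda>x. indicator A x *\<^sub>R (\<bar>f x - c\<bar> powr p))"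
      by (auto simp: g_def indicator_def)
    finally show "(\<lambda>x. indicator A x *\<^sub>R (\<bar>f x - c\<bar> powr p)) \<in> borel_measurable lebesgue" .
    show "AE x in lebesgue. norm (indicator A x *\<^sub>R (\<bar>f x - c\<bar> powr p))
        \<le> norm (2 powr p * (indicator A x *\<^sub>R (\<bar>f x\<bar> powr p + \<bar>c\<bar> powr p)))"
      using powr_add_le[of p _ "- c"] p by (intro AE_I2) (auto simp: indicator_def)
  qed
qed

text \<open>On a set of finite measure |t| <= |t|^p + 1 provides the majorant.\<close>

lemma Lp_imp_set_integrable:
  assumes f: "f \<in> Lp p A" and A: "A \<in> sets lebesgue" "emeasure lebesgue A < \<infinity>" and p: "1 \<le> p"
  shows "set_integrable lebesgue A f"
proof -
  have "set_integrable lebesgue A (\<lambda>x. \<bar>f x\<bar> powr p + 1)"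
    using f A by (intro set_integral_add set_integrable_finite_measure_const) (auto simp: Lp_def)
  moreover have "\<bar>t\<bar> \<le> \<bar>t\<bar> powr p + 1" for t :: real
  proof (cases "\<bar>t\<bar> \<le> 1")
    case True
    then show ?thesis using powr_ge_zero[of "\<bar>t\<bar>" p] by linarith
  next
    case False
    then have "\<bar>t\<bar> powr 1 \<le> \<bar>t\<bar> powr p" using p by (intro powr_mono) auto
    with False show ?thesis by simp
  qed
  ultimately show ?thesis using f unfolding set_integrable_def Lp_def set_borel_measurable_def
    by (elim Bochner_Integration.integrable_bound) (auto simp: indicator_def)
qed

text \<open>The norm is at most n times the largest coordinate. The constant is crude, but the lemma
  only serves to make the p-th power of the gradient deviation integrable.\<close>

lemma norm_powr_le_sum:
  fixes v :: "'a::euclidean_space"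
  assumes p: "1 \<le> p"
  shows "norm v powr p \<le> real DIM('a) powr p * (\<Sum>b\<in>Basis. \<bar>v \<bullet> b\<bar> powr p)"
proof -
  obtain b where b: "b \<in> Basis" "\<And>b'. b' \<in> Basis \<Longrightarrow> \<bar>v \<bullet> b'\<bar> \<le> \<bar>v \<bullet> b\<bar>"
    using finite_imageI[OF finite_Basis, of "\<lambda>b. \<bar>v \<bullet> b\<bar>"] Max_in[of "(\<lambda>b. \<bar>v \<bullet> b\<bar>) ` Basis"] Max_ge[of "(\<lambda>b. \<bar>v \<bullet> b\<bar>) ` Basis"]
    by (metis (no_types, lifting) finite_Basis imageE image_eqI image_is_empty nonempty_Basis)
  have "norm v \<le> (\<Sum>b\<in>Basis. \<bar>v \<bullet> b\<bar>)" by (rule norm_le_l1)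
  also have "\<dots> \<le> real DIM('a) * \<bar>v \<bullet> b\<bar>" using b(2) by (rule sum_bounded_above)
  finally have "norm v powr p \<le> (real DIM('a) * \<bar>v \<bullet> b\<bar>) powr p" using p by (intro powr_mono2) auto
  also have "\<dots> = real DIM('a) powr p * \<bar>v \<bullet> b\<bar> powr p" by (simp add: powr_mult)
  also have "\<dots> \<le> real DIM('a) powr p * (\<Sum>b\<in>Basis. \<bar>v \<bullet> b\<bar> powr p)"
    using b(1) by (intro mult_left_mono member_le_sum) auto
  finally show ?thesis .
qed

text \<open>\<open>W1p\<close> provides some weak derivative in \<open>Lp\<close>; the one chosen by
  \<open>weak_partial\<close> agrees with it almost everywhere and so inherits the
  integrability.\<close>

lemma W1p_weak_partial:
  assumes \<Omega>: "open \<Omega>" and f: "f \<in> W1p p \<Omega>" and b: "b \<in> Basis"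
  shows "is_weak_partial \<Omega> b f (weak_partial \<Omega> b f)" "weak_partial \<Omega> b f \<in> Lp p \<Omega>"
proof -
  obtain g where g: "g \<in> Lp p \<Omega>" "is_weak_partial \<Omega> b f g" using f b by (auto simp: W1p_def)
  show w: "is_weak_partial \<Omega> b f (weak_partial \<Omega> b f)"
    using g(2) by (rule weak_partial_is_weak_partial)
  show "weak_partial \<Omega> b f \<in> Lp p \<Omega>"
    using Lp_cong_AE[OF g(1) _ weak_partial_unique[OF \<Omega> g(2) w]] \<Omega> by simp
qed

text \<open>Test functions on V, and their derivatives, vanish off V, so integrals over
  \<open>\<Omega>\<close> and over V coincide.\<close>

lemma is_weak_partial_subset:
  assumes w: "is_weak_partial \<Omega> b f g" and V: "V \<subseteq> \<Omega>" and b: "b \<in> Basis"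
  shows "is_weak_partial V b f g"
proof -
  have eq: "(LINT x:\<Omega>|lebesgue. u x * \<psi> x) = (LINT x:V|lebesgue. u x * \<psi> x)" if "\<psi> \<in> test_functions V" for u \<psi>
    unfolding set_lebesgue_integral_def using test_functionsD(6)[OF that] V
    by (intro Bochner_Integration.integral_cong) (auto simp: indicator_def)
  have "(LINT x:V|lebesgue. f x * partial b \<phi> x) = - (LINT x:V|lebesgue. g x * \<phi> x)"
    if \<phi>: "\<phi> \<in> test_functions V" for \<phi>
    using w \<phi> test_functions_mono[OF V] unfolding is_weak_partial_def
    by (metis (no_types, lifting) eq[OF \<phi>] eq[OF partial_in_test_functions[OF \<phi> b]] subsetD)
  moreover have "f \<in> Lp_loc 1 V" "g \<in> Lp_loc 1 V"
    using w V by (auto simp: is_weak_partial_def Lp_loc_def)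
  ultimately show ?thesis by (simp add: is_weak_partial_def)
qed

lemma W1p_subset:
  assumes f: "f \<in> W1p p \<Omega>" and V: "open V" "V \<subseteq> \<Omega>"
  shows "f \<in> W1p p V"
  using f V Lp_subset[of _ p \<Omega> V] is_weak_partial_subset[OF _ V(2)] unfolding W1p_def by fastforce

lemma W1p_imp_W1p_loc: "f \<in> W1p p \<Omega> \<Longrightarrow> f \<in> W1p_loc p \<Omega>"
  unfolding W1p_loc_def using W1p_subset closure_subset by blast

lemma set_integrable_lebesgue_AE:
  fixes u u' :: "'a::euclidean_space \<Rightarrow> real"
  assumes A: "A \<in> sets borel" and u': "set_integrable lborel A u'"
    and eq: "AE y in lebesgue. y \<in> A \<longrightarrow> u y = u' y"
  shows "set_integrable lebesgue A u"
proof -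
  have m: "(\<lambda>y. indicator A y *\<^sub>R u' y) \<in> borel_measurable lborel" and i: "integrable lebesgue (\<lambda>y. indicator A y *\<^sub>R u' y)"
    using u' by (auto simp: set_integrable_def integrable_completion)
  have ae: "AE y in lebesgue. indicator A y *\<^sub>R u' y = indicator A y *\<^sub>R u y"
    using eq by eventually_elim (auto simp: indicator_def)
  show ?thesis unfolding set_integrable_def
    by (rule integrable_cong_AE_imp[OF i borel_measurable_AE[OF borel_measurable_integrable[OF i] ae] ae])
qed

text \<open>F and G are globally integrable Borel stand-ins for f and its weak gradient on one
  closed ball around x. The vector a is the limit of the gradient there, and l is the value produced
  by \<open>pointwise_expansion\<close>, later identified with the precise representative at
  x.\<close>

locale good_point =
  fixes p :: real and \<Omega> :: "'a::euclidean_space set" and f :: "'a \<Rightarrow> real" and x a :: 'a and l :: real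
    and F :: "'a \<Rightarrow> real" and G :: "'a \<Rightarrow> 'a" and \<rho> :: real
  assumes p: "1 \<le> p" and \<Omega>: "open \<Omega>" and f: "f \<in> W1p p \<Omega>" and \<rho>: "0 < \<rho>" and cball: "cball x \<rho> \<subseteq> \<Omega>"
    and F: "integrable lborel F" and G: "integrable lborel G"
    and fF: "AE y in lebesgue. y \<in> cball x \<rho> \<longrightarrow> f y = F y"
    and gG: "\<And>b. b \<in> Basis \<Longrightarrow> AE y in lebesgue. y \<in> cball x \<rho> \<longrightarrow> weak_partial \<Omega> b f y = G y \<bullet> b"
    and weak: "\<And>\<phi> b. \<phi> \<in> test_functions (ball x \<rho>) \<Longrightarrow> b \<in> Basis \<Longrightarrow>
      (LINT y|lborel. F y * partial b \<phi> y) = - (LINT y|lborel. (G y \<bullet> b) * \<phi> y)"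
    and gradient: "\<And>\<eta>. \<eta> > 0 \<Longrightarrow> \<forall>\<^sub>F r in at_right 0.
      (\<integral>\<^sup>+y\<in>ball x r. ennreal (norm (G y - a) powr p) \<partial>lborel) \<le> ennreal (\<eta> * measure lborel (ball x r))"
    and expansion: "\<And>\<eta>. \<eta> > 0 \<Longrightarrow> \<forall>\<^sub>F r in at_right 0.
      (\<integral>\<^sup>+z\<in>ball x r. ennreal (\<bar>F z - l - a \<bullet> (z - x)\<bar> powr p) \<partial>lborel)
        \<le> ennreal (\<eta> * r powr p * measure lborel (ball x r))"

lemma Lp_imp_set_integrable_compact:
  assumes "f \<in> Lp p \<Omega>" "compact K" "K \<subseteq> \<Omega>" "1 \<le> p"
  shows "set_integrable lebesgue K f" "set_integrable lebesgue K (\<lambda>x. \<bar>f x - c\<bar> powr p)"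
proof -
  have K: "K \<in> sets lebesgue" "emeasure lebesgue K < \<infinity>"
    using lmeasurable_compact[OF assms(2)] by (simp_all only: fmeasurable_def mem_Collect_eq)
  have fK: "f \<in> Lp p K" by (rule Lp_subset[OF assms(1) K(1) assms(3)])
  show "set_integrable lebesgue K f" by (rule Lp_imp_set_integrable[OF fK K assms(4)])
  show "set_integrable lebesgue K (\<lambda>x. \<bar>f x - c\<bar> powr p)" by (rule Lp_imp_set_integrable_diff[OF fK K assms(4)])
qed

lemma weak_grad_inner: "b \<in> Basis \<Longrightarrow> weak_grad \<Omega> f z \<bullet> b = weak_partial \<Omega> b f z"
  by (simp add: weak_grad_def inner_sum_left inner_Basis if_distrib sum.delta cong: if_cong)

lemma good_pointI:
  fixes f :: "'a::euclidean_space \<Rightarrow> real"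
  assumes p: "1 \<le> p" and \<Omega>: "open \<Omega>" and f: "f \<in> W1p p \<Omega>" and x: "x \<in> \<Omega>"
    and avg: "(ball_avg (\<lambda>z. norm (weak_grad \<Omega> f z - a) powr p) x \<longlongrightarrow> 0) (at_right 0)"
  obtains l F G \<rho> where "good_point p \<Omega> f x a l F G \<rho>"
proof -
  obtain \<rho> where \<rho>: "\<rho> > 0" "cball x \<rho> \<subseteq> \<Omega>" using x \<Omega> open_contains_cball by blast
  note ball_sub = ball_subset_cball[of x \<rho>]
  have fL: "f \<in> Lp p \<Omega>" using f by (simp add: W1p_def)
  note w = W1p_weak_partial[OF \<Omega> f]
  note fi = Lp_imp_set_integrable_compact(1)[OF fL compact_cball \<rho>(2) p]
  note gi = Lp_imp_set_integrable_compact[OF w(2) compact_cball \<rho>(2) p]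
  obtain F where F: "integrable lborel F" "AE y in lebesgue. y \<in> cball x \<rho> \<longrightarrow> f y = F y"
    using set_integrable_lebesgue_borel_version[OF fi] .
  have "\<forall>b\<in>Basis. \<exists>g. integrable lborel g \<and> (AE y in lebesgue. y \<in> cball x \<rho> \<longrightarrow> weak_partial \<Omega> b f y = g y)"
    using set_integrable_lebesgue_borel_version[OF gi(1)] by metis
  then obtain g where g: "\<And>b. b \<in> Basis \<Longrightarrow> integrable lborel (g b)"
    "\<And>b. b \<in> Basis \<Longrightarrow> AE y in lebesgue. y \<in> cball x \<rho> \<longrightarrow> weak_partial \<Omega> b f y = g b y" by metis
  define G where "G y = (\<Sum>b\<in>Basis. g b y *\<^sub>R b)" for y
  have Gb: "G y \<bullet> b = g b y" if "b \<in> Basis" for y b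
    using that by (simp add: G_def inner_sum_left inner_Basis if_distrib sum.delta cong: if_cong)
  have G: "integrable lborel G" unfolding G_def[abs_def] using g(1) by auto
  have [measurable]: "G \<in> borel_measurable borel" using G by auto
  have weak: "(LINT y|lborel. F y * partial b \<phi> y) = - (LINT y|lborel. (G y \<bullet> b) * \<phi> y)"
    if \<phi>: "\<phi> \<in> test_functions (ball x \<rho>)" and b: "b \<in> Basis" for \<phi> b
  proof -
    have \<phi>\<Omega>: "\<phi> \<in> test_functions \<Omega>" using \<phi> test_functions_mono[of "ball x \<rho>" \<Omega>] ball_sub \<rho>(2) by blast
    have "(LINT y|lborel. F y * partial b \<phi> y) = (LINT y:\<Omega>|lebesgue. f y * partial b \<phi> y)"
      using F by (intro integral_mult_test_function_transfer[OF fi ball_sub \<rho>(2) _ _ partial_in_test_functions[OF \<phi> b], symmetric]) auto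
    also have "\<dots> = - (LINT y:\<Omega>|lebesgue. weak_partial \<Omega> b f y * \<phi> y)"
      using w(1)[OF b] \<phi>\<Omega> by (simp add: is_weak_partial_def)
    also have "(LINT y:\<Omega>|lebesgue. weak_partial \<Omega> b f y * \<phi> y) = (LINT y|lborel. g b y * \<phi> y)"
      using g[OF b] by (intro integral_mult_test_function_transfer[OF gi(1)[OF b] ball_sub \<rho>(2) _ _ \<phi>]) auto
    finally show ?thesis by (simp add: Gb[OF b])
  qed
  have wG: "AE y in lebesgue. y \<in> cball x \<rho> \<longrightarrow> weak_grad \<Omega> f y = G y"
  proof -
    have "AE y in lebesgue. \<forall>b\<in>Basis. y \<in> cball x \<rho> \<longrightarrow> weak_partial \<Omega> b f y = g b y"
      using g(2) by (intro AE_finite_allI) auto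
    then show ?thesis
      by eventually_elim (auto simp: weak_grad_def G_def intro!: sum.cong)
  qed
  \<comment> \<open>The hypothesis concerns a real-valued average, which would also be 0 for a
    non-integrable integrand. Integrability \<open>hi\<close>, from the p-integrability of the weak
    partial derivatives, makes it equal to the \<open>ennreal\<close> integral of the Borel
    version.\<close>
  have nn: "(\<integral>\<^sup>+y\<in>ball x r. ennreal (norm (G y - a) powr p) \<partial>lborel)
      = ennreal (ball_avg (\<lambda>z. norm (weak_grad \<Omega> f z - a) powr p) x r * measure lborel (ball x r))"
    if r: "0 < r" "r \<le> \<rho>" for r
  proof -
    let ?h = "\<lambda>y. indicator (ball x r) y *\<^sub>R (norm (weak_grad \<Omega> f y - a) powr p)"
    let ?h' = "\<lambda>y. indicator (ball x r) y *\<^sub>R (norm (G y - a) powr p)"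
    have sub: "ball x r \<subseteq> cball x \<rho>" using r(2) ball_sub subset_ball[OF r(2), of x] by blast
    have hh: "AE y in lebesgue. ?h' y = ?h y"
      using wG by eventually_elim (use sub in \<open>auto simp: indicator_def\<close>)
    have h'm: "?h' \<in> borel_measurable borel"
      by (intro borel_measurable_scaleR borel_measurable_indicator) auto
    then have hm: "?h \<in> borel_measurable lebesgue"
      using borel_measurable_AE[OF _ hh] by (simp add: measurable_completion)
    have gs: "set_integrable lebesgue (ball x r) (\<lambda>y. \<bar>weak_partial \<Omega> b f y - a \<bullet> b\<bar> powr p)" if "b \<in> Basis" for b
      by (rule set_integrable_subset[OF gi(2)[OF that] _ sub]) simp
    have "set_integrable lebesgue (ball x r) (\<lambda>y. \<Sum>b\<in>Basis. \<bar>weak_partial \<Omega> b f y - a \<bullet> b\<bar> powr p)"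
      using gs unfolding set_integrable_def scaleR_sum_right by (rule Bochner_Integration.integrable_sum)
    then have i: "integrable lebesgue (\<lambda>y. real DIM('a) powr p * (indicator (ball x r) y *\<^sub>R (\<Sum>b\<in>Basis. \<bar>weak_partial \<Omega> b f y - a \<bullet> b\<bar> powr p)))"
      unfolding set_integrable_def by (rule integrable_mult_right)
    have hi: "integrable lebesgue ?h"
    proof (rule Bochner_Integration.integrable_bound[OF i hm], intro AE_I2)
      fix y
      have "norm (weak_grad \<Omega> f y - a) powr p \<le> real DIM('a) powr p * (\<Sum>b\<in>Basis. \<bar>weak_partial \<Omega> b f y - a \<bullet> b\<bar> powr p)"
        using norm_powr_le_sum[OF p, of "weak_grad \<Omega> f y - a"] by (simp add: inner_diff_left weak_grad_inner)
      then show "norm (?h y) \<le> norm (real DIM('a) powr p * (indicator (ball x r) y *\<^sub>R (\<Sum>b\<in>Basis. \<bar>weak_partial \<Omega> b f y - a \<bullet> b\<bar> powr p)))"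
        by (auto simp: indicator_def)
    qed
    have "(\<integral>\<^sup>+y\<in>ball x r. ennreal (norm (G y - a) powr p) \<partial>lborel) = (\<integral>\<^sup>+y. ennreal (?h' y) \<partial>lebesgue)"
      by (simp only: set_nn_integral_indicator nn_integral_completion)
    also have "\<dots> = (\<integral>\<^sup>+y. ennreal (?h y) \<partial>lebesgue)"
      using hh by (intro nn_integral_cong_AE) (auto elim!: eventually_mono)
    also have "\<dots> = ennreal (integral\<^sup>L lebesgue ?h)"
      by (rule nn_integral_eq_integral[OF hi]) auto
    also have "integral\<^sup>L lebesgue ?h = ball_avg (\<lambda>z. norm (weak_grad \<Omega> f z - a) powr p) x r * measure lborel (ball x r)"
      using content_ball_pos[OF r(1), of x] by (simp add: ball_avg_def set_lebesgue_integral_def)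
    finally show ?thesis .
  qed
  have gradient: "\<forall>\<^sub>F r in at_right 0.
      (\<integral>\<^sup>+y\<in>ball x r. ennreal (norm (G y - a) powr p) \<partial>lborel) \<le> ennreal (\<eta> * measure lborel (ball x r))"
    if \<eta>: "\<eta> > 0" for \<eta>
  proof -
    have "\<forall>\<^sub>F r in at_right (0::real). r \<in> {0<..<\<rho>}"
      using \<rho>(1) by (rule eventually_at_right_real)
    with order_tendstoD(2)[OF avg \<eta>] show ?thesis
    proof eventually_elim
      case (elim r)
      then have "ball_avg (\<lambda>z. norm (weak_grad \<Omega> f z - a) powr p) x r * measure lborel (ball x r) \<le> \<eta> * measure lborel (ball x r)"
        by (intro mult_right_mono) auto
      with elim(2) show ?case by (subst nn) (auto intro: ennreal_leI)
    qed
  qed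
  obtain l where l: "\<And>\<eta>. \<eta> > 0 \<Longrightarrow> \<forall>\<^sub>F r in at_right 0.
      (\<integral>\<^sup>+z\<in>ball x r. ennreal (\<bar>F z - l - a \<bullet> (z - x)\<bar> powr p) \<partial>lborel)
        \<le> ennreal (\<eta> * r powr p * measure lborel (ball x r))"
    by (rule pointwise_expansion[OF F(1) G p \<rho>(1) weak gradient]) (assumption+, rule that)
  have "good_point p \<Omega> f x a l F G \<rho>"
  proof
    show "AE y in lebesgue. y \<in> cball x \<rho> \<longrightarrow> weak_partial \<Omega> b f y = G y \<bullet> b" if "b \<in> Basis" for b
      using g(2)[OF that] by (simp add: Gb[OF that])
  qed (fact p \<Omega> f \<rho> F G weak gradient l)+
  then show ?thesis by (rule that)
qed

context good_point
begin

lemma measurable_FG [measurable]: "F \<in> borel_measurable borel" "G \<in> borel_measurable borel"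
  using F G by auto

lemma x_in: "x \<in> \<Omega>"
  using cball \<rho> by auto

text \<open>The integrand is left open in \<open>k\<close> to cover both the deviation from l and
  the first-order remainder.\<close>

lemma nn_integral_fF:
  assumes "r \<le> \<rho>"
  shows "(\<integral>\<^sup>+z\<in>ball x r. ennreal (k z (f z)) \<partial>lebesgue) = (\<integral>\<^sup>+z\<in>ball x r. ennreal (k z (F z)) \<partial>lborel)"
proof -
  have sub: "ball x r \<subseteq> cball x \<rho>" using assms ball_subset_cball[of x \<rho>] subset_ball[OF assms, of x] by blast
  have "(\<integral>\<^sup>+z\<in>ball x r. ennreal (k z (f z)) \<partial>lebesgue) = (\<integral>\<^sup>+z\<in>ball x r. ennreal (k z (F z)) \<partial>lebesgue)"
  proof (rule nn_integral_cong_AE)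
    show "AE z in lebesgue. ennreal (k z (f z)) * indicator (ball x r) z = ennreal (k z (F z)) * indicator (ball x r) z"
      using fF by eventually_elim (use sub in \<open>auto simp: indicator_def\<close>)
  qed
  then show ?thesis by (simp add: nn_integral_completion)
qed

lemma deviation:
  assumes \<eta>: "\<eta> > 0"
  shows "\<forall>\<^sub>F r in at_right 0. (\<integral>\<^sup>+z\<in>ball x r. ennreal (\<bar>F z - l\<bar> powr p) \<partial>lborel) \<le> ennreal (\<eta> * measure lborel (ball x r))"
proof -
  \<comment> \<open>2^p comes from \<open>powr_add_le\<close>, 1 from the expansion taken with
    constant 1, and the power of |a| from the linear part. For r below 1 one has r^p <= r, so the
    radius \<open>\<eta> / C\<close> makes the total at most \<open>\<eta>\<close>.\<close>
  define C where "C = 2 powr p * (1 + norm a powr p)"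
  have C: "C > 0" by (simp add: C_def add_pos_nonneg)
  have "\<forall>\<^sub>F r in at_right 0. r \<in> {0<..<min 1 (\<eta> / C)}"
    using \<eta> C by (intro eventually_at_right_real) auto
  with expansion[OF zero_less_one] show ?thesis
  proof eventually_elim
    case (elim r)
    define V where "V = measure lborel (ball x r)"
    have r: "0 < r" "r < 1" "C * r \<le> \<eta>" using elim C by (auto simp: field_simps)
    have V0: "V \<ge> 0" by (simp add: V_def)
    have eV: "emeasure lborel (ball x r) = ennreal V"
      using emeasure_lborel_ball_finite[of x r] by (simp add: V_def emeasure_eq_ennreal_measure less_top[symmetric])
    have [measurable]: "ball x r \<in> sets borel" by simp
    have "(\<integral>\<^sup>+z\<in>ball x r. ennreal (\<bar>F z - l\<bar> powr p) \<partial>lborel)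
       \<le> (\<integral>\<^sup>+z. ennreal (2 powr p) * (ennreal (\<bar>F z - l - a \<bullet> (z - x)\<bar> powr p) * indicator (ball x r) z)
          + ennreal (2 powr p * (norm a powr p * r powr p)) * indicator (ball x r) z \<partial>lborel)"
    proof (rule nn_integral_mono)
      fix z
      have "ennreal (\<bar>F z - l\<bar> powr p) \<le> ennreal (2 powr p) * ennreal (\<bar>F z - l - a \<bullet> (z - x)\<bar> powr p)
          + ennreal (2 powr p * (norm a powr p * r powr p))" if z: "z \<in> ball x r"
      proof -
        have "\<bar>a \<bullet> (z - x)\<bar> \<le> norm a * norm (z - x)" by (rule Cauchy_Schwarz_ineq2)
        also have "\<dots> \<le> norm a * r" using z by (intro mult_left_mono) (auto simp: dist_norm norm_minus_commute)
        finally have "\<bar>a \<bullet> (z - x)\<bar> powr p \<le> (norm a * r) powr p" using p by (intro powr_mono2) auto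
        then have "\<bar>a \<bullet> (z - x)\<bar> powr p \<le> norm a powr p * r powr p" by (simp add: powr_mult)
        then have m1: "2 powr p * (\<bar>F z - l - a \<bullet> (z - x)\<bar> powr p + \<bar>a \<bullet> (z - x)\<bar> powr p) \<le>
            2 powr p * (\<bar>F z - l - a \<bullet> (z - x)\<bar> powr p + norm a powr p * r powr p)"
          by (intro mult_left_mono add_left_mono) auto
        have m2: "\<bar>F z - l\<bar> powr p \<le> 2 powr p * (\<bar>F z - l - a \<bullet> (z - x)\<bar> powr p + \<bar>a \<bullet> (z - x)\<bar> powr p)"
          using powr_add_le[of p "F z - l - a \<bullet> (z - x)" "a \<bullet> (z - x)"] p by simp
        have "\<bar>F z - l\<bar> powr p \<le> 2 powr p * \<bar>F z - l - a \<bullet> (z - x)\<bar> powr p + 2 powr p * (norm a powr p * r powr p)"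
          using order_trans[OF m2 m1] by (simp only: distrib_left)
        then have "ennreal (\<bar>F z - l\<bar> powr p) \<le> ennreal (2 powr p * \<bar>F z - l - a \<bullet> (z - x)\<bar> powr p + 2 powr p * (norm a powr p * r powr p))"
          by (rule ennreal_leI)
        then show ?thesis by (simp add: ennreal_mult)
      qed
      then show "ennreal (\<bar>F z - l\<bar> powr p) * indicator (ball x r) z \<le>
          ennreal (2 powr p) * (ennreal (\<bar>F z - l - a \<bullet> (z - x)\<bar> powr p) * indicator (ball x r) z)
          + ennreal (2 powr p * (norm a powr p * r powr p)) * indicator (ball x r) z"
        by (cases "z \<in> ball x r") simp_all
    qed
    also have "\<dots> = (\<integral>\<^sup>+z. ennreal (2 powr p) * (ennreal (\<bar>F z - l - a \<bullet> (z - x)\<bar> powr p) * indicator (ball x r) z) \<partial>lborel)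
          + (\<integral>\<^sup>+z. ennreal (2 powr p * (norm a powr p * r powr p)) * indicator (ball x r) z \<partial>lborel)"
      by (rule nn_integral_add) measurable
    also have "(\<integral>\<^sup>+z. ennreal (2 powr p) * (ennreal (\<bar>F z - l - a \<bullet> (z - x)\<bar> powr p) * indicator (ball x r) z) \<partial>lborel)
        = ennreal (2 powr p) * (\<integral>\<^sup>+z\<in>ball x r. ennreal (\<bar>F z - l - a \<bullet> (z - x)\<bar> powr p) \<partial>lborel)"
      by (rule nn_integral_cmult) measurable
    also have "(\<integral>\<^sup>+z. ennreal (2 powr p * (norm a powr p * r powr p)) * indicator (ball x r) z \<partial>lborel)
        = ennreal (2 powr p * (norm a powr p * r powr p)) * ennreal V"
      unfolding eV[symmetric] by (rule nn_integral_cmult_indicator) measurable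
    finally have "(\<integral>\<^sup>+z\<in>ball x r. ennreal (\<bar>F z - l\<bar> powr p) \<partial>lborel)
      \<le> ennreal (2 powr p) * (\<integral>\<^sup>+z\<in>ball x r. ennreal (\<bar>F z - l - a \<bullet> (z - x)\<bar> powr p) \<partial>lborel)
        + ennreal (2 powr p * (norm a powr p * r powr p)) * ennreal V" .
    also have "\<dots> \<le> ennreal (2 powr p) * ennreal (1 * r powr p * V) + ennreal (2 powr p * (norm a powr p * r powr p)) * ennreal V"
      using elim(1) by (intro add_right_mono mult_left_mono) (auto simp: V_def)
    also have "\<dots> = ennreal (2 powr p * (r powr p * V) + 2 powr p * (norm a powr p * r powr p) * V)"
      using V0 by (simp add: ennreal_mult[symmetric] ennreal_plus[symmetric] del: ennreal_plus)
    also have "\<dots> = ennreal (C * r powr p * V)"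
      by (simp add: C_def algebra_simps)
    also have "\<dots> \<le> ennreal (\<eta> * V)"
    proof (intro ennreal_leI mult_right_mono V0)
      have "r powr p \<le> r powr 1" using r p by (intro powr_mono') auto
      then have "C * r powr p \<le> C * r" using C r by (intro mult_left_mono) auto
      with r show "C * r powr p \<le> \<eta>" by simp
    qed
    finally show ?case by (simp add: V_def)
  qed
qed

lemma ball_avg_f:
  assumes "r \<le> \<rho>"
  shows "ball_avg f x r = (LINT z:ball x r|lborel. F z) / measure lborel (ball x r)"
proof -
  have sub: "ball x r \<subseteq> cball x \<rho>" using assms ball_subset_cball[of x \<rho>] subset_ball[OF assms, of x] by blast
  have ae: "AE z in lebesgue. z \<in> ball x r \<longrightarrow> f z = F z" using fF by eventually_elim (use sub in auto)
  have "set_integrable lebesgue (ball x r) f"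
    by (rule set_integrable_lebesgue_AE[OF _ set_integrable_lborel_subset[OF F] ae]) auto
  then have "integral\<^sup>L lebesgue (\<lambda>z. indicator (ball x r) z *\<^sub>R f z) = integral\<^sup>L lborel (\<lambda>z. indicator (ball x r) z *\<^sub>R F z)"
    unfolding set_integrable_def
  proof (rule integral_lebesgue_borel_version)
    show "(\<lambda>z. indicator (ball x r) z *\<^sub>R F z) \<in> borel_measurable borel"
      by (intro borel_measurable_scaleR borel_measurable_indicator) auto
    show "AE z in lebesgue. indicator (ball x r) z *\<^sub>R f z = indicator (ball x r) z *\<^sub>R F z"
      using ae by eventually_elim (auto simp: indicator_def)
  qed
  then show ?thesis by (simp add: ball_avg_def set_lebesgue_integral_def)
qed

lemma eventually_less_radius: "\<forall>\<^sub>F r in at_right 0. r \<in> {0<..<\<rho>}"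
  using \<rho> by (rule eventually_at_right_real)

lemma ball_avg_tendsto: "(ball_avg f x \<longlongrightarrow> l) (at_right 0)"
proof (rule tendstoI)
  fix e :: real assume e: "e > 0"
  then have "(e / 2) powr p > 0" by simp
  from deviation[OF this] eventually_less_radius
  show "\<forall>\<^sub>F r in at_right 0. dist (ball_avg f x r) l < e"
  proof eventually_elim
    case (elim r)
    define V where "V = measure lborel (ball x r)"
    have r: "0 < r" "r \<le> \<rho>" using elim by auto
    have V: "V > 0" using content_ball_pos[OF r(1), of x] by (simp add: V_def)
    have "ennreal (\<bar>ball_avg f x r - l\<bar> powr p) \<le> ennreal (1 / V) * (\<integral>\<^sup>+z\<in>ball x r. ennreal (\<bar>F z - l\<bar> powr p) \<partial>lborel)"
      unfolding ball_avg_f[OF r(2)] V_def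
      by (rule average_deviation[OF set_integrable_lborel_subset[OF F] r(1) p]) simp
    also have "\<dots> \<le> ennreal (1 / V) * ennreal ((e / 2) powr p * V)"
      using elim(1) by (intro mult_left_mono) (auto simp: V_def)
    also have "\<dots> = ennreal ((e / 2) powr p)" using V by (simp add: ennreal_mult[symmetric])
    finally have le: "\<bar>ball_avg f x r - l\<bar> powr p \<le> (e / 2) powr p" by simp
    have "\<bar>ball_avg f x r - l\<bar> \<le> e / 2"
      using e p by (intro powr_inverse_le_imp[OF _ _ _ le]) simp_all
    with e show ?case by (simp add: dist_real_def)
  qed
qed

lemma precise_rep_eq: "precise_rep f x = l"
proof -
  have "Lim (at_right 0) (ball_avg f x) = l"
    using ball_avg_tendsto by (intro tendsto_Lim) auto
  with ball_avg_tendsto show ?thesis unfolding precise_rep_def by auto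
qed

lemma Lp_loc: "f \<in> Lp_loc p \<Omega>"
proof -
  have "f \<in> Lp p K" if "compact K" "K \<subseteq> \<Omega>" for K
    using f that lmeasurable_compact[OF that(1)]
    by (intro Lp_subset[of f p \<Omega> K]) (simp_all only: W1p_def fmeasurable_def mem_Collect_eq)
  then show ?thesis by (simp add: Lp_loc_def)
qed

lemma is_Lp_point: "Lp_point p \<Omega> f x"
proof -
  have "((\<lambda>r. ball_avg (\<lambda>z. \<bar>f z - l\<bar> powr p) x r) \<longlongrightarrow> 0) (at_right 0)"
  proof (rule ball_avg_tendsto_0)
    fix \<eta> :: real assume "\<eta> > 0"
    from deviation[OF this] eventually_less_radius
    show "\<forall>\<^sub>F r in at_right 0. (\<integral>\<^sup>+z\<in>ball x r. ennreal (\<bar>f z - l\<bar> powr p) \<partial>lebesgue) \<le> ennreal (\<eta> * measure lborel (ball x r))"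
    proof eventually_elim
      case (elim r)
      then show ?case by (subst nn_integral_fF[where k="\<lambda>_ t. \<bar>t - l\<bar> powr p"]) auto
    qed
  qed simp
  then show ?thesis
    using ball_avg_tendsto Lp_loc x_in by (auto simp: Lp_point_def precise_rep_eq)
qed

lemma is_Lp_differentiable: "Lp_differentiable p \<Omega> f x"
proof -
  have "((\<lambda>r. ball_avg (\<lambda>z. \<bar>f z - l - a \<bullet> (z - x)\<bar> powr p / r powr p) x r) \<longlongrightarrow> 0) (at_right 0)"
  proof (rule ball_avg_tendsto_0)
    fix \<eta> :: real assume "\<eta> > 0"
    from expansion[OF this] eventually_less_radius
    show "\<forall>\<^sub>F r in at_right 0. (\<integral>\<^sup>+z\<in>ball x r. ennreal (\<bar>f z - l - a \<bullet> (z - x)\<bar> powr p / r powr p) \<partial>lebesgue)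
        \<le> ennreal (\<eta> * measure lborel (ball x r))"
    proof eventually_elim
      case (elim r)
      then have r: "0 < r" "r \<le> \<rho>" by auto
      have [measurable]: "ball x r \<in> sets borel" by simp
      have "(\<integral>\<^sup>+z\<in>ball x r. ennreal (\<bar>f z - l - a \<bullet> (z - x)\<bar> powr p / r powr p) \<partial>lebesgue)
          = (\<integral>\<^sup>+z\<in>ball x r. ennreal (\<bar>F z - l - a \<bullet> (z - x)\<bar> powr p / r powr p) \<partial>lborel)"
        by (rule nn_integral_fF[OF r(2), where k="\<lambda>z t. \<bar>t - l - a \<bullet> (z - x)\<bar> powr p / r powr p"])
      also have "\<dots> = (\<integral>\<^sup>+z. ennreal (1 / r powr p) * (ennreal (\<bar>F z - l - a \<bullet> (z - x)\<bar> powr p) * indicator (ball x r) z) \<partial>lborel)"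
        using r by (intro nn_integral_cong) (simp add: ennreal_mult[symmetric] mult.assoc[symmetric])
      also have "\<dots> = ennreal (1 / r powr p) * (\<integral>\<^sup>+z\<in>ball x r. ennreal (\<bar>F z - l - a \<bullet> (z - x)\<bar> powr p) \<partial>lborel)"
        by (rule nn_integral_cmult) measurable
      also have "\<dots> \<le> ennreal (1 / r powr p) * ennreal (\<eta> * r powr p * measure lborel (ball x r))"
        using elim(1) by (intro mult_left_mono) auto
      also have "\<dots> = ennreal (\<eta> * measure lborel (ball x r))"
        using r \<open>\<eta> > 0\<close> by (simp add: ennreal_mult[symmetric])
      finally show ?case .
    qed
  qed simp
  moreover have "linear (\<lambda>v. a \<bullet> v)" by (simp add: linear_iff inner_add_right)
  ultimately show ?thesis
    unfolding Lp_differentiable_def precise_rep_eq using Lp_loc x_in by (intro conjI exI[of _ "\<lambda>v. a \<bullet> v"])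
qed

end

text \<open>\<open>W1p_norm\<close> refers to the derivatives chosen by
  \<open>weak_partial U\<close>; uniqueness replaces them by the explicit g. The bounds are given as
  p-th powers so that the root in \<open>Lp_norm\<close> can be taken directly.\<close>

lemma W1p_normI:
  assumes p: "1 \<le> p" and U: "open U"
    and u: "u \<in> Lp p U" "(LINT y:U|lebesgue. \<bar>u y\<bar> powr p) \<le> A powr p" and A: "0 \<le> A"
    and g: "\<And>b. b \<in> Basis \<Longrightarrow> is_weak_partial U b u (g b)" "\<And>b. b \<in> Basis \<Longrightarrow> g b \<in> Lp p U"
      "\<And>b. b \<in> Basis \<Longrightarrow> (LINT y:U|lebesgue. \<bar>g b y\<bar> powr p) \<le> B powr p" and B: "0 \<le> B"
  shows "u \<in> W1p p U" "0 \<le> W1p_norm p U u" "W1p_norm p U (u :: 'a::euclidean_space \<Rightarrow> real) \<le> A + real DIM('a) * B"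
proof -
  show "u \<in> W1p p U" using u(1) g(1,2) by (auto simp: W1p_def)
  have nonneg: "0 \<le> Lp_norm p U v" for v :: "'a \<Rightarrow> real" by (simp add: Lp_norm_def)
  then show "0 \<le> W1p_norm p U u" unfolding W1p_norm_def by (intro add_nonneg_nonneg sum_nonneg)
  have le: "Lp_norm p U v \<le> C" if "(LINT y:U|lebesgue. \<bar>v y\<bar> powr p) \<le> C powr p" "0 \<le> C" for v :: "'a \<Rightarrow> real" and C
  proof -
    have "0 \<le> (LINT y:U|lebesgue. \<bar>v y\<bar> powr p)"
      unfolding set_lebesgue_integral_def by (rule Bochner_Integration.integral_nonneg) simp
    then have "Lp_norm p U v \<le> (C powr p) powr (1 / p)"
      unfolding Lp_norm_def using that(1) p by (intro powr_mono2) auto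
    also have "\<dots> = C" using that(2) p by (simp add: powr_powr)
    finally show ?thesis .
  qed
  have "Lp_norm p U (weak_partial U b u) \<le> B" if b: "b \<in> Basis" for b
  proof (rule le[OF _ B])
    have ae: "AE y in lebesgue. y \<in> U \<longrightarrow> g b y = weak_partial U b u y"
      by (rule weak_partial_unique[OF U g(1)[OF b] weak_partial_is_weak_partial[OF g(1)[OF b]]])
    have "set_integrable lebesgue U (\<lambda>y. \<bar>g b y\<bar> powr p)" using g(2)[OF b] by (simp add: Lp_def)
    moreover have "weak_partial U b u \<in> Lp p U"
      using Lp_cong_AE[OF g(2)[OF b] _ ae] U by simp
    then have "set_integrable lebesgue U (\<lambda>y. \<bar>weak_partial U b u y\<bar> powr p)" by (simp add: Lp_def)
    ultimately have "(LINT y:U|lebesgue. \<bar>g b y\<bar> powr p) = (LINT y:U|lebesgue. \<bar>weak_partial U b u y\<bar> powr p)"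
      unfolding set_lebesgue_integral_def set_integrable_def
    proof (intro integral_cong_AE)
      show "AE y in lebesgue. indicator U y *\<^sub>R \<bar>g b y\<bar> powr p = indicator U y *\<^sub>R \<bar>weak_partial U b u y\<bar> powr p"
        using ae by eventually_elim (auto simp: indicator_def)
    qed auto
    then show "(LINT y:U|lebesgue. \<bar>weak_partial U b u y\<bar> powr p) \<le> B powr p"
      using g(3)[OF b] by simp
  qed
  then have "(\<Sum>b\<in>Basis. Lp_norm p U (weak_partial U b u)) \<le> real DIM('a) * B"
    by (rule sum_bounded_above)
  with le[OF u(2) A] show "W1p_norm p U u \<le> A + real DIM('a) * B"
    by (simp add: W1p_norm_def)
qed

text \<open>The substitution y = x + h z multiplies the integral and the volume of the ball by the
  same |h|^n, so these factors cancel and the bound no longer contains h explicitly. The constant c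
  leaves room for the 1/|h|^p of the blow-up.\<close>

lemma lborel_nn_integral_ball_rescale:
  fixes x :: "'a::euclidean_space"
  assumes k[measurable]: "k \<in> borel_measurable borel" and h: "h \<noteq> 0" and U: "U \<subseteq> ball 0 R"
    and k': "\<And>z. z \<in> U \<Longrightarrow> k' z \<le> c * k (x + h *\<^sub>R z)" "0 \<le> c" and knn: "\<And>y. 0 \<le> k y"
    and le: "(\<integral>\<^sup>+y\<in>ball x (\<bar>h\<bar> * R). ennreal (k y) \<partial>lborel) \<le> ennreal (\<eta> * measure lborel (ball x (\<bar>h\<bar> * R)))"
    and R: "0 < R" and \<eta>: "0 \<le> \<eta>"
  shows "(\<integral>\<^sup>+z\<in>U. ennreal (k' z) \<partial>lborel) \<le> ennreal (c * (\<eta> * measure lborel (ball (0::'a) R)))"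
proof -
  let ?B = "ball x (\<bar>h\<bar> * R)"
  have B[measurable]: "?B \<in> sets borel" by simp
  define H where "H = \<bar>h\<bar> ^ DIM('a)"
  have H: "H > 0" using h by (simp add: H_def)
  have V: "measure lborel ?B = H * measure lborel (ball (0::'a) R)"
    using R content_ball_scale[of R "\<bar>h\<bar>" x 0] by (simp add: H_def)
  have mem: "x + h *\<^sub>R z \<in> ?B \<longleftrightarrow> z \<in> ball 0 R" for z
    using h by (simp add: dist_norm)
  have "(\<integral>\<^sup>+z\<in>U. ennreal (k' z) \<partial>lborel) \<le> (\<integral>\<^sup>+z. ennreal c * (ennreal (k (x + h *\<^sub>R z)) * indicator ?B (x + h *\<^sub>R z)) \<partial>lborel)"
  proof (rule nn_integral_mono)
    fix z
    show "ennreal (k' z) * indicator U z \<le> ennreal c * (ennreal (k (x + h *\<^sub>R z)) * indicator ?B (x + h *\<^sub>R z))"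
    proof (cases "z \<in> U")
      case True
      then have "x + h *\<^sub>R z \<in> ?B" using U mem by blast
      moreover have "ennreal (k' z) \<le> ennreal c * ennreal (k (x + h *\<^sub>R z))"
        using k'(1)[OF True] k'(2) knn by (simp add: ennreal_mult[symmetric] ennreal_leI)
      ultimately show ?thesis using True by simp
    qed simp
  qed
  also have "\<dots> = ennreal c * (\<integral>\<^sup>+z. ennreal (k (x + h *\<^sub>R z)) * indicator ?B (x + h *\<^sub>R z) \<partial>lborel)"
    by (rule nn_integral_cmult) measurable
  also have "(\<integral>\<^sup>+z. ennreal (k (x + h *\<^sub>R z)) * indicator ?B (x + h *\<^sub>R z) \<partial>lborel)
      = ennreal (1 / H) * (\<integral>\<^sup>+y\<in>?B. ennreal (k y) \<partial>lborel)"
  proof -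
    have "(\<integral>\<^sup>+y\<in>?B. ennreal (k y) \<partial>lborel)
        = ennreal H * (\<integral>\<^sup>+z. ennreal (k (x + h *\<^sub>R z)) * indicator ?B (x + h *\<^sub>R z) \<partial>lborel)"
      unfolding H_def by (rule lborel_nn_integral_affine[OF _ h]) measurable
    then show ?thesis using H by (simp add: mult.assoc[symmetric] ennreal_mult[symmetric])
  qed
  also have "ennreal c * (ennreal (1 / H) * (\<integral>\<^sup>+y\<in>?B. ennreal (k y) \<partial>lborel))
      \<le> ennreal c * (ennreal (1 / H) * ennreal (\<eta> * measure lborel ?B))"
    by (intro mult_left_mono le) auto
  also have "\<dots> = ennreal (c * (\<eta> * measure lborel (ball (0::'a) R)))"
    using H \<eta> k'(2) by (simp add: V ennreal_mult[symmetric])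
  finally show ?thesis .
qed

section \<open>Blow-ups at a good point\<close>

context good_point
begin

text \<open>The Borel version of \<open>blowup f x h z - a \<bullet> z\<close>, with F in place of
  the precise representative and l for its value at x.\<close>

definition blowup_rep :: "real \<Rightarrow> 'a \<Rightarrow> real" where
  "blowup_rep h z = (F (x + h *\<^sub>R z) - l) / h - a \<bullet> z"

lemma measurable_blowup_rep [measurable]: "blowup_rep h \<in> borel_measurable borel"
  unfolding blowup_rep_def[abs_def] by measurable

lemma affine_in_cball:
  assumes "\<bar>h\<bar> * R < \<rho>" "z \<in> ball 0 R"
  shows "x + h *\<^sub>R z \<in> ball x \<rho>"
proof -
  have "norm (h *\<^sub>R z) \<le> \<bar>h\<bar> * R" using assms(2) by (auto intro!: mult_left_mono)
  with assms(1) show ?thesis by (simp add: dist_norm)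
qed

text \<open>Both identities f* = f and f = F hold off a null set, and the affine map pulls null sets
  back to null sets. The gradient carries no power of h: the inner derivative h cancels the division
  by h.\<close>

lemma AE_blowup:
  assumes h: "h \<noteq> 0" "\<bar>h\<bar> * R < \<rho>" and U: "U \<subseteq> ball 0 R"
  shows "AE z in lebesgue. z \<in> U \<longrightarrow> blowup f x h z - a \<bullet> z = blowup_rep h z"
    and "b \<in> Basis \<Longrightarrow> AE z in lebesgue. z \<in> U \<longrightarrow> weak_partial \<Omega> b f (x + h *\<^sub>R z) - a \<bullet> b = G (x + h *\<^sub>R z) \<bullet> b - a \<bullet> b"
proof -
  have in_cball: "x + h *\<^sub>R z \<in> cball x \<rho>" "x + h *\<^sub>R z \<in> \<Omega>" if "z \<in> U" for z
    using affine_in_cball[OF h(2), of z] U that cball ball_subset_cball[of x \<rho>] by blast+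
  have f1: "f \<in> Lp_loc 1 \<Omega>"
    unfolding Lp_loc_1_iff using Lp_imp_set_integrable_compact(1)[of f p \<Omega>] f p by (simp add: W1p_def)
  have "AE y in lborel. y \<in> cball x \<rho> \<longrightarrow> f y = F y" using fF by (simp only: AE_completion_iff)
  from AE_lborel_affine[OF h(1) this, of x]
  have 1: "AE z in lebesgue. x + h *\<^sub>R z \<in> cball x \<rho> \<longrightarrow> f (x + h *\<^sub>R z) = F (x + h *\<^sub>R z)" by (rule AE_completion)
  have "AE y in lborel. y \<in> \<Omega> \<longrightarrow> precise_rep f y = f y" using AE_precise_rep[OF \<Omega> f1] by (simp only: AE_completion_iff)
  from AE_lborel_affine[OF h(1) this, of x]
  have 2: "AE z in lebesgue. x + h *\<^sub>R z \<in> \<Omega> \<longrightarrow> precise_rep f (x + h *\<^sub>R z) = f (x + h *\<^sub>R z)" by (rule AE_completion)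
  from 1 2 show "AE z in lebesgue. z \<in> U \<longrightarrow> blowup f x h z - a \<bullet> z = blowup_rep h z"
  proof eventually_elim
    case (elim z)
    then show ?case using in_cball[of z] by (simp add: blowup_def blowup_rep_def precise_rep_eq)
  qed
  assume "b \<in> Basis"
  from gG[OF this] have "AE y in lborel. y \<in> cball x \<rho> \<longrightarrow> weak_partial \<Omega> b f y = G y \<bullet> b" by (simp only: AE_completion_iff)
  from AE_lborel_affine[OF h(1) this, of x]
  have 3: "AE z in lebesgue. x + h *\<^sub>R z \<in> cball x \<rho> \<longrightarrow> weak_partial \<Omega> b f (x + h *\<^sub>R z) = G (x + h *\<^sub>R z) \<bullet> b" by (rule AE_completion)
  then show "AE z in lebesgue. z \<in> U \<longrightarrow> weak_partial \<Omega> b f (x + h *\<^sub>R z) - a \<bullet> b = G (x + h *\<^sub>R z) \<bullet> b - a \<bullet> b"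
  proof eventually_elim
    case (elim z)
    then show ?case using in_cball[of z] by simp
  qed
qed

lemma set_integrable_const_bounded:
  assumes "open U" "U \<subseteq> ball 0 R"
  shows "set_integrable lborel U (\<lambda>_ :: 'a. c :: real)"
  using set_integrable_subset[OF set_integrable_const_ball[of 0 R c], of U] assms by simp

lemma set_integrable_blowup:
  assumes h: "h \<noteq> 0" and U: "open U" "U \<subseteq> ball 0 R"
  shows "set_integrable lborel U (blowup_rep h)"
    and "set_integrable lborel U (\<lambda>z. G (x + h *\<^sub>R z) \<bullet> b - a \<bullet> b)"
proof -
  have "integrable lborel (\<lambda>z. F (x + h *\<^sub>R z))"
    using F h by (subst lborel_integrable_affine) auto
  then have 1: "set_integrable lborel U (\<lambda>z. F (x + h *\<^sub>R z))"
    using U by (intro set_integrable_lborel_subset) auto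
  have "set_integrable lborel (cball 0 R) (\<lambda>z. a \<bullet> z)"
    unfolding set_integrable_def by (rule borel_integrable_compact) (auto intro!: continuous_intros)
  then have 2: "set_integrable lborel U (\<lambda>z. a \<bullet> z)"
    by (rule set_integrable_subset) (use U in auto)
  show "set_integrable lborel U (blowup_rep h)"
    unfolding blowup_rep_def[abs_def]
    by (intro set_integral_diff set_integrable_divide 1 2 set_integrable_const_bounded[OF U])
  have "integrable lborel (\<lambda>z. G (x + h *\<^sub>R z) \<bullet> b)"
    using G h by (subst lborel_integrable_affine[of "\<lambda>y. G y \<bullet> b"]) auto
  then have 3: "set_integrable lborel U (\<lambda>z. G (x + h *\<^sub>R z) \<bullet> b)"
    using U by (intro set_integrable_lborel_subset) auto
  show "set_integrable lborel U (\<lambda>z. G (x + h *\<^sub>R z) \<bullet> b - a \<bullet> b)"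
    by (intro set_integral_diff 3 set_integrable_const_bounded[OF U])
qed

text \<open>Transport \<open>\<phi>\<close> to a test function \<open>\<psi>\<close> on the ball
  around x and use the weak derivative there: differentiating \<open>\<psi>\<close> yields exactly
  the 1/h of the blow-up, and the Jacobian |h|^n cancels. The constant l/h tests to 0 and the linear
  term contributes \<open>a \<bullet> b\<close>.\<close>

lemma integral_blowup_test_function:
  assumes h: "h \<noteq> 0" "\<bar>h\<bar> * R < \<rho>" and U: "open U" "U \<subseteq> ball 0 R"
    and \<phi>: "\<phi> \<in> test_functions U" and b: "b \<in> Basis"
  shows "(LINT z|lborel. blowup_rep h z * partial b \<phi> z) = - (LINT z|lborel. (G (x + h *\<^sub>R z) \<bullet> b - a \<bullet> b) * \<phi> z)"
proof -
  define \<psi> where "\<psi> y = \<phi> (- ((1 / h) *\<^sub>R x) + (1 / h) *\<^sub>R y)" for y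
  have undo: "- ((1 / h) *\<^sub>R x) + (1 / h) *\<^sub>R (x + h *\<^sub>R z) = z" for z
    using h by (simp add: scaleR_add_right)
  have redo: "y = x + h *\<^sub>R (- ((1 / h) *\<^sub>R x) + (1 / h) *\<^sub>R y)" for y
    using h by (simp add: scaleR_add_right scaleR_diff_right)
  have \<psi>: "\<psi> \<in> test_functions (ball x \<rho>)"
    unfolding \<psi>_def[abs_def]
  proof (rule affine_in_test_functions[OF \<phi>])
    fix y assume "- ((1 / h) *\<^sub>R x) + (1 / h) *\<^sub>R y \<in> U"
    then have "x + h *\<^sub>R (- ((1 / h) *\<^sub>R x) + (1 / h) *\<^sub>R y) \<in> ball x \<rho>"
      using affine_in_cball[OF h(2)] U(2) by blast
    then show "y \<in> ball x \<rho>" by (simp only: redo[symmetric])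
  qed (use h in auto)
  have p\<psi>: "partial b \<psi> y = (1 / h) * partial b \<phi> (- ((1 / h) *\<^sub>R x) + (1 / h) *\<^sub>R y)" for y
    unfolding \<psi>_def[abs_def] by (rule partial_affine[OF \<phi>])
  note p = partial_in_test_functions[OF \<phi> b]
  have [measurable]: "\<phi> \<in> borel_measurable borel" "partial b \<phi> \<in> borel_measurable borel"
      "\<psi> \<in> borel_measurable borel" "partial b \<psi> \<in> borel_measurable borel"
    using test_functionsD(5)[OF \<phi>] test_functionsD(5)[OF p] test_functionsD(5)[OF \<psi>]
      test_functionsD(5)[OF partial_in_test_functions[OF \<psi> b]] by auto
  have Fh: "integrable lborel (\<lambda>z. F (x + h *\<^sub>R z))" using F h by (subst lborel_integrable_affine) auto
  have Gh: "integrable lborel (\<lambda>z. G (x + h *\<^sub>R z) \<bullet> b)"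
    using G h by (subst lborel_integrable_affine[of "\<lambda>y. G y \<bullet> b"]) auto
  define H where "H = \<bar>h\<bar> ^ DIM('a)"
  have H: "H \<noteq> 0" using h by (simp add: H_def)
  have "H * (LINT z|lborel. F (x + h *\<^sub>R z) * ((1 / h) * partial b \<phi> z)) = (LINT y|lborel. F y * partial b \<psi> y)"
    using lborel_integral_affine[of "\<lambda>y. F y * partial b \<psi> y" h x] h(1)
    by (simp add: H_def p\<psi> undo[simplified])
  also have "\<dots> = - (LINT y|lborel. (G y \<bullet> b) * \<psi> y)" by (rule weak[OF \<psi> b])
  also have "(LINT y|lborel. (G y \<bullet> b) * \<psi> y) = H * (LINT z|lborel. (G (x + h *\<^sub>R z) \<bullet> b) * \<phi> z)"
    using lborel_integral_affine[of "\<lambda>y. (G y \<bullet> b) * \<psi> y" h x] h(1)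
    by (simp add: H_def \<psi>_def undo[simplified])
  finally have "H * (LINT z|lborel. F (x + h *\<^sub>R z) * ((1 / h) * partial b \<phi> z)) = H * - (LINT z|lborel. (G (x + h *\<^sub>R z) \<bullet> b) * \<phi> z)"
    by simp
  then have main: "(LINT z|lborel. F (x + h *\<^sub>R z) * ((1 / h) * partial b \<phi> z)) = - (LINT z|lborel. (G (x + h *\<^sub>R z) \<bullet> b) * \<phi> z)"
    by (simp only: mult_left_cancel[OF H])
  have ip: "integrable lborel (partial b \<phi>)" by (rule integrable_test_function[OF p])
  have i\<phi>: "integrable lborel \<phi>" by (rule integrable_test_function[OF \<phi>])
  have i1: "integrable lborel (\<lambda>z. F (x + h *\<^sub>R z) * ((1 / h) * partial b \<phi> z))"
    using integrable_mult_right[OF integrable_mult_test_function[OF Fh p], of "1 / h"] by (simp add: mult_ac)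
  have i2: "integrable lborel (\<lambda>z. (l / h) * partial b \<phi> z)" using ip by simp
  have i3: "integrable lborel (\<lambda>z. (z \<bullet> a) * partial b \<phi> z)"
    using integrable_test_function[OF mult_in_test_functions[OF _ p], of "\<lambda>z. z \<bullet> a"] Ck_inner by blast
  have i4: "integrable lborel (\<lambda>z. (G (x + h *\<^sub>R z) \<bullet> b) * \<phi> z)" by (rule integrable_mult_test_function[OF Gh \<phi>])
  have i5: "integrable lborel (\<lambda>z. (a \<bullet> b) * \<phi> z)" using i\<phi> by simp
  have "(LINT z|lborel. blowup_rep h z * partial b \<phi> z)
      = (LINT z|lborel. F (x + h *\<^sub>R z) * ((1 / h) * partial b \<phi> z) - (l / h) * partial b \<phi> z - (z \<bullet> a) * partial b \<phi> z)"
  proof (rule Bochner_Integration.integral_cong[OF refl])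
    fix z
    show "blowup_rep h z * partial b \<phi> z = F (x + h *\<^sub>R z) * ((1 / h) * partial b \<phi> z) - (l / h) * partial b \<phi> z - (z \<bullet> a) * partial b \<phi> z"
      by (simp add: blowup_rep_def inner_commute left_diff_distrib diff_divide_distrib)
  qed
  also have "\<dots> = (LINT z|lborel. F (x + h *\<^sub>R z) * ((1 / h) * partial b \<phi> z)) - (LINT z|lborel. (l / h) * partial b \<phi> z)
      - (LINT z|lborel. (z \<bullet> a) * partial b \<phi> z)"
    by (simp only: Bochner_Integration.integral_diff[OF Bochner_Integration.integrable_diff[OF i1 i2] i3]
        Bochner_Integration.integral_diff[OF i1 i2])
  also have "(LINT z|lborel. (l / h) * partial b \<phi> z) = 0"
    by (simp add: integral_partial_test_function[OF \<phi> b])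
  also have "(LINT z|lborel. (z \<bullet> a) * partial b \<phi> z) = - (LINT z|lborel. (a \<bullet> b) * \<phi> z)"
    by (rule integral_linear_partial_test_function[OF \<phi> b])
  finally have "(LINT z|lborel. blowup_rep h z * partial b \<phi> z)
      = - ((LINT z|lborel. (G (x + h *\<^sub>R z) \<bullet> b) * \<phi> z) - (LINT z|lborel. (a \<bullet> b) * \<phi> z))"
    unfolding main by simp
  also have "(LINT z|lborel. (G (x + h *\<^sub>R z) \<bullet> b) * \<phi> z) - (LINT z|lborel. (a \<bullet> b) * \<phi> z)
      = (LINT z|lborel. (G (x + h *\<^sub>R z) \<bullet> b - a \<bullet> b) * \<phi> z)"
    unfolding left_diff_distrib by (rule Bochner_Integration.integral_diff[OF i4 i5, symmetric])
  finally show ?thesis .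
qed

lemma blowup_weak_partial:
  assumes h: "h \<noteq> 0" "\<bar>h\<bar> * R < \<rho>" and U: "open U" "U \<subseteq> ball 0 R" and b: "b \<in> Basis"
  shows "is_weak_partial U b (\<lambda>z. blowup f x h z - a \<bullet> z) (\<lambda>z. weak_partial \<Omega> b f (x + h *\<^sub>R z) - a \<bullet> b)"
proof -
  note ae1 = AE_blowup(1)[OF h U(2)] and ae2 = AE_blowup(2)[OF h U(2) b]
  have Ub: "U \<in> sets borel" using U by simp
  have i1: "set_integrable lebesgue U (\<lambda>z. blowup f x h z - a \<bullet> z)"
    by (rule set_integrable_lebesgue_AE[OF Ub set_integrable_blowup(1)[OF h(1) U] ae1])
  have i2: "set_integrable lebesgue U (\<lambda>z. weak_partial \<Omega> b f (x + h *\<^sub>R z) - a \<bullet> b)"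
    by (rule set_integrable_lebesgue_AE[OF Ub set_integrable_blowup(2)[OF h(1) U] ae2])
  have loc: "v \<in> Lp_loc 1 U" if v: "set_integrable lebesgue U v" for v :: "'a \<Rightarrow> real"
    unfolding Lp_loc_1_iff
  proof (intro allI impI)
    fix K assume K: "compact K \<and> K \<subseteq> U"
    then have "K \<in> sets lebesgue" using lmeasurable_compact[of K] by (blast intro: fmeasurableD)
    then show "set_integrable lebesgue K v" using K by (blast intro: set_integrable_subset[OF v])
  qed
  have "(LINT z:U|lebesgue. (blowup f x h z - a \<bullet> z) * partial b \<phi> z)
      = - (LINT z:U|lebesgue. (weak_partial \<Omega> b f (x + h *\<^sub>R z) - a \<bullet> b) * \<phi> z)"
    if \<phi>: "\<phi> \<in> test_functions U" for \<phi>
  proof -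
    have "(LINT z:U|lebesgue. (blowup f x h z - a \<bullet> z) * partial b \<phi> z) = (LINT z|lborel. blowup_rep h z * partial b \<phi> z)"
      by (rule integral_mult_test_function_transfer[OF i1 order_refl order_refl _ ae1 partial_in_test_functions[OF \<phi> b]]) measurable
    also have "\<dots> = - (LINT z|lborel. (G (x + h *\<^sub>R z) \<bullet> b - a \<bullet> b) * \<phi> z)"
      by (rule integral_blowup_test_function[OF h U \<phi> b])
    also have "(LINT z|lborel. (G (x + h *\<^sub>R z) \<bullet> b - a \<bullet> b) * \<phi> z)
        = (LINT z:U|lebesgue. (weak_partial \<Omega> b f (x + h *\<^sub>R z) - a \<bullet> b) * \<phi> z)"
      by (rule integral_mult_test_function_transfer[OF i2 order_refl order_refl _ ae2 \<phi>, symmetric]) measurable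
    finally show ?thesis .
  qed
  with loc[OF i1] loc[OF i2] show ?thesis by (simp add: is_weak_partial_def)
qed

text \<open>At y = x + h z the quantity \<open>blowup_rep h z\<close> is the first-order remainder
  divided by h. Its bound at radius |h| R carries (|h| R)^p, of which R^p remains after division;
  hence R M for the function and M for each derivative, where M^p is the volume of the ball of
  radius R.\<close>

lemma blowup_estimate:
  assumes h: "h \<noteq> 0" "\<bar>h\<bar> * R < \<rho>" and R: "0 < R" and U: "open U" "U \<subseteq> ball 0 R" and \<delta>: "0 < \<delta>"
    and G_le: "(\<integral>\<^sup>+y\<in>ball x (\<bar>h\<bar> * R). ennreal (norm (G y - a) powr p) \<partial>lborel)
      \<le> ennreal (\<delta> powr p * measure lborel (ball x (\<bar>h\<bar> * R)))"
    and F_le: "(\<integral>\<^sup>+z\<in>ball x (\<bar>h\<bar> * R). ennreal (\<bar>F z - l - a \<bullet> (z - x)\<bar> powr p) \<partial>lborel)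
      \<le> ennreal (\<delta> powr p * (\<bar>h\<bar> * R) powr p * measure lborel (ball x (\<bar>h\<bar> * R)))"
  defines "M \<equiv> measure lborel (ball (0::'a) R) powr (1 / p)"
  shows "(\<lambda>z. blowup f x h z - a \<bullet> z) \<in> W1p p U"
    and "0 \<le> W1p_norm p U (\<lambda>z. blowup f x h z - a \<bullet> z)"
    and "W1p_norm p U (\<lambda>z. blowup f x h z - a \<bullet> z) \<le> \<delta> * (R * M + real DIM('a) * M)"
proof -
  note ae1 = AE_blowup(1)[OF h U(2)] and ae2 = AE_blowup(2)[OF h U(2)]
  have Ub: "U \<in> sets borel" using U by simp
  define V where "V = measure lborel (ball (0::'a) R)"
  have V: "V \<ge> 0" by (simp add: V_def)
  have MV: "M powr p = V" using p V by (simp add: M_def V_def[symmetric] powr_powr)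
  have M: "M \<ge> 0" by (simp add: M_def)
  have 1: "(\<integral>\<^sup>+z\<in>U. ennreal (\<bar>blowup_rep h z\<bar> powr p) \<partial>lborel) \<le> ennreal ((\<delta> * (R * M)) powr p)"
  proof -
    have "(\<integral>\<^sup>+z\<in>U. ennreal (\<bar>blowup_rep h z\<bar> powr p) \<partial>lborel) \<le> ennreal ((1 / \<bar>h\<bar> powr p) * ((\<delta> powr p * (\<bar>h\<bar> * R) powr p) * measure lborel (ball (0::'a) R)))"
    proof (rule lborel_nn_integral_ball_rescale[OF _ h(1) U(2) _ _ _ F_le R])
      fix z
      have "blowup_rep h z = (F (x + h *\<^sub>R z) - l - a \<bullet> (x + h *\<^sub>R z - x)) / h"
        using h by (simp add: blowup_rep_def diff_divide_distrib)
      then show "\<bar>blowup_rep h z\<bar> powr p \<le> 1 / \<bar>h\<bar> powr p * \<bar>F (x + h *\<^sub>R z) - l - a \<bullet> (x + h *\<^sub>R z - x)\<bar> powr p"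
        by (simp add: powr_divide)
    qed auto
    also have "(1 / \<bar>h\<bar> powr p) * ((\<delta> powr p * (\<bar>h\<bar> * R) powr p) * measure lborel (ball (0::'a) R)) = (\<delta> * (R * M)) powr p"
      using h by (simp add: powr_mult MV V_def)
    finally show ?thesis .
  qed
  have 2: "(\<integral>\<^sup>+z\<in>U. ennreal (\<bar>G (x + h *\<^sub>R z) \<bullet> b - a \<bullet> b\<bar> powr p) \<partial>lborel) \<le> ennreal ((\<delta> * M) powr p)" if b: "b \<in> Basis" for b
  proof -
    have "(\<integral>\<^sup>+z\<in>U. ennreal (\<bar>G (x + h *\<^sub>R z) \<bullet> b - a \<bullet> b\<bar> powr p) \<partial>lborel) \<le> ennreal (1 * (\<delta> powr p * measure lborel (ball (0::'a) R)))"
    proof (rule lborel_nn_integral_ball_rescale[OF _ h(1) U(2) _ _ _ G_le R])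
      fix z
      have "\<bar>G (x + h *\<^sub>R z) \<bullet> b - a \<bullet> b\<bar> \<le> norm (G (x + h *\<^sub>R z) - a)"
        unfolding inner_diff_left[symmetric] using b by (rule Basis_le_norm)
      then show "\<bar>G (x + h *\<^sub>R z) \<bullet> b - a \<bullet> b\<bar> powr p \<le> 1 * norm (G (x + h *\<^sub>R z) - a) powr p"
        using p by (simp add: powr_mono2)
    qed auto
    also have "1 * (\<delta> powr p * measure lborel (ball (0::'a) R)) = (\<delta> * M) powr p"
      by (simp add: powr_mult MV V_def)
    finally show ?thesis .
  qed
  have m2: "(\<lambda>z. G (x + h *\<^sub>R z) \<bullet> b - a \<bullet> b) \<in> borel_measurable borel" for b by measurable
  note L1 = Lp_borel_versionI[OF Ub measurable_blowup_rep ae1 1 powr_ge_zero]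
  note L2 = Lp_borel_versionI[OF Ub m2 ae2 2 powr_ge_zero]
  have nn: "0 \<le> \<delta> * (R * M)" "0 \<le> \<delta> * M" using \<delta> R M by auto
  note W = W1p_normI[OF p U(1) L1 nn(1) blowup_weak_partial[OF h U] L2 nn(2)]
  show "(\<lambda>z. blowup f x h z - a \<bullet> z) \<in> W1p p U" "0 \<le> W1p_norm p U (\<lambda>z. blowup f x h z - a \<bullet> z)"
    by (rule W; assumption)+
  have "W1p_norm p U (\<lambda>z. blowup f x h z - a \<bullet> z) \<le> \<delta> * (R * M) + real DIM('a) * (\<delta> * M)"
    by (rule W; assumption)
  then show "W1p_norm p U (\<lambda>z. blowup f x h z - a \<bullet> z) \<le> \<delta> * (R * M + real DIM('a) * M)"
    by (simp add: algebra_simps)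
qed

lemma is_W1p_differentiable: "W1p_differentiable p \<Omega> f x"
proof -
  have lin: "linear (\<lambda>v. a \<bullet> v)" by (simp add: linear_iff inner_add_right)
  have blow: "(\<forall>\<^sub>F h in at 0. (\<lambda>z. blowup f x h z - a \<bullet> z) \<in> W1p p U) \<and>
      ((\<lambda>h. W1p_norm p U (\<lambda>z. blowup f x h z - a \<bullet> z)) \<longlongrightarrow> 0) (at 0)" if U: "open U" "bounded U" for U
  proof -
    obtain R where R: "R > 0" "U \<subseteq> ball 0 R" using bounded_subset_ballD[OF U(2), of 0] by auto
    define M where "M = measure lborel (ball (0::'a) R) powr (1 / p)"
    have M: "M > 0" using R content_ball_pos[of R "0::'a"] by (simp add: M_def)
    define N where "N = R * M + real DIM('a) * M"
    have N: "N > 0" using R M by (simp add: N_def add_pos_nonneg)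
    \<comment> \<open>The rates at x concern positive radii; replacing the radius by |h| R handles h
      of both signs at once.\<close>
    have filt: "filterlim (\<lambda>h. \<bar>h\<bar> * R) (at_right 0) (at (0::real))"
    proof -
      have "((\<lambda>h. \<bar>h\<bar> * R) \<longlongrightarrow> \<bar>0\<bar> * R) (at (0::real))" by (intro tendsto_intros)
      moreover have "\<forall>\<^sub>F h in at (0::real). \<bar>h\<bar> * R \<in> {0<..}"
        using R by (auto simp: eventually_at_filter)
      ultimately show ?thesis using R by (simp add: filterlim_at eventually_at_filter)
    qed
    have est: "\<forall>\<^sub>F h in at 0. (\<lambda>z. blowup f x h z - a \<bullet> z) \<in> W1p p U \<and>
        0 \<le> W1p_norm p U (\<lambda>z. blowup f x h z - a \<bullet> z) \<and>
        W1p_norm p U (\<lambda>z. blowup f x h z - a \<bullet> z) \<le> \<delta> * N" if \<delta>: "\<delta> > 0" for \<delta>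
    proof -
      have \<delta>p: "\<delta> powr p > 0" using \<delta> by simp
      have nz: "\<forall>\<^sub>F h in at (0::real). h \<noteq> 0" by (simp add: eventually_at_filter)
      from nz filterlim_iff[THEN iffD1, OF filt, rule_format, OF eventually_less_radius]
        filterlim_iff[THEN iffD1, OF filt, rule_format, OF gradient[OF \<delta>p]]
        filterlim_iff[THEN iffD1, OF filt, rule_format, OF expansion[OF \<delta>p]]
      show ?thesis
      proof eventually_elim
        case (elim h)
        then have h: "h \<noteq> 0" "\<bar>h\<bar> * R < \<rho>" by auto
        show ?case
          unfolding N_def M_def
          using blowup_estimate[OF h R(1) U(1) R(2) \<delta> elim(3,4)] by blast
      qed
    qed
    have "((\<lambda>h. W1p_norm p U (\<lambda>z. blowup f x h z - a \<bullet> z)) \<longlongrightarrow> 0) (at 0)"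
    proof (rule tendstoI)
      fix e :: real assume e: "e > 0"
      \<comment> \<open>The factor 2 turns the non-strict bound into a strict one.\<close>
      then have "e / (2 * N) > 0" using N by simp
      from est[OF this] show "\<forall>\<^sub>F h in at 0. dist (W1p_norm p U (\<lambda>z. blowup f x h z - a \<bullet> z)) 0 < e"
      proof eventually_elim
        case (elim h)
        have "e / (2 * N) * N = e / 2" using N by simp
        with elim e show ?case by (simp add: dist_real_def)
      qed
    qed
    moreover have "\<forall>\<^sub>F h in at 0. (\<lambda>z. blowup f x h z - a \<bullet> z) \<in> W1p p U"
      using est[OF zero_less_one] by eventually_elim (elim conjE)
    ultimately show ?thesis by (intro conjI)
  qed
  show ?thesis
    unfolding W1p_differentiable_def
    using W1p_imp_W1p_loc[OF f] is_Lp_point lin blow by (intro conjI exI[of _ "\<lambda>v. a \<bullet> v"]) auto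
qed

end

lemma cap_ae_mono:
  assumes "cap_ae p \<Omega> P" "\<And>x. x \<in> \<Omega> \<Longrightarrow> P x \<Longrightarrow> Q x"
  shows "cap_ae p \<Omega> Q"
  using assms unfolding cap_ae_def by (metis DiffD1)

theorem theorem4p5:
  fixes p :: real and \<Omega> :: "'a::euclidean_space set" and f :: "'a \<Rightarrow> real"
  assumes "1 \<le> p"
    and "open \<Omega>"
    and "f \<in> RW1p p \<Omega>"
  shows "cap_ae p \<Omega> (\<lambda>x. W1p_differentiable p \<Omega> f x) \<and>
         cap_ae p \<Omega> (\<lambda>x. Lp_differentiable p \<Omega> f x)"
proof -
  have f: "f \<in> W1p p \<Omega>" and ae: "cap_ae p \<Omega> (\<lambda>x.
      (ball_avg (\<lambda>z. norm (weak_grad \<Omega> f z - precise_rep_vec (weak_grad \<Omega> f) x) powr p) x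
        \<longlongrightarrow> 0) (at_right 0))"
    using assms(3) by (auto simp: RW1p_def)
  have "W1p_differentiable p \<Omega> f x \<and> Lp_differentiable p \<Omega> f x"
    if x: "x \<in> \<Omega>" "(ball_avg (\<lambda>z. norm (weak_grad \<Omega> f z - precise_rep_vec (weak_grad \<Omega> f) x) powr p) x
        \<longlongrightarrow> 0) (at_right 0)" for x
  proof -
    obtain l F G \<rho> where "good_point p \<Omega> f x (precise_rep_vec (weak_grad \<Omega> f) x) l F G \<rho>"
      using good_pointI[OF assms(1,2) f x] .
    then show ?thesis
      using good_point.is_W1p_differentiable good_point.is_Lp_differentiable by blast
  qed
  then show ?thesis using cap_ae_mono[OF ae] by blast
qed

end
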